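(* Let $\mathcal A$ and $\mathcal B$ be additive categories. (a) Let $F\colon\mathcal A\to\mathcal B$ be an additive functor. By setting $$(\operatorname{Adel}(F))(X):=\bigl(F(X_0)\xrightarrow{F(x_0)}F(X_1)\xrightarrow{F(x_1)}F(X_2)\bigr)$$ for objects $X=(X_0\xrightarrow{x_0}X_1\xrightarrow{x_1}X_2)$ of $\operatorname{Adel}(\mathcal A)$ and $(\operatorname{Adel}(F))([f]):=[F(f_0),F(f_1),F(f_2)]$ for morphisms $[f]$ of $\operatorname{Adel}(\mathcal A)$, one obtains a (well-defined) exact functor $\operatorname{Adel}(F)\colon\operatorname{Adel}(\mathcal A)\to\operatorname{Adel}(\mathcal B)$. The equation $\operatorname{Adel}(F)^{\mathrm{op}}=\mathrm D_{\mathcal B}^{-1}\circ\operatorname{Adel}(F^{\mathrm{op}})\circ \mathrm D_{\mathcal A}$ holds. The family $\varepsilon^F\colon \mathrm I_{\mathcal B}\circ F\Rightarrow\operatorname{Adel}(F)\circ \mathrm I_{\mathcal A}$ defined by $$(\varepsilon^F)_S:=[0,1,0]\colon\bigl(0\to F(S)\to 0\bigr)\to\bigl(F(0)\to F(S)\to F(0)\bigr)\qquad(S\in\operatorname{Ob}\mathcal A)$$ is a natural isomorphism. In particular, $\mathrm I_{\mathcal B}\circ F=\operatorname{Adel}(F)\circ \mathrm I_{\mathcal A}$ if $F(0_{\mathcal A})=0_{\mathcal B}$ holds. (b) Let $F,G\colon\mathcal A\to\mathcal B$ be additive functors and let $\alpha\colon F\Rightarrow G$ be a natural transformation. By setting $(\operatorname{Adel}(\alpha))_X:=[\alpha_{X_0},\alpha_{X_1},\alpha_{X_2}]\colon(\operatorname{Adel}(F))(X)\to(\operatorname{Adel}(G))(X)$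 for $X\in\operatorname{Ob}(\operatorname{Adel}(\mathcal A))$, one obtains a natural transformation $\operatorname{Adel}(\alpha)\colon\operatorname{Adel}(F)\Rightarrow\operatorname{Adel}(G)$. If $\alpha$ is a natural isomorphism, then so is $\operatorname{Adel}(\alpha)$.
   Context: Conventions: morphisms are composed from left to right ($fg$ means first $f$, then $g$); functors are composed in the usual order. Every additive category $\mathcal A$ comes with a chosen zero object $0=0_{\mathcal A}$, and $0_{\mathcal A^{\mathrm{op}}}=0_{\mathcal A}$. An exact functor between abelian categories is an additive functor that preserves kernels and cokernels. For a functor $F$, $F^{\mathrm{op}}$ denotes the induced functor between opposite categories. Adelman category: for an additive category $\mathcal A$, let $\mathcal A^{\Delta_2}$ be the category whose objects are diagrams $A=(A_0\xrightarrow{a_0}A_1\xrightarrow{a_1}A_2)$ in $\mathcal A$ (with no condition on $a_0a_1$) and whose morphisms $f\colon A\to B$ are triples $f=(f_0,f_1,f_2)$, $f_i\colon A_i\to B_i$, with $a_0f_1=f_0b_0$ and $a_1f_2=f_1b_1$. Such an $f$ is null-homotopic if there are morphisms $s\colon A_1\to B_0$ and $t\colon A_2\to B_1$ in $\mathcal A$ with $sb_0+a_1t=f_1$. The null-homotopic morphisms form an ideal of $\mathcal A^{\Delta_2}$, and $\operatorname{Adel}(\mathcal A)$ is the quotient category of $\mathcal A^{\Delta_2}$ by this ideal (same objects; morphisms are residue classes $[f]=[f_0,f_1,f_2]$). It is an abelian category. The inclusion functor $\mathrm I_{\mathcal A}\colon\mathcal A\to\operatorname{Adel}(\mathcal A)$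 is given by $\mathrm I_{\mathcal A}(X)=(0\to X\to 0)$ and $\mathrm I_{\mathcal A}(f)=[0,f,0]$. $\mathrm D_{\mathcal A}\colon\operatorname{Adel}(\mathcal A)^{\mathrm{op}}\to\operatorname{Adel}(\mathcal A^{\mathrm{op}})$ is the isomorphism of categories given by $\mathrm D_{\mathcal A}(A)=(A_2\xrightarrow{a_1^{\mathrm{op}}}A_1\xrightarrow{a_0^{\mathrm{op}}}A_0)$ and $\mathrm D_{\mathcal A}([f]^{\mathrm{op}})=[f_2^{\mathrm{op}},f_1^{\mathrm{op}},f_0^{\mathrm{op}}]$. *)

theory Defs
  imports "HOL-Algebra.Group"
begin

section \<open>Categories\<close>

text \<open>
  A category is a record of carriers and operations on arrows. Values of the operations outside
  the carriers are irrelevant. Composition is written from left to right.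
\<close>

record ('o, 'm) cat =
  Ob    :: "'o set"
  Arr   :: "'m set"
  Dom   :: "'m \<Rightarrow> 'o"
  Cod   :: "'m \<Rightarrow> 'o"
  Ident :: "'o \<Rightarrow> 'm"
  Comp  :: "'m \<Rightarrow> 'm \<Rightarrow> 'm"  (infixl "\<cdot>\<index>" 70)

definition Hom :: "('o, 'm, 'z) cat_scheme \<Rightarrow> 'o \<Rightarrow> 'o \<Rightarrow> 'm set" where
  "Hom C X Y = {f \<in> Arr C. Dom C f = X \<and> Cod C f = Y}"

locale category =
  fixes C :: "('o, 'm, 'z) cat_scheme" (structure)
  assumes Dom_Ob: "f \<in> Arr C \<Longrightarrow> Dom C f \<in> Ob C"
    and Cod_Ob: "f \<in> Arr C \<Longrightarrow> Cod C f \<in> Ob C"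
    and Ident_Hom: "X \<in> Ob C \<Longrightarrow> Ident C X \<in> Hom C X X"
    and Comp_Hom: "f \<in> Hom C X Y \<Longrightarrow> g \<in> Hom C Y Z \<Longrightarrow> f \<cdot> g \<in> Hom C X Z"
    and Ident_left: "f \<in> Hom C X Y \<Longrightarrow> Ident C X \<cdot> f = f"
    and Ident_right: "f \<in> Hom C X Y \<Longrightarrow> f \<cdot> Ident C Y = f"
    and Comp_assoc: "f \<in> Hom C W X \<Longrightarrow> g \<in> Hom C X Y \<Longrightarrow> h \<in> Hom C Y Z \<Longrightarrow>
                       (f \<cdot> g) \<cdot> h = f \<cdot> (g \<cdot> h)"

definition iso_arrow :: "('o, 'm, 'z) cat_scheme \<Rightarrow> 'm \<Rightarrow> bool" where
  "iso_arrow C f \<longleftrightarrow> f \<in> Arr C \<and>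
     (\<exists>g \<in> Hom C (Cod C f) (Dom C f).
        f \<cdot>\<^bsub>C\<^esub> g = Ident C (Dom C f) \<and> g \<cdot>\<^bsub>C\<^esub> f = Ident C (Cod C f))"

definition mono_arrow :: "('o, 'm, 'z) cat_scheme \<Rightarrow> 'm \<Rightarrow> bool" where
  "mono_arrow C f \<longleftrightarrow> f \<in> Arr C \<and>
     (\<forall>T. \<forall>u \<in> Hom C T (Dom C f). \<forall>v \<in> Hom C T (Dom C f).
        u \<cdot>\<^bsub>C\<^esub> f = v \<cdot>\<^bsub>C\<^esub> f \<longrightarrow> u = v)"

definition epi_arrow :: "('o, 'm, 'z) cat_scheme \<Rightarrow> 'm \<Rightarrow> bool" where
  "epi_arrow C f \<longleftrightarrow> f \<in> Arr C \<and>
     (\<forall>T. \<forall>u \<in> Hom C (Cod C f) T. \<forall>v \<in> Hom C (Cod C f) T.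
        f \<cdot>\<^bsub>C\<^esub> u = f \<cdot>\<^bsub>C\<^esub> v \<longrightarrow> u = v)"


section \<open>Additive and abelian categories\<close>

text \<open>The field \<open>ZeroOb\<close> is the chosen zero object.\<close>

record ('o, 'm) addcat = "('o, 'm) cat" +
  Add     :: "'m \<Rightarrow> 'm \<Rightarrow> 'm"  (infixl "\<boxplus>\<index>" 65)
  ZeroArr :: "'o \<Rightarrow> 'o \<Rightarrow> 'm"
  ZeroOb  :: "'o"

definition hom_group :: "('o, 'm, 'z) addcat_scheme \<Rightarrow> 'o \<Rightarrow> 'o \<Rightarrow> 'm monoid" where
  "hom_group C X Y = \<lparr>carrier = Hom C X Y, monoid.mult = Add C, one = ZeroArr C X Y\<rparr>"

definition Diff :: "('o, 'm, 'z) addcat_scheme \<Rightarrow> 'm \<Rightarrow> 'm \<Rightarrow> 'm" where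
  "Diff C f g = f \<boxplus>\<^bsub>C\<^esub> inv\<^bsub>hom_group C (Dom C g) (Cod C g)\<^esub> g"

locale preadditive_category = category C
  for C :: "('o, 'm, 'z) addcat_scheme" (structure) +
  assumes hom_comm_group: "X \<in> Ob C \<Longrightarrow> Y \<in> Ob C \<Longrightarrow> comm_group (hom_group C X Y)"
    and Comp_Add_left: "f \<in> Hom C X Y \<Longrightarrow> f' \<in> Hom C X Y \<Longrightarrow> g \<in> Hom C Y Z \<Longrightarrow>
                          (f \<boxplus> f') \<cdot> g = f \<cdot> g \<boxplus> f' \<cdot> g"
    and Comp_Add_right: "f \<in> Hom C X Y \<Longrightarrow> g \<in> Hom C Y Z \<Longrightarrow> g' \<in> Hom C Y Z \<Longrightarrow>
                          f \<cdot> (g \<boxplus> g') = f \<cdot> g \<boxplus> f \<cdot> g'"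

definition zero_object :: "('o, 'm, 'z) cat_scheme \<Rightarrow> 'o \<Rightarrow> bool" where
  "zero_object C Z \<longleftrightarrow> Z \<in> Ob C \<and>
     (\<forall>X \<in> Ob C. (\<exists>!f. f \<in> Hom C X Z) \<and> (\<exists>!f. f \<in> Hom C Z X))"

definition biproduct ::
  "('o, 'm, 'z) addcat_scheme \<Rightarrow> 'o \<Rightarrow> 'o \<Rightarrow> 'o \<Rightarrow> 'm \<Rightarrow> 'm \<Rightarrow> 'm \<Rightarrow> 'm \<Rightarrow> bool" where
  "biproduct C X Y S i j p q \<longleftrightarrow>
     S \<in> Ob C \<and> i \<in> Hom C X S \<and> j \<in> Hom C Y S \<and> p \<in> Hom C S X \<and> q \<in> Hom C S Y \<and>
     i \<cdot>\<^bsub>C\<^esub> p = Ident C X \<and> j \<cdot>\<^bsub>C\<^esub> q = Ident C Y \<and>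
     i \<cdot>\<^bsub>C\<^esub> q = ZeroArr C X Y \<and> j \<cdot>\<^bsub>C\<^esub> p = ZeroArr C Y X \<and>
     p \<cdot>\<^bsub>C\<^esub> i \<boxplus>\<^bsub>C\<^esub> q \<cdot>\<^bsub>C\<^esub> j = Ident C S"

locale additive_category = preadditive_category +
  assumes ZeroOb_zero: "zero_object C (ZeroOb C)"
    and biproducts: "X \<in> Ob C \<Longrightarrow> Y \<in> Ob C \<Longrightarrow> \<exists>S i j p q. biproduct C X Y S i j p q"

definition kernel_arrow :: "('o, 'm, 'z) addcat_scheme \<Rightarrow> 'm \<Rightarrow> 'm \<Rightarrow> bool" where
  "kernel_arrow C f k \<longleftrightarrow> f \<in> Arr C \<and> k \<in> Arr C \<and> Cod C k = Dom C f \<and>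
     k \<cdot>\<^bsub>C\<^esub> f = ZeroArr C (Dom C k) (Cod C f) \<and>
     (\<forall>T. \<forall>t \<in> Hom C T (Dom C f). t \<cdot>\<^bsub>C\<^esub> f = ZeroArr C T (Cod C f) \<longrightarrow>
        (\<exists>!u. u \<in> Hom C T (Dom C k) \<and> u \<cdot>\<^bsub>C\<^esub> k = t))"

definition cokernel_arrow :: "('o, 'm, 'z) addcat_scheme \<Rightarrow> 'm \<Rightarrow> 'm \<Rightarrow> bool" where
  "cokernel_arrow C f c \<longleftrightarrow> f \<in> Arr C \<and> c \<in> Arr C \<and> Dom C c = Cod C f \<and>
     f \<cdot>\<^bsub>C\<^esub> c = ZeroArr C (Dom C f) (Cod C c) \<and>
     (\<forall>T. \<forall>t \<in> Hom C (Cod C f) T. f \<cdot>\<^bsub>C\<^esub> t = ZeroArr C (Dom C f) T \<longrightarrow>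
        (\<exists>!u. u \<in> Hom C (Cod C c) T \<and> c \<cdot>\<^bsub>C\<^esub> u = t))"

locale abelian_category = additive_category +
  assumes kernels: "f \<in> Arr C \<Longrightarrow> \<exists>k. kernel_arrow C f k"
    and cokernels: "f \<in> Arr C \<Longrightarrow> \<exists>c. cokernel_arrow C f c"
    and mono_normal: "mono_arrow C f \<Longrightarrow> \<exists>g. kernel_arrow C g f"
    and epi_normal: "epi_arrow C f \<Longrightarrow> \<exists>g. cokernel_arrow C g f"


section \<open>Functors and natural transformations\<close>

record ('o, 'm, 'p, 'n) fctr =
  obj_map :: "'o \<Rightarrow> 'p"
  arr_map :: "'m \<Rightarrow> 'n"

locale cat_functor = A: category A + B: category B
  for A :: "('o, 'm, 'y) cat_scheme" and B :: "('p, 'n, 'z) cat_scheme" +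
  fixes F :: "('o, 'm, 'p, 'n) fctr"
  assumes obj_map_Ob: "X \<in> Ob A \<Longrightarrow> obj_map F X \<in> Ob B"
    and arr_map_Hom: "f \<in> Hom A X Y \<Longrightarrow> arr_map F f \<in> Hom B (obj_map F X) (obj_map F Y)"
    and arr_map_Ident: "X \<in> Ob A \<Longrightarrow> arr_map F (Ident A X) = Ident B (obj_map F X)"
    and arr_map_Comp: "f \<in> Hom A X Y \<Longrightarrow> g \<in> Hom A Y Z \<Longrightarrow>
                         arr_map F (f \<cdot>\<^bsub>A\<^esub> g) = arr_map F f \<cdot>\<^bsub>B\<^esub> arr_map F g"

locale additive_functor = A: additive_category A + B: additive_category B + cat_functor A B F
  for A :: "('o, 'm, 'y) addcat_scheme" and B :: "('p, 'n, 'z) addcat_scheme" and F +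
  assumes arr_map_Add: "f \<in> Hom A X Y \<Longrightarrow> g \<in> Hom A X Y \<Longrightarrow>
                          arr_map F (f \<boxplus>\<^bsub>A\<^esub> g) = arr_map F f \<boxplus>\<^bsub>B\<^esub> arr_map F g"

locale exact_functor = A: abelian_category A + B: abelian_category B + additive_functor A B F
  for A :: "('o, 'm, 'y) addcat_scheme" and B :: "('p, 'n, 'z) addcat_scheme" and F +
  assumes preserves_kernels:
      "kernel_arrow A f k \<Longrightarrow> kernel_arrow B (arr_map F f) (arr_map F k)"
    and preserves_cokernels:
      "cokernel_arrow A f c \<Longrightarrow> cokernel_arrow B (arr_map F f) (arr_map F c)"

locale nat_trans = F: cat_functor A B F + G: cat_functor A B G
  for A :: "('o, 'm, 'y) cat_scheme" and B :: "('p, 'n, 'z) cat_scheme" and F G +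
  fixes \<alpha> :: "'o \<Rightarrow> 'n"
  assumes component_Hom: "X \<in> Ob A \<Longrightarrow> \<alpha> X \<in> Hom B (obj_map F X) (obj_map G X)"
    and naturality: "f \<in> Hom A X Y \<Longrightarrow> arr_map F f \<cdot>\<^bsub>B\<^esub> \<alpha> Y = \<alpha> X \<cdot>\<^bsub>B\<^esub> arr_map G f"

locale nat_iso = nat_trans +
  assumes component_iso: "X \<in> Ob A \<Longrightarrow> iso_arrow B (\<alpha> X)"

definition comp_fctr ::
  "('p, 'n, 'q, 'r) fctr \<Rightarrow> ('o, 'm, 'p, 'n) fctr \<Rightarrow> ('o, 'm, 'q, 'r) fctr" where
  "comp_fctr G F = \<lparr>obj_map = obj_map G \<circ> obj_map F, arr_map = arr_map G \<circ> arr_map F\<rparr>"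

text \<open>
  The inverse of an isomorphism of categories with source \<open>C\<close>, i.e. of a functor that is bijective
  on objects and on arrows.
\<close>

definition inv_fctr ::
  "('o, 'm, 'y) cat_scheme \<Rightarrow> ('o, 'm, 'p, 'n) fctr \<Rightarrow> ('p, 'n, 'o, 'm) fctr" where
  "inv_fctr C F = \<lparr>obj_map = inv_into (Ob C) (obj_map F), arr_map = inv_into (Arr C) (arr_map F)\<rparr>"

text \<open>Equality of functors with source \<open>C\<close>; values outside the carriers of \<open>C\<close> are ignored.\<close>

definition fctr_eq ::
  "('o, 'm, 'y) cat_scheme \<Rightarrow> ('o, 'm, 'p, 'n) fctr \<Rightarrow> ('o, 'm, 'p, 'n) fctr \<Rightarrow> bool" where
  "fctr_eq C F G \<longleftrightarrow> (\<forall>X \<in> Ob C. obj_map F X = obj_map G X) \<and>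
                      (\<forall>f \<in> Arr C. arr_map F f = arr_map G f)"

text \<open>
  An arrow \<open>f\<close> of \<open>C\<close> also represents the arrow \<open>f\<^sup>o\<^sup>p\<close> of the opposite category. Hence the
  opposite of a functor has the same underlying maps.
\<close>

definition op_cat :: "('o, 'm) addcat \<Rightarrow> ('o, 'm) addcat" where
  "op_cat C = \<lparr>Ob = Ob C, Arr = Arr C, Dom = Cod C, Cod = Dom C, Ident = Ident C,
     Comp = (\<lambda>f g. g \<cdot>\<^bsub>C\<^esub> f), Add = Add C, ZeroArr = (\<lambda>X Y. ZeroArr C Y X), ZeroOb = ZeroOb C\<rparr>"

definition op_fctr :: "('o, 'm, 'p, 'n) fctr \<Rightarrow> ('o, 'm, 'p, 'n) fctr" where
  "op_fctr F = F"


section \<open>The quotient of an additive category by an ideal\<close>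

definition ideal_rel :: "('o, 'm) addcat \<Rightarrow> 'm set \<Rightarrow> ('m \<times> 'm) set" where
  "ideal_rel C I = {(f, g). f \<in> Arr C \<and> g \<in> Arr C \<and> Dom C f = Dom C g \<and> Cod C f = Cod C g \<and>
                            Diff C f g \<in> I}"

definition residue_class :: "('o, 'm) addcat \<Rightarrow> 'm set \<Rightarrow> 'm \<Rightarrow> 'm set" where
  "residue_class C I f = ideal_rel C I `` {f}"

text \<open>
  Residue classes are nonempty sets of parallel arrows. An operation on representatives that
  respects the ideal is lifted by taking the union of the resulting classes, which all coincide.
\<close>

definition quotient_cat :: "('o, 'm) addcat \<Rightarrow> 'm set \<Rightarrow> ('o, 'm set) addcat" where
  "quotient_cat C I =
     \<lparr>Ob = Ob C,
      Arr = Arr C // ideal_rel C I,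
      Dom = (\<lambda>c. the_elem (Dom C ` c)),
      Cod = (\<lambda>c. the_elem (Cod C ` c)),
      Ident = (\<lambda>X. residue_class C I (Ident C X)),
      Comp = (\<lambda>c d. \<Union>f\<in>c. \<Union>g\<in>d. residue_class C I (f \<cdot>\<^bsub>C\<^esub> g)),
      Add = (\<lambda>c d. \<Union>f\<in>c. \<Union>g\<in>d. residue_class C I (f \<boxplus>\<^bsub>C\<^esub> g)),
      ZeroArr = (\<lambda>X Y. residue_class C I (ZeroArr C X Y)),
      ZeroOb = ZeroOb C\<rparr>"


section \<open>The Adelman category\<close>

text \<open>
  \<open>Diag a\<^sub>0 a\<^sub>1\<close> is the diagram of two composable arrows \<open>a\<^sub>0\<close>, \<open>a\<^sub>1\<close>; its vertices are recovered
  from the arrows. \<open>DMor A B f\<^sub>0 f\<^sub>1 f\<^sub>2\<close> is the triple \<open>(f\<^sub>0, f\<^sub>1, f\<^sub>2)\<close> together with its source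
  and target.
\<close>

datatype 'm diag = Diag (edge0: 'm) (edge1: 'm)

datatype 'm dmor = DMor (src: "'m diag") (tgt: "'m diag") (comp0: 'm) (comp1: 'm) (comp2: 'm)

definition vert0 :: "('o, 'm) addcat \<Rightarrow> 'm diag \<Rightarrow> 'o" where
  "vert0 C A = Dom C (edge0 A)"

definition vert1 :: "('o, 'm) addcat \<Rightarrow> 'm diag \<Rightarrow> 'o" where
  "vert1 C A = Cod C (edge0 A)"

definition vert2 :: "('o, 'm) addcat \<Rightarrow> 'm diag \<Rightarrow> 'o" where
  "vert2 C A = Cod C (edge1 A)"

definition diagrams :: "('o, 'm) addcat \<Rightarrow> 'm diag set" where
  "diagrams C = {Diag a0 a1 | a0 a1. a0 \<in> Arr C \<and> a1 \<in> Arr C \<and> Cod C a0 = Dom C a1}"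

definition diagram_morphisms :: "('o, 'm) addcat \<Rightarrow> 'm dmor set" where
  "diagram_morphisms C = {DMor A B f0 f1 f2 | A B f0 f1 f2.
     A \<in> diagrams C \<and> B \<in> diagrams C \<and>
     f0 \<in> Hom C (vert0 C A) (vert0 C B) \<and>
     f1 \<in> Hom C (vert1 C A) (vert1 C B) \<and>
     f2 \<in> Hom C (vert2 C A) (vert2 C B) \<and>
     edge0 A \<cdot>\<^bsub>C\<^esub> f1 = f0 \<cdot>\<^bsub>C\<^esub> edge0 B \<and>
     edge1 A \<cdot>\<^bsub>C\<^esub> f2 = f1 \<cdot>\<^bsub>C\<^esub> edge1 B}"

definition Delta2 :: "('o, 'm) addcat \<Rightarrow> ('m diag, 'm dmor) addcat" where
  "Delta2 C =
     \<lparr>Ob = diagrams C,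
      Arr = diagram_morphisms C,
      Dom = src,
      Cod = tgt,
      Ident = (\<lambda>A. DMor A A (Ident C (vert0 C A)) (Ident C (vert1 C A)) (Ident C (vert2 C A))),
      Comp = (\<lambda>f g. DMor (src f) (tgt g)
                (comp0 f \<cdot>\<^bsub>C\<^esub> comp0 g) (comp1 f \<cdot>\<^bsub>C\<^esub> comp1 g) (comp2 f \<cdot>\<^bsub>C\<^esub> comp2 g)),
      Add = (\<lambda>f g. DMor (src f) (tgt f)
                (comp0 f \<boxplus>\<^bsub>C\<^esub> comp0 g) (comp1 f \<boxplus>\<^bsub>C\<^esub> comp1 g) (comp2 f \<boxplus>\<^bsub>C\<^esub> comp2 g)),
      ZeroArr = (\<lambda>A B. DMor A B (ZeroArr C (vert0 C A) (vert0 C B))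
                  (ZeroArr C (vert1 C A) (vert1 C B)) (ZeroArr C (vert2 C A) (vert2 C B))),
      ZeroOb = Diag (ZeroArr C (ZeroOb C) (ZeroOb C)) (ZeroArr C (ZeroOb C) (ZeroOb C))\<rparr>"

definition null_homotopic :: "('o, 'm) addcat \<Rightarrow> 'm dmor set" where
  "null_homotopic C = {f \<in> diagram_morphisms C.
     \<exists>s \<in> Hom C (vert1 C (src f)) (vert0 C (tgt f)).
     \<exists>t \<in> Hom C (vert2 C (src f)) (vert1 C (tgt f)).
       s \<cdot>\<^bsub>C\<^esub> edge0 (tgt f) \<boxplus>\<^bsub>C\<^esub> edge1 (src f) \<cdot>\<^bsub>C\<^esub> t = comp1 f}"

definition Adel :: "('o, 'm) addcat \<Rightarrow> ('m diag, 'm dmor set) addcat" where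
  "Adel C = quotient_cat (Delta2 C) (null_homotopic C)"

definition adel_class :: "('o, 'm) addcat \<Rightarrow> 'm dmor \<Rightarrow> 'm dmor set" where
  "adel_class C f = residue_class (Delta2 C) (null_homotopic C) f"

definition Adel_inclusion :: "('o, 'm) addcat \<Rightarrow> ('o, 'm, 'm diag, 'm dmor set) fctr" where
  "Adel_inclusion C =
     (let Z = ZeroOb C; I = (\<lambda>X. Diag (ZeroArr C Z X) (ZeroArr C X Z)) in
      \<lparr>obj_map = I,
       arr_map = (\<lambda>f. adel_class C
          (DMor (I (Dom C f)) (I (Cod C f)) (ZeroArr C Z Z) f (ZeroArr C Z Z)))\<rparr>)"

text \<open>The functor \<open>D\<^sub>C\<close> from \<open>op_cat (Adel C)\<close> to \<open>Adel (op_cat C)\<close>.\<close>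

definition diag_dual :: "'m diag \<Rightarrow> 'm diag" where
  "diag_dual A = Diag (edge1 A) (edge0 A)"

definition dmor_dual :: "'m dmor \<Rightarrow> 'm dmor" where
  "dmor_dual f = DMor (diag_dual (tgt f)) (diag_dual (src f)) (comp2 f) (comp1 f) (comp0 f)"

definition Adel_dual ::
  "('o, 'm) addcat \<Rightarrow> ('m diag, 'm dmor set, 'm diag, 'm dmor set) fctr" where
  "Adel_dual C = \<lparr>obj_map = diag_dual,
                  arr_map = (\<lambda>c. \<Union>f\<in>c. adel_class (op_cat C) (dmor_dual f))\<rparr>"

text \<open>\<open>Adel_fctr B F\<close> is \<open>Adel(F)\<close> for a functor \<open>F\<close> with target \<open>B\<close>.\<close>

definition diag_image :: "('o, 'm, 'p, 'n) fctr \<Rightarrow> 'm diag \<Rightarrow> 'n diag" where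
  "diag_image F X = Diag (arr_map F (edge0 X)) (arr_map F (edge1 X))"

definition dmor_image :: "('o, 'm, 'p, 'n) fctr \<Rightarrow> 'm dmor \<Rightarrow> 'n dmor" where
  "dmor_image F f = DMor (diag_image F (src f)) (diag_image F (tgt f))
     (arr_map F (comp0 f)) (arr_map F (comp1 f)) (arr_map F (comp2 f))"

definition Adel_fctr ::
  "('p, 'n) addcat \<Rightarrow> ('o, 'm, 'p, 'n) fctr \<Rightarrow> ('m diag, 'm dmor set, 'n diag, 'n dmor set) fctr" where
  "Adel_fctr B F = \<lparr>obj_map = diag_image F,
                    arr_map = (\<lambda>c. \<Union>f\<in>c. adel_class B (dmor_image F f))\<rparr>"

definition Adel_epsilon ::
  "('o, 'm) addcat \<Rightarrow> ('p, 'n) addcat \<Rightarrow> ('o, 'm, 'p, 'n) fctr \<Rightarrow> 'o \<Rightarrow> 'n dmor set" where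
  "Adel_epsilon A B F S = adel_class B
     (DMor (obj_map (Adel_inclusion B) (obj_map F S))
           (obj_map (Adel_fctr B F) (obj_map (Adel_inclusion A) S))
           (ZeroArr B (ZeroOb B) (obj_map F (ZeroOb A)))
           (Ident B (obj_map F S))
           (ZeroArr B (ZeroOb B) (obj_map F (ZeroOb A))))"

definition Adel_nat ::
  "('o, 'm) addcat \<Rightarrow> ('p, 'n) addcat \<Rightarrow> ('o, 'm, 'p, 'n) fctr \<Rightarrow> ('o, 'm, 'p, 'n) fctr \<Rightarrow>
   ('o \<Rightarrow> 'n) \<Rightarrow> 'm diag \<Rightarrow> 'n dmor set" where
  "Adel_nat A B F G \<alpha> X = adel_class B
     (DMor (obj_map (Adel_fctr B F) X) (obj_map (Adel_fctr B G) X)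
           (\<alpha> (vert0 A X)) (\<alpha> (vert1 A X)) (\<alpha> (vert2 A X)))"

end

theory Submission
  imports Defs
begin

text \<open>
  The kernel of an arrow of \<open>Adel(A)\<close> is given by biproducts and edges alone, so \<open>Adel(F)\<close> maps this
  kernel to a kernel of the same form, and every other kernel is isomorphic to it. If the kernel of a
  monomorphism \<open>f\<close> is null-homotopic, the null-homotopy provides the arrows needed to factor through
  \<open>f\<close> whatever the cokernel of \<open>f\<close> annihilates, so \<open>f\<close> is a kernel. The statements about
  cokernels and epimorphisms follow along the isomorphism between \<open>Adel(A)\<^sup>o\<^sup>p\<close> and
  \<open>Adel(A\<^sup>o\<^sup>p)\<close>.
\<close>

section \<open>Arrows of preadditive categories\<close>

text \<open>The locale \<open>exact_functor\<close> contains \<open>abelian_category\<close> for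
  source and target, so the Adelman category has to be proved abelian along the way. Two features of
  homotopy make explicit computation feasible. The condition concerns only \<open>comp1\<close>:
  parallel diagram morphisms with equal middle components have the same class, so the outer
  components of a constructed morphism only have to make the squares commute. And a homotopy is a
  pair of arrows of the base category, hence data: the vanishing of a composite supplies the arrows
  from which factorisations are assembled.

  Biproducts are only known to exist. The kernel formula is therefore a relation,
  \<open>kernel_data\<close>, satisfied for every choice of biproducts; an additive functor sends
  biproducts to biproducts and so respects the relation, whereas it would not respect an arbitrary
  choice. Reversing arrows exchanges the two halves \<open>s\<close> and \<open>t\<close> of a
  homotopy, so the passage to the opposite base category needs no new homotopies.\<close>

lemma Hom_iff: "f \<in> Hom C X Y \<longleftrightarrow> f \<in> Arr C \<and> Dom C f = X \<and> Cod C f = Y"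
  by (simp add: Hom_def)

lemma arr_in_Hom: "f \<in> Arr C \<Longrightarrow> f \<in> Hom C (Dom C f) (Cod C f)"
  by (simp add: Hom_iff)

context category
begin

lemma Ident_simps [simp]:
  assumes "X \<in> Ob C"
  shows "Ident C X \<in> Arr C" and "Dom C (Ident C X) = X" and "Cod C (Ident C X) = X"
  using Ident_Hom[OF assms] by (auto simp: Hom_iff)

lemma Comp_simps [simp]:
  assumes "f \<in> Arr C" and "g \<in> Arr C" and "Cod C f = Dom C g"
  shows "f \<cdot> g \<in> Arr C" and "Dom C (f \<cdot> g) = Dom C f" and "Cod C (f \<cdot> g) = Cod C g"
  using Comp_Hom[of f "Dom C f" "Cod C f" g "Cod C g"] assms by (auto simp: Hom_iff)

lemma Comp_Ident [simp]:
  assumes "f \<in> Arr C"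
  shows "Dom C f = X \<Longrightarrow> Ident C X \<cdot> f = f" and "Cod C f = X \<Longrightarrow> f \<cdot> Ident C X = f"
  using Ident_left[OF arr_in_Hom[OF assms]] Ident_right[OF arr_in_Hom[OF assms]] by auto

lemma Comp_Comp:
  assumes "f \<in> Arr C" and "g \<in> Arr C" and "h \<in> Arr C"
    and "Cod C f = Dom C g" and "Cod C g = Dom C h"
  shows "(f \<cdot> g) \<cdot> h = f \<cdot> (g \<cdot> h)"
  using Comp_assoc[of f "Dom C f" "Cod C f" g "Cod C g" h "Cod C h"] assms by (auto simp: Hom_iff)

lemma iso_arrowI:
  assumes "f \<in> Hom C X Y" and "g \<in> Hom C Y X" and "f \<cdot> g = Ident C X" and "g \<cdot> f = Ident C Y"
  shows "iso_arrow C f"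
  using assms unfolding iso_arrow_def by (auto simp: Hom_iff)

end

text \<open>The hom group is that of the arrow's own source and target, so no objects have to be
  supplied and \<open>Diff\<close> becomes a sum with \<open>Neg\<close>.\<close>

definition Neg :: "('o, 'm, 'z) addcat_scheme \<Rightarrow> 'm \<Rightarrow> 'm" where
  "Neg C f = inv\<^bsub>hom_group C (Dom C f) (Cod C f)\<^esub> f"

lemma Diff_eq: "Diff C f g = f \<boxplus>\<^bsub>C\<^esub> Neg C g"
  by (simp add: Diff_def Neg_def)

context preadditive_category
begin

lemma hom_groupD:
  assumes "X \<in> Ob C" and "Y \<in> Ob C"
  shows "ZeroArr C X Y \<in> Hom C X Y"
    and "f \<in> Hom C X Y \<Longrightarrow> g \<in> Hom C X Y \<Longrightarrow> f \<boxplus> g \<in> Hom C X Y"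
    and "f \<in> Hom C X Y \<Longrightarrow> ZeroArr C X Y \<boxplus> f = f"
    and "f \<in> Hom C X Y \<Longrightarrow> g \<in> Hom C X Y \<Longrightarrow> f \<boxplus> g = g \<boxplus> f"
    and "f \<in> Hom C X Y \<Longrightarrow> g \<in> Hom C X Y \<Longrightarrow> h \<in> Hom C X Y \<Longrightarrow> (f \<boxplus> g) \<boxplus> h = f \<boxplus> (g \<boxplus> h)"
    and "f \<in> Hom C X Y \<Longrightarrow> Neg C f \<in> Hom C X Y"
    and "f \<in> Hom C X Y \<Longrightarrow> Neg C f \<boxplus> f = ZeroArr C X Y"
proof -
  interpret G: comm_group "hom_group C X Y"
    by (rule hom_comm_group[OF assms])
  show "ZeroArr C X Y \<in> Hom C X Y"
    using G.one_closed by (simp add: hom_group_def)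
  show "f \<in> Hom C X Y \<Longrightarrow> g \<in> Hom C X Y \<Longrightarrow> f \<boxplus> g \<in> Hom C X Y"
    using G.m_closed[of f g] by (simp add: hom_group_def)
  show "f \<in> Hom C X Y \<Longrightarrow> ZeroArr C X Y \<boxplus> f = f"
    using G.l_one[of f] by (simp add: hom_group_def)
  show "f \<in> Hom C X Y \<Longrightarrow> g \<in> Hom C X Y \<Longrightarrow> f \<boxplus> g = g \<boxplus> f"
    using G.m_comm[of f g] by (simp add: hom_group_def)
  show "f \<in> Hom C X Y \<Longrightarrow> g \<in> Hom C X Y \<Longrightarrow> h \<in> Hom C X Y \<Longrightarrow> (f \<boxplus> g) \<boxplus> h = f \<boxplus> (g \<boxplus> h)"
    using G.m_assoc[of f g h] by (simp add: hom_group_def)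
  show "f \<in> Hom C X Y \<Longrightarrow> Neg C f \<in> Hom C X Y"
    using G.inv_closed[of f] by (auto simp: hom_group_def Neg_def Hom_iff)
  show "f \<in> Hom C X Y \<Longrightarrow> Neg C f \<boxplus> f = ZeroArr C X Y"
    using G.l_inv[of f] by (auto simp: hom_group_def Neg_def Hom_iff)
qed

lemma Arr_Ob [simp]:
  assumes "f \<in> Arr C"
  shows "Dom C f \<in> Ob C" and "Cod C f \<in> Ob C"
  using assms by (simp_all add: Dom_Ob Cod_Ob)

lemma ZeroArr_simps [simp]:
  assumes "X \<in> Ob C" and "Y \<in> Ob C"
  shows "ZeroArr C X Y \<in> Arr C" and "Dom C (ZeroArr C X Y) = X" and "Cod C (ZeroArr C X Y) = Y"
  using hom_groupD(1)[OF assms] by (auto simp: Hom_iff)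

lemma Add_simps [simp]:
  assumes "f \<in> Arr C" and "g \<in> Arr C" and "Dom C f = Dom C g" and "Cod C f = Cod C g"
  shows "f \<boxplus> g \<in> Arr C" and "Dom C (f \<boxplus> g) = Dom C g" and "Cod C (f \<boxplus> g) = Cod C g"
  using hom_groupD(2)[of "Dom C f" "Cod C f" f g] assms by (auto simp: Hom_iff)

lemma Neg_simps [simp]:
  assumes "f \<in> Arr C"
  shows "Neg C f \<in> Arr C" and "Dom C (Neg C f) = Dom C f" and "Cod C (Neg C f) = Cod C f"
  using hom_groupD(6)[of "Dom C f" "Cod C f" f] assms by (auto simp: Hom_iff)

lemma Add_commute:
  assumes "f \<in> Arr C" and "g \<in> Arr C" and "Dom C f = Dom C g" and "Cod C f = Cod C g"
  shows "f \<boxplus> g = g \<boxplus> f"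
  using hom_groupD(4)[of "Dom C f" "Cod C f" f g] assms by (auto simp: Hom_iff)

lemma Add_assoc:
  assumes "f \<in> Arr C" and "g \<in> Arr C" and "h \<in> Arr C"
    and "Dom C f = Dom C g" and "Cod C f = Cod C g" and "Dom C g = Dom C h" and "Cod C g = Cod C h"
  shows "(f \<boxplus> g) \<boxplus> h = f \<boxplus> (g \<boxplus> h)"
  using hom_groupD(5)[of "Dom C f" "Cod C f" f g h] assms by (auto simp: Hom_iff)

lemma Add_left_commute:
  assumes "f \<in> Arr C" and "g \<in> Arr C" and "h \<in> Arr C"
    and "Dom C f = Dom C g" and "Cod C f = Cod C g" and "Dom C g = Dom C h" and "Cod C g = Cod C h"
  shows "f \<boxplus> (g \<boxplus> h) = g \<boxplus> (f \<boxplus> h)"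
  using assms by (metis Add_assoc Add_commute)

lemmas Add_ac = Add_assoc Add_commute Add_left_commute

lemma Add_Zero [simp]:
  assumes "f \<in> Arr C" and "Dom C f = X" and "Cod C f = Y"
  shows "ZeroArr C X Y \<boxplus> f = f" and "f \<boxplus> ZeroArr C X Y = f"
  using hom_groupD(3)[of X Y f] hom_groupD(4)[of X Y f "ZeroArr C X Y"] assms
  by (auto simp: Hom_iff)

lemma Add_Neg [simp]:
  assumes "f \<in> Arr C"
  shows "Neg C f \<boxplus> f = ZeroArr C (Dom C f) (Cod C f)"
    and "f \<boxplus> Neg C f = ZeroArr C (Dom C f) (Cod C f)"
proof -
  show *: "Neg C f \<boxplus> f = ZeroArr C (Dom C f) (Cod C f)"
    using hom_groupD(7)[of "Dom C f" "Cod C f" f] assms by (simp add: Hom_iff)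
  show "f \<boxplus> Neg C f = ZeroArr C (Dom C f) (Cod C f)"
    using assms by (subst Add_commute) (simp_all add: *)
qed

lemma Add_Neg_cancel [simp]:
  assumes "f \<in> Arr C" and "g \<in> Arr C" and "Dom C f = Dom C g" and "Cod C f = Cod C g"
  shows "f \<boxplus> (Neg C f \<boxplus> g) = g" and "Neg C f \<boxplus> (f \<boxplus> g) = g"
  using assms by (simp_all add: Add_assoc[symmetric])

lemma Add_left_cancel:
  assumes "f \<in> Arr C" and "g \<in> Arr C" and "h \<in> Arr C"
    and "Dom C f = Dom C g" and "Cod C f = Cod C g" and "Dom C g = Dom C h" and "Cod C g = Cod C h"
  shows "f \<boxplus> g = f \<boxplus> h \<longleftrightarrow> g = h"
proof
  assume eq: "f \<boxplus> g = f \<boxplus> h"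
  have "g = Neg C f \<boxplus> (f \<boxplus> g)"
    using assms by simp
  also have "\<dots> = h"
    unfolding eq using assms by simp
  finally show "g = h" .
qed simp

lemma Neg_unique:
  assumes "f \<in> Arr C" and "g \<in> Arr C" and "Dom C f = Dom C g" and "Cod C f = Cod C g"
    and "f \<boxplus> g = ZeroArr C (Dom C g) (Cod C g)"
  shows "g = Neg C f"
proof (rule Add_left_cancel[THEN iffD1])
  show "f \<boxplus> g = f \<boxplus> Neg C f"
    using assms by simp
qed (use assms in simp_all)

lemma Comp_Add_distrib:
  assumes "f \<in> Arr C" and "g \<in> Arr C" and "h \<in> Arr C" and "Dom C g = Dom C h" and "Cod C g = Cod C h"
  shows "Cod C f = Dom C g \<Longrightarrow> f \<cdot> (g \<boxplus> h) = f \<cdot> g \<boxplus> f \<cdot> h"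
    and "Dom C f = Cod C g \<Longrightarrow> (g \<boxplus> h) \<cdot> f = g \<cdot> f \<boxplus> h \<cdot> f"
  using assms by (auto intro!: Comp_Add_left Comp_Add_right simp: Hom_iff)

text \<open>Composition is additive in each argument, so the composite \<open>?z\<close> with a zero
  arrow satisfies \<open>?z \<boxplus> ?z = ?z\<close>; cancellation leaves zero.\<close>

lemma Comp_Zero [simp]:
  assumes "f \<in> Arr C" and "Z \<in> Ob C"
  shows "Cod C f = Y \<Longrightarrow> f \<cdot> ZeroArr C Y Z = ZeroArr C (Dom C f) Z"
    and "Dom C f = Y \<Longrightarrow> ZeroArr C Z Y \<cdot> f = ZeroArr C Z (Cod C f)"
proof -
  assume [simp]: "Cod C f = Y"
  have [simp]: "Y \<in> Ob C"
    using assms \<open>Cod C f = Y\<close> Arr_Ob(2) by blast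
  let ?z = "f \<cdot> ZeroArr C Y Z"
  have "?z \<boxplus> ?z = ?z \<boxplus> ZeroArr C (Dom C f) Z"
    using assms by (simp add: Comp_Add_distrib(1)[symmetric])
  then show "?z = ZeroArr C (Dom C f) Z"
    using assms by (subst (asm) Add_left_cancel) auto
next
  assume [simp]: "Dom C f = Y"
  have [simp]: "Y \<in> Ob C"
    using assms \<open>Dom C f = Y\<close> Arr_Ob(1) by blast
  let ?z = "ZeroArr C Z Y \<cdot> f"
  have "?z \<boxplus> ?z = ?z \<boxplus> ZeroArr C Z (Cod C f)"
    using assms by (simp add: Comp_Add_distrib(2)[symmetric])
  then show "?z = ZeroArr C Z (Cod C f)"
    using assms by (subst (asm) Add_left_cancel) auto
qed

lemma Comp_Neg:
  assumes "f \<in> Arr C" and "g \<in> Arr C" and "Cod C f = Dom C g"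
  shows "f \<cdot> Neg C g = Neg C (f \<cdot> g)" and "Neg C f \<cdot> g = Neg C (f \<cdot> g)"
proof -
  show "f \<cdot> Neg C g = Neg C (f \<cdot> g)"
    using assms by (intro Neg_unique) (simp_all add: Comp_Add_distrib(1)[symmetric])
  show "Neg C f \<cdot> g = Neg C (f \<cdot> g)"
    using assms by (intro Neg_unique) (simp_all add: Comp_Add_distrib(2)[symmetric])
qed

lemma Neg_Neg [simp]: "f \<in> Arr C \<Longrightarrow> Neg C (Neg C f) = f"
  by (rule Neg_unique[symmetric]) simp_all

lemma Neg_Zero [simp]:
  "X \<in> Ob C \<Longrightarrow> Y \<in> Ob C \<Longrightarrow> Neg C (ZeroArr C X Y) = ZeroArr C X Y"
  by (rule Neg_unique[symmetric]) simp_all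

lemma Neg_Add:
  assumes "f \<in> Arr C" and "g \<in> Arr C" and "Dom C f = Dom C g" and "Cod C f = Cod C g"
  shows "Neg C (f \<boxplus> g) = Neg C f \<boxplus> Neg C g"
  using assms by (intro Neg_unique[symmetric]) (simp_all add: Add_assoc Add_left_commute[of g])

lemmas arr_algebra = Comp_Comp Comp_Add_distrib Comp_Neg Neg_Add Add_ac

end


section \<open>Quotients by an ideal\<close>

text \<open>Replaces the group axioms for \<open>hom_group\<close> by conditions on Hom sets; it
  serves for the quotient, the diagram category and the opposite category alike.\<close>

lemma preadditive_categoryI:
  fixes C :: "('o, 'm, 'z) addcat_scheme" (structure)
  assumes "category C"
    and Add_closed: "\<And>X Y f g. f \<in> Hom C X Y \<Longrightarrow> g \<in> Hom C X Y \<Longrightarrow> f \<boxplus> g \<in> Hom C X Y"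
    and Zero_closed: "\<And>X Y. X \<in> Ob C \<Longrightarrow> Y \<in> Ob C \<Longrightarrow> ZeroArr C X Y \<in> Hom C X Y"
    and Add_assoc: "\<And>X Y f g h. f \<in> Hom C X Y \<Longrightarrow> g \<in> Hom C X Y \<Longrightarrow> h \<in> Hom C X Y \<Longrightarrow>
                      (f \<boxplus> g) \<boxplus> h = f \<boxplus> (g \<boxplus> h)"
    and Add_commute: "\<And>X Y f g. f \<in> Hom C X Y \<Longrightarrow> g \<in> Hom C X Y \<Longrightarrow> f \<boxplus> g = g \<boxplus> f"
    and Zero_left: "\<And>X Y f. f \<in> Hom C X Y \<Longrightarrow> ZeroArr C X Y \<boxplus> f = f"
    and inverse: "\<And>X Y f. f \<in> Hom C X Y \<Longrightarrow> \<exists>g\<in>Hom C X Y. g \<boxplus> f = ZeroArr C X Y"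
    and "\<And>X Y Z f f' g. f \<in> Hom C X Y \<Longrightarrow> f' \<in> Hom C X Y \<Longrightarrow> g \<in> Hom C Y Z \<Longrightarrow>
           (f \<boxplus> f') \<cdot> g = f \<cdot> g \<boxplus> f' \<cdot> g"
    and "\<And>X Y Z f g g'. f \<in> Hom C X Y \<Longrightarrow> g \<in> Hom C Y Z \<Longrightarrow> g' \<in> Hom C Y Z \<Longrightarrow>
           f \<cdot> (g \<boxplus> g') = f \<cdot> g \<boxplus> f \<cdot> g'"
  shows "preadditive_category C"
proof -
  have "comm_group (hom_group C X Y)" if "X \<in> Ob C" and "Y \<in> Ob C" for X Y
    using that
    by (intro comm_groupI)
       (auto simp: hom_group_def Add_closed Zero_closed Add_assoc Zero_left inverse intro: Add_commute)
  then show ?thesis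
    unfolding preadditive_category_def preadditive_category_axioms_def using assms by simp
qed

locale arrow_ideal = preadditive_category C
  for C :: "('o, 'm) addcat" (structure) +
  fixes I :: "'m set"
  assumes ideal_Arr: "f \<in> I \<Longrightarrow> f \<in> Arr C"
    and ideal_Zero: "X \<in> Ob C \<Longrightarrow> Y \<in> Ob C \<Longrightarrow> ZeroArr C X Y \<in> I"
    and ideal_Add: "f \<in> I \<Longrightarrow> g \<in> I \<Longrightarrow> Dom C f = Dom C g \<Longrightarrow> Cod C f = Cod C g \<Longrightarrow> f \<boxplus> g \<in> I"
    and ideal_Comp_right: "f \<in> I \<Longrightarrow> g \<in> Arr C \<Longrightarrow> Cod C f = Dom C g \<Longrightarrow> f \<cdot> g \<in> I"
    and ideal_Comp_left: "f \<in> I \<Longrightarrow> g \<in> Arr C \<Longrightarrow> Cod C g = Dom C f \<Longrightarrow> g \<cdot> f \<in> I"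
begin

abbreviation cls :: "'m \<Rightarrow> 'm set" where
  "cls \<equiv> residue_class C I"

abbreviation Q :: "('o, 'm set) addcat" where
  "Q \<equiv> quotient_cat C I"

text \<open>\<open>Neg C f\<close> is \<open>f\<close> followed by the negative of an identity, and
  an ideal absorbs composition.\<close>

lemma ideal_Neg: "f \<in> I \<Longrightarrow> Neg C f \<in> I"
  using ideal_Comp_right[of f "Neg C (Ident C (Cod C f))"] ideal_Arr[of f]
  by (simp add: Comp_Neg)

lemma ideal_rel_iff:
  "(f, g) \<in> ideal_rel C I \<longleftrightarrow>
     f \<in> Arr C \<and> g \<in> Arr C \<and> Dom C f = Dom C g \<and> Cod C f = Cod C g \<and> f \<boxplus> Neg C g \<in> I"
  by (simp add: ideal_rel_def Diff_eq)

lemma equiv_ideal_rel: "equiv (Arr C) (ideal_rel C I)"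
proof (rule equivI)
  show "ideal_rel C I \<subseteq> Arr C \<times> Arr C"
    by (auto simp: ideal_rel_iff)
  show "refl_on (Arr C) (ideal_rel C I)"
    by (rule refl_onI) (auto simp: ideal_rel_iff ideal_Zero)
  show "sym (ideal_rel C I)"
  proof (rule symI)
    fix f g
    assume *: "(f, g) \<in> ideal_rel C I"
    have "g \<boxplus> Neg C f = Neg C (f \<boxplus> Neg C g)"
      using * by (simp add: ideal_rel_iff Neg_Add Add_commute)
    then show "(g, f) \<in> ideal_rel C I"
      using * ideal_Neg by (auto simp: ideal_rel_iff)
  qed
  show "trans (ideal_rel C I)"
  proof (rule transI)
    fix f g h
    assume *: "(f, g) \<in> ideal_rel C I" "(g, h) \<in> ideal_rel C I"
    have "(f \<boxplus> Neg C g) \<boxplus> (g \<boxplus> Neg C h) = f \<boxplus> Neg C h"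
      using * by (simp add: ideal_rel_iff Add_assoc)
    then show "(f, h) \<in> ideal_rel C I"
      using * ideal_Add[of "f \<boxplus> Neg C g" "g \<boxplus> Neg C h"] by (auto simp: ideal_rel_iff)
  qed
qed

lemma cls_eq_iff:
  assumes "f \<in> Arr C" and "g \<in> Arr C"
  shows "cls f = cls g \<longleftrightarrow> Dom C f = Dom C g \<and> Cod C f = Cod C g \<and> f \<boxplus> Neg C g \<in> I"
  using eq_equiv_class_iff[OF equiv_ideal_rel assms] assms
  by (simp add: residue_class_def ideal_rel_iff)

lemma in_cls_iff: "g \<in> cls f \<longleftrightarrow> (f, g) \<in> ideal_rel C I"
  by (simp add: residue_class_def)

lemma cls_self: "f \<in> Arr C \<Longrightarrow> f \<in> cls f"
  by (simp add: in_cls_iff ideal_rel_iff ideal_Zero)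

lemma in_clsD:
  assumes "g \<in> cls f"
  shows "f \<in> Arr C" and "g \<in> Arr C" and "Dom C g = Dom C f" and "Cod C g = Cod C f"
    and "cls g = cls f"
proof -
  show "f \<in> Arr C" and "g \<in> Arr C" and "Dom C g = Dom C f" and "Cod C g = Cod C f"
    using assms by (simp_all add: in_cls_iff ideal_rel_iff)
  show "cls g = cls f"
    using assms equiv_class_eq[OF equiv_ideal_rel] unfolding residue_class_def by blast
qed

lemma Arr_Q: "Arr Q = cls ` Arr C"
  by (auto simp: quotient_cat_def quotient_def residue_class_def)

lemma Ob_Q [simp]: "Ob Q = Ob C"
  by (simp add: quotient_cat_def)

text \<open>The members of a residue class are parallel, so the set under \<open>the_elem\<close> is
  a singleton.\<close>

lemma Dom_Q [simp]: "f \<in> Arr C \<Longrightarrow> Dom Q (cls f) = Dom C f"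
proof -
  assume "f \<in> Arr C"
  then have "Dom C ` cls f = {Dom C f}"
    using cls_self in_clsD(3) by fast
  then show ?thesis
    by (simp add: quotient_cat_def)
qed

lemma Cod_Q [simp]: "f \<in> Arr C \<Longrightarrow> Cod Q (cls f) = Cod C f"
proof -
  assume "f \<in> Arr C"
  then have "Cod C ` cls f = {Cod C f}"
    using cls_self in_clsD(4) by fast
  then show ?thesis
    by (simp add: quotient_cat_def)
qed

lemma Ident_Q [simp]: "Ident Q X = cls (Ident C X)"
  by (simp add: quotient_cat_def)

lemma ZeroArr_Q [simp]: "ZeroArr Q X Y = cls (ZeroArr C X Y)"
  by (simp add: quotient_cat_def)

text \<open>The difference of \<open>f g\<close> and \<open>f' g'\<close> splits into
  \<open>(f - f') g\<close> and \<open>f' (g - g')\<close>; the first lies in the ideal by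
  absorption on the right, the second by absorption on the left.\<close>

lemma cls_Comp_cong:
  assumes "cls f = cls f'" and "cls g = cls g'" and "f \<in> Arr C" and "f' \<in> Arr C"
    and "g \<in> Arr C" and "g' \<in> Arr C" and "Cod C f = Dom C g"
  shows "cls (f \<cdot> g) = cls (f' \<cdot> g')"
proof -
  have *: "Dom C f = Dom C f'" "Cod C f = Cod C f'" "f \<boxplus> Neg C f' \<in> I"
    "Dom C g = Dom C g'" "Cod C g = Cod C g'" "g \<boxplus> Neg C g' \<in> I"
    using assms by (simp_all add: cls_eq_iff)
  have eq: "f \<cdot> g \<boxplus> Neg C (f' \<cdot> g') = (f \<boxplus> Neg C f') \<cdot> g \<boxplus> f' \<cdot> (g \<boxplus> Neg C g')"
    using assms(3-7) *(1,2,4,5) by (simp add: arr_algebra)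
  have "(f \<boxplus> Neg C f') \<cdot> g \<boxplus> f' \<cdot> (g \<boxplus> Neg C g') \<in> I"
    using assms(3-7) *
    by (intro ideal_Add[OF ideal_Comp_right[OF *(3)] ideal_Comp_left[OF *(6)]]) simp_all
  then show ?thesis
    using assms(3-7) *(1,2,4,5) by (simp add: cls_eq_iff eq)
qed

lemma cls_Add_cong:
  assumes "cls f = cls f'" and "cls g = cls g'" and "f \<in> Arr C" and "f' \<in> Arr C"
    and "g \<in> Arr C" and "g' \<in> Arr C" and "Dom C f = Dom C g" and "Cod C f = Cod C g"
  shows "cls (f \<boxplus> g) = cls (f' \<boxplus> g')"
proof -
  have *: "Dom C f = Dom C f'" "Cod C f = Cod C f'" "f \<boxplus> Neg C f' \<in> I"
    "Dom C g = Dom C g'" "Cod C g = Cod C g'" "g \<boxplus> Neg C g' \<in> I"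
    using assms by (simp_all add: cls_eq_iff)
  have par: "Dom C f' = Dom C g'" "Cod C f' = Cod C g'"
    using * assms(7,8) by auto
  have eq: "f \<boxplus> g \<boxplus> Neg C (f' \<boxplus> g') = (f \<boxplus> Neg C f') \<boxplus> (g \<boxplus> Neg C g')"
    using assms(3-8) *(1,2,4,5) par by (simp add: Neg_Add Add_assoc Add_left_commute[of g])
  have "(f \<boxplus> Neg C f') \<boxplus> (g \<boxplus> Neg C g') \<in> I"
    using assms(3-8) * par by (intro ideal_Add[OF *(3) *(6)]) simp_all
  then show ?thesis
    using assms(3-8) *(1,2,4,5) par by (simp add: cls_eq_iff eq)
qed

text \<open>The congruence turns the union in \<open>quotient_cat\<close> into a union of equal
  sets, and its index sets are nonempty because a class contains its representative.\<close>

lemma Comp_Q [simp]: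
  assumes "f \<in> Arr C" and "g \<in> Arr C" and "Cod C f = Dom C g"
  shows "cls f \<cdot>\<^bsub>Q\<^esub> cls g = cls (f \<cdot> g)"
proof -
  have "cls (f' \<cdot> g') = cls (f \<cdot> g)" if "f' \<in> cls f" and "g' \<in> cls g" for f' g'
    using assms in_clsD[OF that(1)] in_clsD[OF that(2)] by (intro cls_Comp_cong) simp_all
  then have "(\<Union>f'\<in>cls f. \<Union>g'\<in>cls g. cls (f' \<cdot> g')) = (\<Union>f'\<in>cls f. \<Union>g'\<in>cls g. cls (f \<cdot> g))"
    by simp
  also have "\<dots> = cls (f \<cdot> g)"
    using assms(1,2)[THEN cls_self] by blast
  finally show ?thesis
    by (simp add: quotient_cat_def)
qed

lemma Add_Q [simp]:
  assumes "f \<in> Arr C" and "g \<in> Arr C" and "Dom C f = Dom C g" and "Cod C f = Cod C g"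
  shows "cls f \<boxplus>\<^bsub>Q\<^esub> cls g = cls (f \<boxplus> g)"
proof -
  have "cls (f' \<boxplus> g') = cls (f \<boxplus> g)" if "f' \<in> cls f" and "g' \<in> cls g" for f' g'
    using assms in_clsD[OF that(1)] in_clsD[OF that(2)] by (intro cls_Add_cong) simp_all
  then have "(\<Union>f'\<in>cls f. \<Union>g'\<in>cls g. cls (f' \<boxplus> g')) = (\<Union>f'\<in>cls f. \<Union>g'\<in>cls g. cls (f \<boxplus> g))"
    by simp
  also have "\<dots> = cls (f \<boxplus> g)"
    using assms(1,2)[THEN cls_self] by blast
  finally show ?thesis
    by (simp add: quotient_cat_def)
qed

lemma Hom_Q_E:
  assumes "c \<in> Hom Q X Y"
  obtains f where "f \<in> Arr C" and "Dom C f = X" and "Cod C f = Y" and "c = cls f"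
  using assms by (auto simp: Hom_iff Arr_Q)

lemma Hom_Q_iff [simp]:
  "f \<in> Arr C \<Longrightarrow> cls f \<in> Hom Q X Y \<longleftrightarrow> Dom C f = X \<and> Cod C f = Y"
  by (auto simp: Hom_iff Arr_Q)

lemma Hom_Q: "Hom Q X Y = cls ` Hom C X Y"
  by (force simp: Hom_iff Arr_Q)

lemma category_Q: "category Q"
proof
  show "Dom Q c \<in> Ob Q" if "c \<in> Arr Q" for c
    using that by (auto simp: Arr_Q)
  show "Cod Q c \<in> Ob Q" if "c \<in> Arr Q" for c
    using that by (auto simp: Arr_Q)
  show "Ident Q X \<in> Hom Q X X" if "X \<in> Ob Q" for X
    using that by simp
  show "c \<cdot>\<^bsub>Q\<^esub> d \<in> Hom Q X Z" if "c \<in> Hom Q X Y" and "d \<in> Hom Q Y Z" for c d X Y Z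
    using that by (auto elim!: Hom_Q_E)
  show "Ident Q X \<cdot>\<^bsub>Q\<^esub> c = c" if "c \<in> Hom Q X Y" for c X Y
    using that by (auto elim!: Hom_Q_E)
  show "c \<cdot>\<^bsub>Q\<^esub> Ident Q Y = c" if "c \<in> Hom Q X Y" for c X Y
    using that by (auto elim!: Hom_Q_E)
  show "(c \<cdot>\<^bsub>Q\<^esub> d) \<cdot>\<^bsub>Q\<^esub> e = c \<cdot>\<^bsub>Q\<^esub> (d \<cdot>\<^bsub>Q\<^esub> e)"
    if "c \<in> Hom Q W X" and "d \<in> Hom Q X Y" and "e \<in> Hom Q Y Z" for c d e W X Y Z
    using that by (auto elim!: Hom_Q_E simp: Comp_Comp)
qed

lemma preadditive_Q: "preadditive_category Q"
proof (rule preadditive_categoryI)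
  show "\<exists>d\<in>Hom Q X Y. d \<boxplus>\<^bsub>Q\<^esub> c = ZeroArr Q X Y" if c: "c \<in> Hom Q X Y" for X Y c
  proof -
    obtain f where f: "f \<in> Arr C" "Dom C f = X" "Cod C f = Y" "c = cls f"
      using c by (rule Hom_Q_E)
    then show ?thesis
      by (intro bexI[of _ "cls (Neg C f)"]) simp_all
  qed
  show "c \<boxplus>\<^bsub>Q\<^esub> d = d \<boxplus>\<^bsub>Q\<^esub> c" if *: "c \<in> Hom Q X Y" "d \<in> Hom Q X Y" for X Y c d
  proof -
    obtain f g where "f \<in> Arr C" "Dom C f = X" "Cod C f = Y" "c = cls f"
      and "g \<in> Arr C" "Dom C g = X" "Cod C g = Y" "d = cls g"
      using * by (auto elim!: Hom_Q_E)
    then show ?thesis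
      using Add_commute[of f g] by simp
  qed
qed (auto elim!: Hom_Q_E simp: category_Q Add_assoc Comp_Add_distrib)

lemma cls_eq_Zero_iff:
  assumes "f \<in> Arr C" and "Dom C f = X" and "Cod C f = Y"
  shows "cls f = cls (ZeroArr C X Y) \<longleftrightarrow> f \<in> I"
  using assms by (subst cls_eq_iff) auto

lemma ex1_cls:
  assumes "\<exists>!f. f \<in> Hom C X Y"
  shows "\<exists>!c. c \<in> Hom Q X Y"
proof -
  from assms obtain f where f: "Hom C X Y = {f}"
    by auto
  then have "Hom Q X Y = {cls f}"
    by (simp add: Hom_Q)
  then show ?thesis
    by auto
qed

text \<open>A zero object is described by singleton Hom sets and a biproduct by equations; the
  surjection onto residue classes preserves both.\<close>

lemma additive_Q:
  assumes "additive_category C"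
  shows "additive_category Q"
proof -
  interpret add: additive_category C
    by (rule assms)
  have zero: "zero_object Q (ZeroOb Q)"
  proof -
    have "\<exists>!c. c \<in> Hom Q X (ZeroOb C)" and "\<exists>!c. c \<in> Hom Q (ZeroOb C) X" if X: "X \<in> Ob C" for X
    proof -
      have *: "\<exists>!f. f \<in> Hom C X (ZeroOb C)" "\<exists>!f. f \<in> Hom C (ZeroOb C) X"
        using add.ZeroOb_zero X by (simp_all add: zero_object_def)
      show "\<exists>!c. c \<in> Hom Q X (ZeroOb C)" and "\<exists>!c. c \<in> Hom Q (ZeroOb C) X"
        using *[THEN ex1_cls] by simp_all
    qed
    then show ?thesis
      using add.ZeroOb_zero by (simp add: zero_object_def quotient_cat_def)
  qed
  have biprod: "\<exists>S i j p q. biproduct Q X Y S i j p q" if *: "X \<in> Ob Q" "Y \<in> Ob Q" for X Y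
  proof -
    obtain S i j p q where "biproduct C X Y S i j p q"
      using add.biproducts[of X Y] * by auto
    then have "biproduct Q X Y S (cls i) (cls j) (cls p) (cls q)"
      by (simp add: biproduct_def Hom_iff[where C = C])
    then show ?thesis
      by blast
  qed
  show ?thesis
    unfolding additive_category_def additive_category_axioms_def
    using preadditive_Q zero biprod by auto
qed

end


section \<open>The Adelman category is additive\<close>

text \<open>Pasting of two commutative squares: \<open>a\<close>, \<open>b\<close>, \<open>c\<close>
  are corresponding edges of three consecutive diagrams, \<open>f\<close>, \<open>g\<close> the
  components at the starts of these edges and \<open>f'\<close>, \<open>g'\<close> those at their
  ends.\<close>

lemma (in category) square_Comp:
  assumes "a \<cdot> f' = f \<cdot> b" and "b \<cdot> g' = g \<cdot> c"
    and "a \<in> Arr C" and "b \<in> Arr C" and "c \<in> Arr C"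
    and "f \<in> Arr C" and "f' \<in> Arr C" and "g \<in> Arr C" and "g' \<in> Arr C"
    and "Cod C a = Dom C f'" and "Cod C f = Dom C b" and "Cod C f' = Dom C g'"
    and "Cod C b = Dom C g'" and "Cod C g = Dom C c" and "Cod C f = Dom C g"
  shows "a \<cdot> (f' \<cdot> g') = (f \<cdot> g) \<cdot> c"
proof -
  have "a \<cdot> (f' \<cdot> g') = (a \<cdot> f') \<cdot> g'"
    using assms(3-) by (simp add: Comp_Comp)
  also have "\<dots> = f \<cdot> (b \<cdot> g')"
    unfolding assms(1) using assms(3-) by (simp add: Comp_Comp)
  also have "\<dots> = (f \<cdot> g) \<cdot> c"
    unfolding assms(2) using assms(3-) by (simp add: Comp_Comp)
  finally show ?thesis .
qed

text \<open>The last four clauses repeat the relations between injections and projections with an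
  arrow \<open>h\<close> behind them, the shape in which they occur once compositions are nested to
  the right.\<close>

lemma (in preadditive_category) biproduct_simps:
  assumes "biproduct C X Y S i j p q"
  shows "X \<in> Ob C" and "Y \<in> Ob C" and "S \<in> Ob C"
    and "i \<in> Arr C" and "Dom C i = X" and "Cod C i = S"
    and "j \<in> Arr C" and "Dom C j = Y" and "Cod C j = S"
    and "p \<in> Arr C" and "Dom C p = S" and "Cod C p = X"
    and "q \<in> Arr C" and "Dom C q = S" and "Cod C q = Y"
    and "i \<cdot> p = Ident C X" and "j \<cdot> q = Ident C Y"
    and "i \<cdot> q = ZeroArr C X Y" and "j \<cdot> p = ZeroArr C Y X"
    and "p \<cdot> i \<boxplus> q \<cdot> j = Ident C S"
    and "\<And>h. h \<in> Arr C \<Longrightarrow> Dom C h = X \<Longrightarrow> i \<cdot> (p \<cdot> h) = h"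
    and "\<And>h. h \<in> Arr C \<Longrightarrow> Dom C h = Y \<Longrightarrow> j \<cdot> (q \<cdot> h) = h"
    and "\<And>h. h \<in> Arr C \<Longrightarrow> Dom C h = Y \<Longrightarrow> i \<cdot> (q \<cdot> h) = ZeroArr C X (Cod C h)"
    and "\<And>h. h \<in> Arr C \<Longrightarrow> Dom C h = X \<Longrightarrow> j \<cdot> (p \<cdot> h) = ZeroArr C Y (Cod C h)"
proof -
  show arr: "S \<in> Ob C"
    "i \<in> Arr C" "Dom C i = X" "Cod C i = S" "j \<in> Arr C" "Dom C j = Y" "Cod C j = S"
    "p \<in> Arr C" "Dom C p = S" "Cod C p = X" "q \<in> Arr C" "Dom C q = S" "Cod C q = Y"
    and eqs: "i \<cdot> p = Ident C X" "j \<cdot> q = Ident C Y"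
    "i \<cdot> q = ZeroArr C X Y" "j \<cdot> p = ZeroArr C Y X"
    "p \<cdot> i \<boxplus> q \<cdot> j = Ident C S"
    using assms by (auto simp: biproduct_def Hom_iff)
  show ob: "X \<in> Ob C" "Y \<in> Ob C"
    using arr Arr_Ob by metis+
  show "i \<cdot> (p \<cdot> h) = h" if "h \<in> Arr C" and "Dom C h = X" for h
    using that arr eqs by (simp add: Comp_Comp[symmetric])
  show "j \<cdot> (q \<cdot> h) = h" if "h \<in> Arr C" and "Dom C h = Y" for h
    using that arr eqs by (simp add: Comp_Comp[symmetric])
  show "i \<cdot> (q \<cdot> h) = ZeroArr C X (Cod C h)" if "h \<in> Arr C" and "Dom C h = Y" for h
    using that arr eqs ob by (simp add: Comp_Comp[symmetric])
  show "j \<cdot> (p \<cdot> h) = ZeroArr C Y (Cod C h)" if "h \<in> Arr C" and "Dom C h = X" for h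
    using that arr eqs ob by (simp add: Comp_Comp[symmetric])
qed

section \<open>Diagrams, their morphisms and homotopies in coordinates\<close>

lemma Delta2_simps [simp]:
  "Ob (Delta2 C) = diagrams C"
  "Arr (Delta2 C) = diagram_morphisms C"
  "Dom (Delta2 C) = src"
  "Cod (Delta2 C) = tgt"
  "Ident (Delta2 C) A =
     DMor A A (Ident C (Dom C (edge0 A))) (Ident C (Cod C (edge0 A))) (Ident C (Cod C (edge1 A)))"
  "f \<cdot>\<^bsub>Delta2 C\<^esub> g = DMor (src f) (tgt g)
     (comp0 f \<cdot>\<^bsub>C\<^esub> comp0 g) (comp1 f \<cdot>\<^bsub>C\<^esub> comp1 g) (comp2 f \<cdot>\<^bsub>C\<^esub> comp2 g)"
  "f \<boxplus>\<^bsub>Delta2 C\<^esub> g = DMor (src f) (tgt f)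
     (comp0 f \<boxplus>\<^bsub>C\<^esub> comp0 g) (comp1 f \<boxplus>\<^bsub>C\<^esub> comp1 g) (comp2 f \<boxplus>\<^bsub>C\<^esub> comp2 g)"
  "ZeroArr (Delta2 C) A B = DMor A B (ZeroArr C (Dom C (edge0 A)) (Dom C (edge0 B)))
     (ZeroArr C (Cod C (edge0 A)) (Cod C (edge0 B))) (ZeroArr C (Cod C (edge1 A)) (Cod C (edge1 B)))"
  "ZeroOb (Delta2 C) = Diag (ZeroArr C (ZeroOb C) (ZeroOb C)) (ZeroArr C (ZeroOb C) (ZeroOb C))"
  by (simp_all add: Delta2_def vert0_def vert1_def vert2_def)

lemma diagrams_iff:
  "A \<in> diagrams C \<longleftrightarrow> edge0 A \<in> Arr C \<and> edge1 A \<in> Arr C \<and> Cod C (edge0 A) = Dom C (edge1 A)"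
  by (cases A) (auto simp: diagrams_def)

lemma diagram_morphisms_iff:
  "f \<in> diagram_morphisms C \<longleftrightarrow>
     src f \<in> diagrams C \<and> tgt f \<in> diagrams C \<and>
     comp0 f \<in> Arr C \<and> Dom C (comp0 f) = Dom C (edge0 (src f)) \<and> Cod C (comp0 f) = Dom C (edge0 (tgt f)) \<and>
     comp1 f \<in> Arr C \<and> Dom C (comp1 f) = Cod C (edge0 (src f)) \<and> Cod C (comp1 f) = Cod C (edge0 (tgt f)) \<and>
     comp2 f \<in> Arr C \<and> Dom C (comp2 f) = Cod C (edge1 (src f)) \<and> Cod C (comp2 f) = Cod C (edge1 (tgt f)) \<and>
     edge0 (src f) \<cdot>\<^bsub>C\<^esub> comp1 f = comp0 f \<cdot>\<^bsub>C\<^esub> edge0 (tgt f) \<and>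
     edge1 (src f) \<cdot>\<^bsub>C\<^esub> comp2 f = comp1 f \<cdot>\<^bsub>C\<^esub> edge1 (tgt f)"
  by (cases f) (auto simp: diagram_morphisms_def Hom_iff vert0_def vert1_def vert2_def)

lemma null_homotopic_iff:
  "f \<in> null_homotopic C \<longleftrightarrow> f \<in> diagram_morphisms C \<and>
     (\<exists>s t. s \<in> Arr C \<and> Dom C s = Cod C (edge0 (src f)) \<and> Cod C s = Dom C (edge0 (tgt f)) \<and>
            t \<in> Arr C \<and> Dom C t = Cod C (edge1 (src f)) \<and> Cod C t = Cod C (edge0 (tgt f)) \<and>
            s \<cdot>\<^bsub>C\<^esub> edge0 (tgt f) \<boxplus>\<^bsub>C\<^esub> edge1 (src f) \<cdot>\<^bsub>C\<^esub> t = comp1 f)"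
  unfolding null_homotopic_def by (simp add: Bex_def Hom_iff vert0_def vert1_def vert2_def)

lemma dmor_eqI:
  "src f = src g \<Longrightarrow> tgt f = tgt g \<Longrightarrow> comp0 f = comp0 g \<Longrightarrow> comp1 f = comp1 g \<Longrightarrow> comp2 f = comp2 g \<Longrightarrow>
     f = g"
  by (simp add: dmor.expand)

text \<open>The diagram, quotient and opposite constructions act on unextended records, so the
  record type is fixed here.\<close>

locale base_category = additive_category C
  for C :: "('o, 'm) addcat" (structure)
begin

lemma category_Delta2: "category (Delta2 C)"
proof
  show "f \<cdot>\<^bsub>Delta2 C\<^esub> g \<in> Hom (Delta2 C) X Z"
    if "f \<in> Hom (Delta2 C) X Y" and "g \<in> Hom (Delta2 C) Y Z" for f g X Y Z
    using that
    by (auto simp: Hom_iff diagram_morphisms_iff diagrams_iff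
        intro: square_Comp[where b = "edge0 Y"] square_Comp[where b = "edge1 Y"])
qed (auto simp: Hom_iff diagram_morphisms_iff diagrams_iff Comp_Comp intro!: dmor_eqI)

lemma preadditive_Delta2: "preadditive_category (Delta2 C)"
proof (rule preadditive_categoryI)
  show "\<exists>g\<in>Hom (Delta2 C) X Y. g \<boxplus>\<^bsub>Delta2 C\<^esub> f = ZeroArr (Delta2 C) X Y"
    if "f \<in> Hom (Delta2 C) X Y" for X Y f
    using that
    by (intro bexI[of _ "DMor X Y (Neg C (comp0 f)) (Neg C (comp1 f)) (Neg C (comp2 f))"])
       (auto simp: Hom_iff diagram_morphisms_iff diagrams_iff Comp_Neg)
qed (auto simp: Hom_iff diagram_morphisms_iff diagrams_iff category_Delta2 Comp_Add_distrib Add_assoc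
      intro!: dmor_eqI Add_commute)

sublocale D: preadditive_category "Delta2 C"
  by (rule preadditive_Delta2)

lemma Neg_Delta2:
  assumes "f \<in> diagram_morphisms C"
  shows "Neg (Delta2 C) f =
    DMor (src f) (tgt f) (Neg C (comp0 f)) (Neg C (comp1 f)) (Neg C (comp2 f))"
  using assms
  by (intro D.Neg_unique[symmetric]) (auto simp: diagram_morphisms_iff diagrams_iff Comp_Neg)

lemma null_homotopicI:
  assumes "f \<in> diagram_morphisms C"
    and "s \<in> Arr C" and "Dom C s = Cod C (edge0 (src f))" and "Cod C s = Dom C (edge0 (tgt f))"
    and "t \<in> Arr C" and "Dom C t = Cod C (edge1 (src f))" and "Cod C t = Cod C (edge0 (tgt f))"
    and "s \<cdot> edge0 (tgt f) \<boxplus> edge1 (src f) \<cdot> t = comp1 f"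
  shows "f \<in> null_homotopic C"
  using assms unfolding null_homotopic_iff by blast

text \<open>Let \<open>(s, t)\<close> be a homotopy for \<open>f\<close>, and let \<open>g0\<close>,
  \<open>g1\<close>, \<open>g2\<close> be the components of \<open>g\<close>. Then
  \<open>f g\<close> has the homotopy \<open>(s g0, t g1)\<close> and \<open>g f\<close> the
  homotopy \<open>(g1 s, g2 t)\<close>; the squares of \<open>g\<close> carry the edges past the
  components. Sums use sums of homotopies.\<close>

sublocale Q: arrow_ideal "Delta2 C" "null_homotopic C"
proof
  fix f g X Y
  show "f \<in> Arr (Delta2 C)" if "f \<in> null_homotopic C"
    using that by (simp add: null_homotopic_iff)
  show "ZeroArr (Delta2 C) X Y \<in> null_homotopic C" if "X \<in> Ob (Delta2 C)" and "Y \<in> Ob (Delta2 C)"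
    using that
    by (intro null_homotopicI[where s = "ZeroArr C (Cod C (edge0 X)) (Dom C (edge0 Y))"
          and t = "ZeroArr C (Cod C (edge1 X)) (Cod C (edge0 Y))"])
       (auto simp: diagram_morphisms_iff diagrams_iff)
  show "f \<boxplus>\<^bsub>Delta2 C\<^esub> g \<in> null_homotopic C"
    if f: "f \<in> null_homotopic C" and g: "g \<in> null_homotopic C"
      and "Dom (Delta2 C) f = Dom (Delta2 C) g" "Cod (Delta2 C) f = Cod (Delta2 C) g"
  proof -
    have [simp]: "src f = src g" "tgt f = tgt g"
      using that by simp_all
    have "f \<boxplus>\<^bsub>Delta2 C\<^esub> g \<in> Arr (Delta2 C)"
      using f g by (intro D.Add_simps(1)) (simp_all add: null_homotopic_iff)
    moreover obtain s t where "s \<in> Arr C" "Dom C s = Cod C (edge0 (src g))"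
      "Cod C s = Dom C (edge0 (tgt g))" "t \<in> Arr C" "Dom C t = Cod C (edge1 (src g))"
      "Cod C t = Cod C (edge0 (tgt g))" "comp1 f = s \<cdot> edge0 (tgt g) \<boxplus> edge1 (src g) \<cdot> t"
      using f by (auto simp: null_homotopic_iff)
    moreover obtain s' t' where "s' \<in> Arr C" "Dom C s' = Cod C (edge0 (src g))"
      "Cod C s' = Dom C (edge0 (tgt g))" "t' \<in> Arr C" "Dom C t' = Cod C (edge1 (src g))"
      "Cod C t' = Cod C (edge0 (tgt g))" "comp1 g = s' \<cdot> edge0 (tgt g) \<boxplus> edge1 (src g) \<cdot> t'"
      using g by (auto simp: null_homotopic_iff)
    moreover have "edge0 (tgt g) \<in> Arr C" "edge1 (src g) \<in> Arr C" "edge1 (tgt g) \<in> Arr C"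
      "Cod C (edge0 (src g)) = Dom C (edge1 (src g))" "Cod C (edge0 (tgt g)) = Dom C (edge1 (tgt g))"
      using g by (simp_all add: null_homotopic_iff diagram_morphisms_iff diagrams_iff)
    ultimately show ?thesis
      by (intro null_homotopicI[where s = "s \<boxplus> s'" and t = "t \<boxplus> t'"])
         (simp_all add: Comp_Add_distrib Add_ac)
  qed
  show "f \<cdot>\<^bsub>Delta2 C\<^esub> g \<in> null_homotopic C"
    if f: "f \<in> null_homotopic C" and g: "g \<in> Arr (Delta2 C)" and "Cod (Delta2 C) f = Dom (Delta2 C) g"
  proof -
    have [simp]: "tgt f = src g"
      using that by simp
    have fg: "f \<cdot>\<^bsub>Delta2 C\<^esub> g \<in> Arr (Delta2 C)"
      using f g by (intro D.Comp_simps(1)) (simp_all add: null_homotopic_iff)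
    obtain s t where st: "s \<in> Arr C" "Dom C s = Cod C (edge0 (src f))"
      "Cod C s = Dom C (edge0 (src g))" "t \<in> Arr C" "Dom C t = Cod C (edge1 (src f))"
      "Cod C t = Cod C (edge0 (src g))" "comp1 f = s \<cdot> edge0 (src g) \<boxplus> edge1 (src f) \<cdot> t"
      using f by (auto simp: null_homotopic_iff)
    have "src f \<in> diagrams C"
      using f by (simp add: null_homotopic_iff diagram_morphisms_iff)
    then show ?thesis
      using fg st g
      by (intro null_homotopicI[where s = "s \<cdot> comp0 g" and t = "t \<cdot> comp1 g"])
         (auto simp: diagram_morphisms_iff diagrams_iff Comp_Add_distrib Comp_Comp)
  qed
  show "g \<cdot>\<^bsub>Delta2 C\<^esub> f \<in> null_homotopic C"
    if f: "f \<in> null_homotopic C" and g: "g \<in> Arr (Delta2 C)" and "Cod (Delta2 C) g = Dom (Delta2 C) f"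
  proof -
    have [simp]: "src f = tgt g"
      using that by simp
    have gf: "g \<cdot>\<^bsub>Delta2 C\<^esub> f \<in> Arr (Delta2 C)"
      using f g by (intro D.Comp_simps(1)) (simp_all add: null_homotopic_iff)
    obtain s t where st: "s \<in> Arr C" "Dom C s = Cod C (edge0 (tgt g))"
      "Cod C s = Dom C (edge0 (tgt f))" "t \<in> Arr C" "Dom C t = Cod C (edge1 (tgt g))"
      "Cod C t = Cod C (edge0 (tgt f))" "comp1 f = s \<cdot> edge0 (tgt f) \<boxplus> edge1 (tgt g) \<cdot> t"
      using f by (auto simp: null_homotopic_iff)
    have eq: "edge1 (src g) \<cdot> (comp2 g \<cdot> t) = comp1 g \<cdot> (edge1 (tgt g) \<cdot> t)"
      using g st by (simp add: diagram_morphisms_iff diagrams_iff Comp_Comp[symmetric])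
    have "tgt f \<in> diagrams C"
      using f by (simp add: null_homotopic_iff diagram_morphisms_iff)
    then have arr: "edge0 (tgt f) \<in> Arr C" "edge1 (tgt f) \<in> Arr C"
      "Cod C (edge0 (tgt f)) = Dom C (edge1 (tgt f))"
      and g': "edge0 (src g) \<in> Arr C" "edge1 (src g) \<in> Arr C" "edge0 (tgt g) \<in> Arr C" "edge1 (tgt g) \<in> Arr C"
      "Cod C (edge0 (tgt g)) = Dom C (edge1 (tgt g))" "Cod C (edge0 (src g)) = Dom C (edge1 (src g))"
      "comp1 g \<in> Arr C" "Dom C (comp1 g) = Cod C (edge0 (src g))" "Cod C (comp1 g) = Cod C (edge0 (tgt g))"
      "comp2 g \<in> Arr C" "Dom C (comp2 g) = Cod C (edge1 (src g))" "Cod C (comp2 g) = Cod C (edge1 (tgt g))"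
      using g by (simp_all add: diagram_morphisms_iff diagrams_iff)
    show ?thesis
    proof (rule null_homotopicI[where s = "comp1 g \<cdot> s" and t = "comp2 g \<cdot> t"])
      show "g \<cdot>\<^bsub>Delta2 C\<^esub> f \<in> diagram_morphisms C"
        using gf by (simp only: Delta2_simps)
    qed (use st arr g' eq in \<open>simp_all add: Comp_Add_distrib Comp_Comp\<close>)
  qed
qed

section \<open>Zero object and biproducts of diagrams\<close>

lemma ZeroOb_unique:
  assumes "f \<in> Arr C" and "Dom C f = ZeroOb C \<or> Cod C f = ZeroOb C"
  shows "f = ZeroArr C (Dom C f) (Cod C f)"
proof -
  have "\<exists>!g. g \<in> Hom C (Dom C f) (Cod C f)"
    using assms ZeroOb_zero unfolding zero_object_def by (metis Arr_Ob)
  moreover have "f \<in> Hom C (Dom C f) (Cod C f)" "ZeroArr C (Dom C f) (Cod C f) \<in> Hom C (Dom C f) (Cod C f)"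
    using assms(1) by (simp_all add: Hom_iff)
  ultimately show ?thesis
    by blast
qed

lemma ZeroOb_Ob [simp]: "ZeroOb C \<in> Ob C"
  using ZeroOb_zero by (simp add: zero_object_def)

text \<open>Sums are formed vertexwise; the edges of \<open>S\<close> are block diagonal, so all
  injections and projections are morphisms of diagrams.\<close>

lemma biproduct_Delta2:
  assumes "A \<in> diagrams C" and "B \<in> diagrams C"
    and bp: "biproduct C (Dom C (edge0 A)) (Dom C (edge0 B)) S0 i0 j0 p0 q0"
      "biproduct C (Cod C (edge0 A)) (Cod C (edge0 B)) S1 i1 j1 p1 q1"
      "biproduct C (Cod C (edge1 A)) (Cod C (edge1 B)) S2 i2 j2 p2 q2"
  defines "S \<equiv> Diag (p0 \<cdot> (edge0 A \<cdot> i1) \<boxplus> q0 \<cdot> (edge0 B \<cdot> j1)) (p1 \<cdot> (edge1 A \<cdot> i2) \<boxplus> q1 \<cdot> (edge1 B \<cdot> j2))"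
  shows "biproduct (Delta2 C) A B S (DMor A S i0 i1 i2) (DMor B S j0 j1 j2) (DMor S A p0 p1 p2) (DMor S B q0 q1 q2)"
  using assms(1,2)
  by (simp add: biproduct_def Hom_iff diagram_morphisms_iff diagrams_iff S_def Comp_Comp
      Comp_Add_distrib bp[THEN biproduct_simps(1)] bp[THEN biproduct_simps(2)] biproduct_simps[OF bp(1)] biproduct_simps[OF bp(2)] biproduct_simps[OF bp(3)])

lemma additive_Delta2: "additive_category (Delta2 C)"
  unfolding additive_category_def additive_category_axioms_def
proof (intro conjI allI impI)
  show "preadditive_category (Delta2 C)"
    by (rule preadditive_Delta2)
  show "zero_object (Delta2 C) (ZeroOb (Delta2 C))"
    unfolding zero_object_def
  proof (intro conjI ballI)
    show "ZeroOb (Delta2 C) \<in> Ob (Delta2 C)"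
      by (simp add: diagrams_iff)
    fix X
    assume X: "X \<in> Ob (Delta2 C)"
    let ?Z = "ZeroOb (Delta2 C)"
    show "\<exists>!f. f \<in> Hom (Delta2 C) X ?Z"
    proof (rule ex1I)
      show "ZeroArr (Delta2 C) X ?Z \<in> Hom (Delta2 C) X ?Z"
        using X by (auto simp: Hom_iff diagram_morphisms_iff diagrams_iff)
      show "f = ZeroArr (Delta2 C) X ?Z" if "f \<in> Hom (Delta2 C) X ?Z" for f
        using that X ZeroOb_unique[of "comp0 f"] ZeroOb_unique[of "comp1 f"] ZeroOb_unique[of "comp2 f"]
        by (auto simp: Hom_iff diagram_morphisms_iff intro!: dmor_eqI)
    qed
    show "\<exists>!f. f \<in> Hom (Delta2 C) ?Z X"
    proof (rule ex1I)
      show "ZeroArr (Delta2 C) ?Z X \<in> Hom (Delta2 C) ?Z X"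
        using X by (auto simp: Hom_iff diagram_morphisms_iff diagrams_iff)
      show "f = ZeroArr (Delta2 C) ?Z X" if "f \<in> Hom (Delta2 C) ?Z X" for f
        using that X ZeroOb_unique[of "comp0 f"] ZeroOb_unique[of "comp1 f"] ZeroOb_unique[of "comp2 f"]
        by (auto simp: Hom_iff diagram_morphisms_iff intro!: dmor_eqI)
    qed
  qed
  show "\<exists>S i j p q. biproduct (Delta2 C) A B S i j p q"
    if *: "A \<in> Ob (Delta2 C)" "B \<in> Ob (Delta2 C)" for A B
  proof -
    have AB: "A \<in> diagrams C" "B \<in> diagrams C"
      using * by simp_all
    obtain S0 i0 j0 p0 q0 where "biproduct C (Dom C (edge0 A)) (Dom C (edge0 B)) S0 i0 j0 p0 q0"
      using biproducts[of "Dom C (edge0 A)" "Dom C (edge0 B)"] AB by (auto simp: diagrams_iff)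
    moreover obtain S1 i1 j1 p1 q1 where "biproduct C (Cod C (edge0 A)) (Cod C (edge0 B)) S1 i1 j1 p1 q1"
      using biproducts[of "Cod C (edge0 A)" "Cod C (edge0 B)"] AB by (auto simp: diagrams_iff)
    moreover obtain S2 i2 j2 p2 q2 where "biproduct C (Cod C (edge1 A)) (Cod C (edge1 B)) S2 i2 j2 p2 q2"
      using biproducts[of "Cod C (edge1 A)" "Cod C (edge1 B)"] AB by (auto simp: diagrams_iff)
    ultimately show ?thesis
      using biproduct_Delta2[OF AB] by blast
  qed
qed

lemma additive_Adel: "additive_category (Adel C)"
  unfolding Adel_def by (rule Q.additive_Q[OF additive_Delta2])

end


section \<open>Kernels\<close>

text \<open>Sorting by \<open>Add_ac\<close> can leave \<open>f\<close> and \<open>Neg C f\<close>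
  apart with two summands in between; this cancels them in that position.\<close>

lemma (in preadditive_category) Add_Neg_cancel3:
  assumes "f \<in> Arr C" and "g \<in> Arr C" and "h \<in> Arr C"
    and "Dom C f = Dom C g" and "Cod C f = Cod C g" and "Dom C g = Dom C h" and "Cod C g = Cod C h"
  shows "f \<boxplus> (g \<boxplus> (h \<boxplus> Neg C f)) = g \<boxplus> h"
  using assms by (simp add: Add_left_commute[of f] Add_commute[of h])

text \<open>Existence and uniqueness are tested on representatives. Two factorisations through
  \<open>cls k\<close> differ by an arrow whose composite with \<open>k\<close> lies in the ideal,
  so uniqueness only has to be checked against zero.\<close>

lemma (in arrow_ideal) kernel_arrow_QI:
  assumes f: "f \<in> Arr C" and k: "k \<in> Arr C" "Cod C k = Dom C f" and kf: "k \<cdot> f \<in> I"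
    and lift: "\<And>g. g \<in> Arr C \<Longrightarrow> Cod C g = Dom C f \<Longrightarrow> g \<cdot> f \<in> I \<Longrightarrow>
                 \<exists>u\<in>Hom C (Dom C g) (Dom C k). cls (u \<cdot> k) = cls g"
    and mono: "\<And>u. u \<in> Arr C \<Longrightarrow> Cod C u = Dom C k \<Longrightarrow> u \<cdot> k \<in> I \<Longrightarrow> u \<in> I"
  shows "kernel_arrow Q (cls f) (cls k)"
  unfolding kernel_arrow_def
proof (intro conjI allI ballI impI)
  show "cls f \<in> Arr Q" "cls k \<in> Arr Q" "Cod Q (cls k) = Dom Q (cls f)"
    using f k by (simp_all add: Arr_Q)
  show "cls k \<cdot>\<^bsub>Q\<^esub> cls f = ZeroArr Q (Dom Q (cls k)) (Cod Q (cls f))"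
    using f k kf by (simp add: cls_eq_Zero_iff)
  fix T c
  assume "c \<in> Hom Q T (Dom Q (cls f))" and zero: "c \<cdot>\<^bsub>Q\<^esub> cls f = ZeroArr Q T (Cod Q (cls f))"
  then obtain g where g: "g \<in> Arr C" "Dom C g = T" "Cod C g = Dom C f" "c = cls g"
    using f by (auto elim: Hom_Q_E)
  have "g \<cdot> f \<in> I"
    using zero f g by (simp add: cls_eq_Zero_iff)
  then obtain u where u: "u \<in> Hom C (Dom C g) (Dom C k)" "cls (u \<cdot> k) = cls g"
    using lift g by blast
  show "\<exists>!u. u \<in> Hom Q T (Dom Q (cls k)) \<and> u \<cdot>\<^bsub>Q\<^esub> cls k = c"
  proof (rule ex1I)
    show "cls u \<in> Hom Q T (Dom Q (cls k)) \<and> cls u \<cdot>\<^bsub>Q\<^esub> cls k = c"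
      using u g k by (simp add: Hom_iff[where C = C])
    fix d
    assume d: "d \<in> Hom Q T (Dom Q (cls k)) \<and> d \<cdot>\<^bsub>Q\<^esub> cls k = c"
    then obtain v where v: "v \<in> Arr C" "Dom C v = T" "Cod C v = Dom C k" "d = cls v"
      using k by (auto elim: Hom_Q_E)
    have u': "u \<in> Arr C" "Dom C u = T" "Cod C u = Dom C k"
      using u(1) g(2) by (simp_all add: Hom_iff)
    have "cls (v \<cdot> k) = cls (u \<cdot> k)"
      using d v k u(2) g(4) by simp
    then have "v \<cdot> k \<boxplus> Neg C (u \<cdot> k) \<in> I"
      using v(1-3) k u' by (simp add: cls_eq_iff)
    then have "(v \<boxplus> Neg C u) \<cdot> k \<in> I"
      using v(1-3) k u' by (simp add: Comp_Add_distrib Comp_Neg)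
    with v(1-3) k u' have "v \<boxplus> Neg C u \<in> I"
      by (intro mono[of "v \<boxplus> Neg C u"]) simp_all
    then show "d = cls u"
      using v u' by (simp add: cls_eq_iff)
  qed
qed

text \<open>In the quotient, \<open>k\<close> and the zero arrow have the same composite with the
  monomorphism \<open>f\<close>.\<close>

lemma (in arrow_ideal) mono_arrow_QD:
  assumes mono: "mono_arrow Q (cls f)" and f: "f \<in> Arr C"
    and k: "k \<in> Arr C" "Cod C k = Dom C f" and kf: "k \<cdot> f \<in> I"
  shows "k \<in> I"
proof -
  let ?z = "ZeroArr C (Dom C k) (Dom C f)"
  have "cls k \<in> Hom Q (Dom C k) (Dom Q (cls f))" "cls ?z \<in> Hom Q (Dom C k) (Dom Q (cls f))"
    using f k by simp_all
  moreover have "cls k \<cdot>\<^bsub>Q\<^esub> cls f = cls ?z \<cdot>\<^bsub>Q\<^esub> cls f"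
    using f k kf by (simp add: cls_eq_Zero_iff)
  ultimately have "cls k = cls ?z"
    using mono unfolding mono_arrow_def by blast
  then show ?thesis
    using k by (simp add: cls_eq_Zero_iff)
qed

text \<open>
  Read in an abelian category, a diagram \<open>A\<close> stands for the quotient of \<open>ker a\<^sub>1\<close> by its intersection
  with \<open>im a\<^sub>0\<close>. The kernel of \<open>f: A \<rightarrow> B\<close> consists of pairs \<open>(x, y)\<close> in \<open>A\<^sub>1 \<oplus> B\<^sub>0\<close> with
  \<open>x a\<^sub>1 = 0\<close> and \<open>x f\<^sub>1 + y b\<^sub>0 = 0\<close>, modulo the image of \<open>A\<^sub>0 \<oplus> B\<^sub>0\<close>.
\<close>

definition kernel_data :: "('o, 'm) addcat \<Rightarrow> 'm dmor \<Rightarrow> 'm dmor \<Rightarrow> bool" where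
  "kernel_data C f k \<longleftrightarrow> f \<in> diagram_morphisms C \<and>
     (\<exists>S0 i0 j0 p0 q0 S1 i1 j1 p1 q1 S2 i2 j2 p2 q2.
        biproduct C (Dom C (edge0 (src f))) (Dom C (edge0 (tgt f))) S0 i0 j0 p0 q0 \<and>
        biproduct C (Cod C (edge0 (src f))) (Dom C (edge0 (tgt f))) S1 i1 j1 p1 q1 \<and>
        biproduct C (Cod C (edge1 (src f))) (Cod C (edge0 (tgt f))) S2 i2 j2 p2 q2 \<and>
        k = DMor
          (Diag
            (p0 \<cdot>\<^bsub>C\<^esub> (edge0 (src f) \<cdot>\<^bsub>C\<^esub> i1) \<boxplus>\<^bsub>C\<^esub> q0 \<cdot>\<^bsub>C\<^esub> j1)
            (p1 \<cdot>\<^bsub>C\<^esub> (edge1 (src f) \<cdot>\<^bsub>C\<^esub> i2) \<boxplus>\<^bsub>C\<^esub>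
              (p1 \<cdot>\<^bsub>C\<^esub> (comp1 f \<cdot>\<^bsub>C\<^esub> j2) \<boxplus>\<^bsub>C\<^esub> q1 \<cdot>\<^bsub>C\<^esub> (edge0 (tgt f) \<cdot>\<^bsub>C\<^esub> j2))))
          (src f) p0 p1 p2)"

text \<open>A middle vertex is the target of one edge and the source of the other. It is written
  here as the source of \<open>edge1\<close> throughout, which gives the simplifier a normal form
  for endpoints.\<close>

lemma diagram_morphismD:
  assumes "f \<in> diagram_morphisms C"
  shows "edge0 (src f) \<in> Arr C" and "edge1 (src f) \<in> Arr C"
    and "Cod C (edge0 (src f)) = Dom C (edge1 (src f))"
    and "edge0 (tgt f) \<in> Arr C" and "edge1 (tgt f) \<in> Arr C"
    and "Cod C (edge0 (tgt f)) = Dom C (edge1 (tgt f))"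
    and "comp0 f \<in> Arr C" and "Dom C (comp0 f) = Dom C (edge0 (src f))"
    and "Cod C (comp0 f) = Dom C (edge0 (tgt f))"
    and "comp1 f \<in> Arr C" and "Dom C (comp1 f) = Dom C (edge1 (src f))"
    and "Cod C (comp1 f) = Dom C (edge1 (tgt f))"
    and "comp2 f \<in> Arr C" and "Dom C (comp2 f) = Cod C (edge1 (src f))"
    and "Cod C (comp2 f) = Cod C (edge1 (tgt f))"
  using assms by (simp_all add: diagram_morphisms_iff diagrams_iff)

section \<open>The kernel formula and its universal property\<close>

context base_category
begin

lemma diagram_morphism_squares:
  assumes "f \<in> diagram_morphisms C"
  shows "edge0 (src f) \<cdot> comp1 f = comp0 f \<cdot> edge0 (tgt f)"
    and "edge1 (src f) \<cdot> comp2 f = comp1 f \<cdot> edge1 (tgt f)"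
    and "h \<in> Arr C \<Longrightarrow> Dom C h = Dom C (edge1 (tgt f)) \<Longrightarrow>
          edge0 (src f) \<cdot> (comp1 f \<cdot> h) = comp0 f \<cdot> (edge0 (tgt f) \<cdot> h)"
    and "h \<in> Arr C \<Longrightarrow> Dom C h = Cod C (edge1 (tgt f)) \<Longrightarrow>
          edge1 (src f) \<cdot> (comp2 f \<cdot> h) = comp1 f \<cdot> (edge1 (tgt f) \<cdot> h)"
  using assms diagram_morphismD[OF assms]
  by (simp_all add: Comp_Comp[symmetric] diagram_morphisms_iff)

text \<open>The same data with middle vertices in the normal form of
  \<open>diagram_morphismD\<close>.\<close>

lemma kernel_dataE:
  assumes "kernel_data C f k"
  obtains S0 i0 j0 p0 q0 S1 i1 j1 p1 q1 S2 i2 j2 p2 q2 where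
    "biproduct C (Dom C (edge0 (src f))) (Dom C (edge0 (tgt f))) S0 i0 j0 p0 q0"
    "biproduct C (Dom C (edge1 (src f))) (Dom C (edge0 (tgt f))) S1 i1 j1 p1 q1"
    "biproduct C (Cod C (edge1 (src f))) (Dom C (edge1 (tgt f))) S2 i2 j2 p2 q2"
    "edge0 (src k) = p0 \<cdot> (edge0 (src f) \<cdot> i1) \<boxplus> q0 \<cdot> j1"
    "edge1 (src k) = p1 \<cdot> (edge1 (src f) \<cdot> i2) \<boxplus>
       (p1 \<cdot> (comp1 f \<cdot> j2) \<boxplus> q1 \<cdot> (edge0 (tgt f) \<cdot> j2))"
    "tgt k = src f" "comp0 k = p0" "comp1 k = p1" "comp2 k = p2"
proof -
  obtain S0 i0 j0 p0 q0 S1 i1 j1 p1 q1 S2 i2 j2 p2 q2 where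
    bp: "biproduct C (Dom C (edge0 (src f))) (Dom C (edge0 (tgt f))) S0 i0 j0 p0 q0"
        "biproduct C (Cod C (edge0 (src f))) (Dom C (edge0 (tgt f))) S1 i1 j1 p1 q1"
        "biproduct C (Cod C (edge1 (src f))) (Cod C (edge0 (tgt f))) S2 i2 j2 p2 q2"
    and k: "k = DMor (Diag (p0 \<cdot> (edge0 (src f) \<cdot> i1) \<boxplus> q0 \<cdot> j1)
       (p1 \<cdot> (edge1 (src f) \<cdot> i2) \<boxplus> (p1 \<cdot> (comp1 f \<cdot> j2) \<boxplus> q1 \<cdot> (edge0 (tgt f) \<cdot> j2))))
          (src f) p0 p1 p2"
    and f: "f \<in> diagram_morphisms C"
    using assms unfolding kernel_data_def by blast
  show thesis
    using that[of S0 i0 j0 p0 q0 S1 i1 j1 p1 q1 S2 i2 j2 p2 q2] bp k diagram_morphismD(3,6)[OF f]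
    by simp
qed

lemma kernel_data_exists:
  assumes "f \<in> diagram_morphisms C"
  shows "\<exists>k. kernel_data C f k"
proof -
  note d = diagram_morphismD[OF assms]
  obtain S0 i0 j0 p0 q0 where "biproduct C (Dom C (edge0 (src f))) (Dom C (edge0 (tgt f))) S0 i0 j0 p0 q0"
    using biproducts[of "Dom C (edge0 (src f))" "Dom C (edge0 (tgt f))"] d by auto
  moreover obtain S1 i1 j1 p1 q1 where "biproduct C (Cod C (edge0 (src f))) (Dom C (edge0 (tgt f))) S1 i1 j1 p1 q1"
    using biproducts[of "Cod C (edge0 (src f))" "Dom C (edge0 (tgt f))"] d by auto
  moreover obtain S2 i2 j2 p2 q2 where "biproduct C (Cod C (edge1 (src f))) (Cod C (edge0 (tgt f))) S2 i2 j2 p2 q2"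
    using biproducts[of "Cod C (edge1 (src f))" "Cod C (edge0 (tgt f))"] d by auto
  ultimately show ?thesis
    using assms unfolding kernel_data_def by blast
qed

context
  fixes f k :: "'m dmor"
  assumes data: "kernel_data C f k"
begin

lemma kernel_data_source: "f \<in> diagram_morphisms C"
  using data by (simp add: kernel_data_def)

lemma kernel_data_tgt: "tgt k = src f"
  using data by (auto simp: kernel_data_def)

lemmas f_simps = diagram_morphismD[OF kernel_data_source] diagram_morphism_squares[OF kernel_data_source]

lemma kernel_data_arrow: "k \<in> diagram_morphisms C"
  using data
proof (rule kernel_dataE)
  fix S0 i0 j0 p0 q0 S1 i1 j1 p1 q1 S2 i2 j2 p2 q2
  assume bp: "biproduct C (Dom C (edge0 (src f))) (Dom C (edge0 (tgt f))) S0 i0 j0 p0 q0"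
    "biproduct C (Dom C (edge1 (src f))) (Dom C (edge0 (tgt f))) S1 i1 j1 p1 q1"
    "biproduct C (Cod C (edge1 (src f))) (Dom C (edge1 (tgt f))) S2 i2 j2 p2 q2"
    and k: "edge0 (src k) = p0 \<cdot> (edge0 (src f) \<cdot> i1) \<boxplus> q0 \<cdot> j1"
    "edge1 (src k) = p1 \<cdot> (edge1 (src f) \<cdot> i2) \<boxplus>
       (p1 \<cdot> (comp1 f \<cdot> j2) \<boxplus> q1 \<cdot> (edge0 (tgt f) \<cdot> j2))"
    "tgt k = src f" "comp0 k = p0" "comp1 k = p1" "comp2 k = p2"
  show "k \<in> diagram_morphisms C"
    by (simp add: diagram_morphisms_iff diagrams_iff k f_simps biproduct_simps[OF bp(1)]
        biproduct_simps[OF bp(2)] biproduct_simps[OF bp(3)] Comp_Add_distrib Comp_Comp)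
qed

lemma kernel_data_null: "k \<cdot>\<^bsub>Delta2 C\<^esub> f \<in> null_homotopic C"
  using data
proof (rule kernel_dataE)
  fix S0 i0 j0 p0 q0 S1 i1 j1 p1 q1 S2 i2 j2 p2 q2
  assume bp: "biproduct C (Dom C (edge0 (src f))) (Dom C (edge0 (tgt f))) S0 i0 j0 p0 q0"
    "biproduct C (Dom C (edge1 (src f))) (Dom C (edge0 (tgt f))) S1 i1 j1 p1 q1"
    "biproduct C (Cod C (edge1 (src f))) (Dom C (edge1 (tgt f))) S2 i2 j2 p2 q2"
    and k: "edge0 (src k) = p0 \<cdot> (edge0 (src f) \<cdot> i1) \<boxplus> q0 \<cdot> j1"
    "edge1 (src k) = p1 \<cdot> (edge1 (src f) \<cdot> i2) \<boxplus>
       (p1 \<cdot> (comp1 f \<cdot> j2) \<boxplus> q1 \<cdot> (edge0 (tgt f) \<cdot> j2))"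
    "tgt k = src f" "comp0 k = p0" "comp1 k = p1" "comp2 k = p2"
  show ?thesis
  \<comment> \<open>With \<open>f1\<close> for \<open>comp1 f\<close> and \<open>b0\<close> for
    \<open>edge0 (tgt f)\<close>, the second kernel edge followed by \<open>q2\<close> is
    \<open>p1 f1 + q1 b0\<close>; the choice of \<open>s\<close> removes the second summand.\<close>
  proof (rule null_homotopicI[where s = "Neg C q1" and t = "q2"])
    show "k \<cdot>\<^bsub>Delta2 C\<^esub> f \<in> diagram_morphisms C"
      using D.Comp_simps(1)[of k f] kernel_data_arrow kernel_data_source kernel_data_tgt
      by simp
    show "Neg C q1 \<cdot> edge0 (tgt (k \<cdot>\<^bsub>Delta2 C\<^esub> f)) \<boxplus> edge1 (src (k \<cdot>\<^bsub>Delta2 C\<^esub> f)) \<cdot> q2 =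
        comp1 (k \<cdot>\<^bsub>Delta2 C\<^esub> f)"
      by (simp add: k f_simps biproduct_simps[OF bp(1)]
        biproduct_simps[OF bp(2)] biproduct_simps[OF bp(3)] Comp_Add_distrib Comp_Comp Comp_Neg Add_ac)
  qed (simp_all add: k f_simps biproduct_simps[OF bp(1)]
        biproduct_simps[OF bp(2)] biproduct_simps[OF bp(3)])
qed

text \<open>A homotopy \<open>(s, t)\<close> for \<open>g f\<close> says that
  \<open>comp1 g \<cdot> comp1 f\<close> is \<open>s b0 + T1 t\<close>, with \<open>b0\<close> the
  first edge of \<open>tgt f\<close> and \<open>T1\<close> the second edge of \<open>src g\<close>.
  So \<open>-s\<close> is the second coordinate that has to accompany \<open>comp1 g\<close>, and
  \<open>T1 t\<close> is what the second kernel edge then produces in its new coordinate. The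
  factorisation holds before passing to classes.\<close>

lemma kernel_data_lift:
  assumes g: "g \<in> diagram_morphisms C" "tgt g = src f" and gf: "g \<cdot>\<^bsub>Delta2 C\<^esub> f \<in> null_homotopic C"
  shows "\<exists>u\<in>Hom (Delta2 C) (src g) (src k). u \<cdot>\<^bsub>Delta2 C\<^esub> k = g"
  using data
proof (rule kernel_dataE)
  fix S0 i0 j0 p0 q0 S1 i1 j1 p1 q1 S2 i2 j2 p2 q2
  assume bp: "biproduct C (Dom C (edge0 (src f))) (Dom C (edge0 (tgt f))) S0 i0 j0 p0 q0"
    "biproduct C (Dom C (edge1 (src f))) (Dom C (edge0 (tgt f))) S1 i1 j1 p1 q1"
    "biproduct C (Cod C (edge1 (src f))) (Dom C (edge1 (tgt f))) S2 i2 j2 p2 q2"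
    and k: "edge0 (src k) = p0 \<cdot> (edge0 (src f) \<cdot> i1) \<boxplus> q0 \<cdot> j1"
    "edge1 (src k) = p1 \<cdot> (edge1 (src f) \<cdot> i2) \<boxplus>
       (p1 \<cdot> (comp1 f \<cdot> j2) \<boxplus> q1 \<cdot> (edge0 (tgt f) \<cdot> j2))"
    "tgt k = src f" "comp0 k = p0" "comp1 k = p1" "comp2 k = p2"
  note gD = diagram_morphismD[OF g(1), unfolded g(2)]
    diagram_morphism_squares[OF g(1), unfolded g(2)]
  obtain s t where st: "s \<in> Arr C" "Dom C s = Dom C (edge1 (src g))" "Cod C s = Dom C (edge0 (tgt f))"
    "t \<in> Arr C" "Dom C t = Cod C (edge1 (src g))" "Cod C t = Dom C (edge1 (tgt f))"
    "comp1 g \<cdot> comp1 f = s \<cdot> edge0 (tgt f) \<boxplus> edge1 (src g) \<cdot> t"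
    using gf by (auto simp: null_homotopic_iff gD f_simps)
  have eq: "comp1 g \<cdot> (comp1 f \<cdot> h) = s \<cdot> (edge0 (tgt f) \<cdot> h) \<boxplus> edge1 (src g) \<cdot> (t \<cdot> h)"
    if h: "h \<in> Arr C" "Dom C h = Dom C (edge1 (tgt f))" for h
  proof -
    have "comp1 g \<cdot> (comp1 f \<cdot> h) = (comp1 g \<cdot> comp1 f) \<cdot> h"
      using h by (simp add: Comp_Comp gD f_simps)
    then show ?thesis
      using h st(1-6) unfolding st(7) by (simp add: Comp_Comp Comp_Add_distrib gD f_simps)
  qed
  note simps = k gD f_simps st eq biproduct_simps[OF bp(1)] biproduct_simps[OF bp(2)] biproduct_simps[OF bp(3)]
  \<comment> \<open>In coordinates: \<open>(g0, -T0 s)\<close>, \<open>(g1, -s)\<close>,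
    \<open>(g2, t)\<close>, where \<open>g0\<close>, \<open>g1\<close>, \<open>g2\<close> are the
    components of \<open>g\<close> and \<open>T0\<close> is the first edge of its source; the entry
    \<open>-T0 s\<close> is forced by the left square.\<close>
  let ?u = "DMor (src g) (src k) (comp0 g \<cdot> i0 \<boxplus> Neg C (edge0 (src g) \<cdot> (s \<cdot> j0)))
    (comp1 g \<cdot> i1 \<boxplus> Neg C (s \<cdot> j1)) (comp2 g \<cdot> i2 \<boxplus> t \<cdot> j2)"
  have "?u \<in> Hom (Delta2 C) (src g) (src k)"
    by (simp add: Hom_iff diagram_morphisms_iff diagrams_iff simps Comp_Comp Comp_Add_distrib Comp_Neg
        Add_ac Add_Neg_cancel3)
  moreover have "?u \<cdot>\<^bsub>Delta2 C\<^esub> k = g"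
    by (rule dmor_eqI) (simp_all add: simps g Comp_Comp Comp_Add_distrib Comp_Neg)
  ultimately show ?thesis
    by blast
qed

text \<open>The first kernel edge carries the second summand of \<open>S0\<close> identically onto
  that of \<open>S1\<close>; this is why \<open>S0\<close> contains an extra copy of
  \<open>Dom C (edge0 (tgt f))\<close>. Hence the second coordinate of \<open>comp1 u\<close>
  factors through that edge, and a homotopy for \<open>u k\<close> takes care of the first
  coordinate.\<close>

lemma kernel_data_mono:
  assumes u: "u \<in> diagram_morphisms C" "tgt u = src k" and uk: "u \<cdot>\<^bsub>Delta2 C\<^esub> k \<in> null_homotopic C"
  shows "u \<in> null_homotopic C"
  using data
proof (rule kernel_dataE)
  fix S0 i0 j0 p0 q0 S1 i1 j1 p1 q1 S2 i2 j2 p2 q2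
  assume bp: "biproduct C (Dom C (edge0 (src f))) (Dom C (edge0 (tgt f))) S0 i0 j0 p0 q0"
    "biproduct C (Dom C (edge1 (src f))) (Dom C (edge0 (tgt f))) S1 i1 j1 p1 q1"
    "biproduct C (Cod C (edge1 (src f))) (Dom C (edge1 (tgt f))) S2 i2 j2 p2 q2"
    and k: "edge0 (src k) = p0 \<cdot> (edge0 (src f) \<cdot> i1) \<boxplus> q0 \<cdot> j1"
    "edge1 (src k) = p1 \<cdot> (edge1 (src f) \<cdot> i2) \<boxplus>
       (p1 \<cdot> (comp1 f \<cdot> j2) \<boxplus> q1 \<cdot> (edge0 (tgt f) \<cdot> j2))"
    "tgt k = src f" "comp0 k = p0" "comp1 k = p1" "comp2 k = p2"
  note simps = k f_simps biproduct_simps[OF bp(1)] biproduct_simps[OF bp(2)] biproduct_simps[OF bp(3)]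
  have e1: "Dom C (edge1 (src k)) = S1" "Cod C (edge1 (src k)) = S2" "Dom C (edge0 (src k)) = S0"
    by (simp_all add: simps)
  note uD = diagram_morphismD(1-3,7-15)[OF u(1), unfolded u(2) e1]
  obtain s t where st: "s \<in> Arr C" "Dom C s = Dom C (edge1 (src u))" "Cod C s = Dom C (edge0 (src f))"
    "t \<in> Arr C" "Dom C t = Cod C (edge1 (src u))" "Cod C t = Dom C (edge1 (src f))"
    "s \<cdot> edge0 (src f) \<boxplus> edge1 (src u) \<cdot> t = comp1 u \<cdot> p1"
    using uk by (auto simp: null_homotopic_iff k f_simps uD)
  have eq: "comp1 u \<cdot> (p1 \<cdot> i1) = s \<cdot> (edge0 (src f) \<cdot> i1) \<boxplus> edge1 (src u) \<cdot> (t \<cdot> i1)"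
  proof -
    have "comp1 u \<cdot> (p1 \<cdot> i1) = (comp1 u \<cdot> p1) \<cdot> i1"
      by (simp add: Comp_Comp uD simps)
    then show ?thesis
      using st(1-6) unfolding st(7)[symmetric] by (simp add: Comp_Comp Comp_Add_distrib uD simps)
  qed
  have "comp1 u = comp1 u \<cdot> (p1 \<cdot> i1 \<boxplus> q1 \<cdot> j1)"
    by (simp add: simps uD)
  also have "\<dots> = comp1 u \<cdot> (p1 \<cdot> i1) \<boxplus> comp1 u \<cdot> (q1 \<cdot> j1)"
    by (subst Comp_Add_distrib) (simp_all add: simps uD)
  finally have decomp: "comp1 u = comp1 u \<cdot> (p1 \<cdot> i1) \<boxplus> comp1 u \<cdot> (q1 \<cdot> j1)" .
  show "u \<in> null_homotopic C"
  proof (rule null_homotopicI[where s = "s \<cdot> i0 \<boxplus> comp1 u \<cdot> (q1 \<cdot> j0)" and t = "t \<cdot> i1"])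
    show "(s \<cdot> i0 \<boxplus> comp1 u \<cdot> (q1 \<cdot> j0)) \<cdot> edge0 (tgt u) \<boxplus> edge1 (src u) \<cdot> (t \<cdot> i1) = comp1 u"
      using st(1-6) by (subst decomp) (simp add: u uD eq simps Comp_Comp Comp_Add_distrib Add_ac)
  qed (use st(1-6) in \<open>simp_all add: u uD simps\<close>)
qed

lemma kernel_data_kernel: "kernel_arrow (Adel C) (adel_class C f) (adel_class C k)"
  unfolding Adel_def adel_class_def
proof (rule Q.kernel_arrow_QI)
  fix g
  assume "g \<in> Arr (Delta2 C)" "Cod (Delta2 C) g = Dom (Delta2 C) f"
    "g \<cdot>\<^bsub>Delta2 C\<^esub> f \<in> null_homotopic C"
  then obtain u where "u \<in> Hom (Delta2 C) (src g) (src k)" "u \<cdot>\<^bsub>Delta2 C\<^esub> k = g"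
    using kernel_data_lift[of g] by auto
  then show "\<exists>u\<in>Hom (Delta2 C) (Dom (Delta2 C) g) (Dom (Delta2 C) k). 
      Q.cls (u \<cdot>\<^bsub>Delta2 C\<^esub> k) = Q.cls g"
    by (auto simp del: Delta2_simps(6))
qed (use kernel_data_arrow kernel_data_source kernel_data_tgt kernel_data_null kernel_data_mono in auto)

end

end


section \<open>Monomorphisms are kernels\<close>

text \<open>As \<open>Add_Neg_cancel3\<close>, with a further summand behind the negative.\<close>

lemma (in preadditive_category) Add_Neg_cancel4:
  assumes "f \<in> Arr C" and "g \<in> Arr C" and "h \<in> Arr C" and "k \<in> Arr C"
    and "Dom C f = Dom C g" and "Cod C f = Cod C g" and "Dom C g = Dom C h" and "Cod C g = Cod C h"
    and "Dom C h = Dom C k" and "Cod C h = Cod C k"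
  shows "f \<boxplus> (g \<boxplus> (h \<boxplus> (Neg C f \<boxplus> k))) = g \<boxplus> (h \<boxplus> k)"
  using assms by (simp add: Add_left_commute[of f])

context base_category
begin

text \<open>Monicity forces the kernel arrow \<open>k\<close> to be null-homotopic, so its middle
  component, a projection from the biproduct \<open>S1\<close>, has the form
  \<open>s a0 + k1 t\<close> with \<open>a0\<close> the first edge of \<open>src f\<close> and
  \<open>k1\<close> the second edge of \<open>src k\<close>. The four arrows are the blocks of
  \<open>s\<close> and \<open>t\<close>, and the two equations are the restrictions to the two
  summands of \<open>S1\<close>.\<close>

lemma mono_splitting:
  assumes f: "f \<in> diagram_morphisms C" and mono: "mono_arrow (Adel C) (adel_class C f)"
  obtains s1 s2 t1 t2 where
    "s1 \<in> Arr C" "Dom C s1 = Dom C (edge1 (src f))" "Cod C s1 = Dom C (edge0 (src f))"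
    "s2 \<in> Arr C" "Dom C s2 = Dom C (edge0 (tgt f))" "Cod C s2 = Dom C (edge0 (src f))"
    "t1 \<in> Arr C" "Dom C t1 = Cod C (edge1 (src f))" "Cod C t1 = Dom C (edge1 (src f))"
    "t2 \<in> Arr C" "Dom C t2 = Dom C (edge1 (tgt f))" "Cod C t2 = Dom C (edge1 (src f))"
    "s1 \<cdot> edge0 (src f) \<boxplus> (edge1 (src f) \<cdot> t1 \<boxplus> comp1 f \<cdot> t2) = Ident C (Dom C (edge1 (src f)))"
    "s2 \<cdot> edge0 (src f) \<boxplus> edge0 (tgt f) \<cdot> t2 =
       ZeroArr C (Dom C (edge0 (tgt f))) (Dom C (edge1 (src f)))"
proof -
  obtain k where data: "kernel_data C f k"
    using kernel_data_exists[OF f] by blast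
  have null: "k \<in> null_homotopic C"
    using Q.mono_arrow_QD[of f k] mono f kernel_data_arrow[OF data] kernel_data_tgt[OF data]
      kernel_data_null[OF data]
    by (simp add: Adel_def adel_class_def)
  obtain S0 i0 j0 p0 q0 S1 i1 j1 p1 q1 S2 i2 j2 p2 q2 where bp:
    "biproduct C (Dom C (edge0 (src f))) (Dom C (edge0 (tgt f))) S0 i0 j0 p0 q0"
    "biproduct C (Dom C (edge1 (src f))) (Dom C (edge0 (tgt f))) S1 i1 j1 p1 q1"
    "biproduct C (Cod C (edge1 (src f))) (Dom C (edge1 (tgt f))) S2 i2 j2 p2 q2"
    and k: "edge0 (src k) = p0 \<cdot> (edge0 (src f) \<cdot> i1) \<boxplus> q0 \<cdot> j1"
    "edge1 (src k) = p1 \<cdot> (edge1 (src f) \<cdot> i2) \<boxplus>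
       (p1 \<cdot> (comp1 f \<cdot> j2) \<boxplus> q1 \<cdot> (edge0 (tgt f) \<cdot> j2))"
    "tgt k = src f" "comp0 k = p0" "comp1 k = p1" "comp2 k = p2"
    using data by (rule kernel_dataE)
  note simps = k diagram_morphismD[OF f] biproduct_simps[OF bp(1)] biproduct_simps[OF bp(2)]
    biproduct_simps[OF bp(3)]
  obtain s t where st: "s \<in> Arr C" "Dom C s = S1" "Cod C s = Dom C (edge0 (src f))"
    "t \<in> Arr C" "Dom C t = S2" "Cod C t = Dom C (edge1 (src f))"
    "s \<cdot> edge0 (src f) \<boxplus> edge1 (src k) \<cdot> t = p1"
    using null by (auto simp: null_homotopic_iff simps)
  \<comment> \<open>Restriction along \<open>i1\<close> makes the projection an identity; below,
    restriction along \<open>j1\<close> makes it zero.\<close>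
  have "i1 \<cdot> (s \<cdot> edge0 (src f) \<boxplus> edge1 (src k) \<cdot> t) = Ident C (Dom C (edge1 (src f)))"
    unfolding st(7) by (simp add: simps)
  then have e1: "(i1 \<cdot> s) \<cdot> edge0 (src f) \<boxplus> (edge1 (src f) \<cdot> (i2 \<cdot> t) \<boxplus> comp1 f \<cdot> (j2 \<cdot> t)) =
      Ident C (Dom C (edge1 (src f)))"
    using st(1-6) by (simp add: simps Comp_Add_distrib Comp_Comp)
  have "j1 \<cdot> (s \<cdot> edge0 (src f) \<boxplus> edge1 (src k) \<cdot> t) =
      ZeroArr C (Dom C (edge0 (tgt f))) (Dom C (edge1 (src f)))"
    unfolding st(7) by (simp add: simps)
  then have e2: "(j1 \<cdot> s) \<cdot> edge0 (src f) \<boxplus> edge0 (tgt f) \<cdot> (j2 \<cdot> t) =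
      ZeroArr C (Dom C (edge0 (tgt f))) (Dom C (edge1 (src f)))"
    using st(1-6) by (simp add: simps Comp_Add_distrib Comp_Comp)
  show thesis
    by (rule that[OF _ _ _ _ _ _ _ _ _ _ _ _ e1 e2]) (simp_all add: simps st(1-6))
qed

text \<open>The arrow \<open>f\<close> is the kernel of its cokernel \<open>c\<close>. A homotopy
  for \<open>g c\<close> yields an arrow \<open>q\<close> such that \<open>comp1 g\<close> equals
  \<open>q \<cdot> comp1 f\<close> up to homotopy terms, and the two equations of
  \<open>mono_splitting\<close> supply the corrections that turn \<open>q\<close> into the middle
  component of a morphism into \<open>src f\<close>. Uniqueness of the factorisation is monicity of
  \<open>f\<close>.\<close>

lemma mono_is_kernel:
  assumes f: "f \<in> diagram_morphisms C" and mono: "mono_arrow (Adel C) (adel_class C f)"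
  shows "\<exists>c. kernel_arrow (Adel C) c (adel_class C f)"
proof -
  let ?a0 = "edge0 (src f)" and ?a1 = "edge1 (src f)" and ?b0 = "edge0 (tgt f)"
    and ?b1 = "edge1 (tgt f)" and ?f1 = "comp1 f"
  note fD = diagram_morphismD[OF f] diagram_morphism_squares[OF f]
  obtain s1 s2 t1 t2 where split:
    "s1 \<in> Arr C" "Dom C s1 = Dom C ?a1" "Cod C s1 = Dom C ?a0"
    "s2 \<in> Arr C" "Dom C s2 = Dom C ?b0" "Cod C s2 = Dom C ?a0"
    "t1 \<in> Arr C" "Dom C t1 = Cod C ?a1" "Cod C t1 = Dom C ?a1"
    "t2 \<in> Arr C" "Dom C t2 = Dom C ?b1" "Cod C t2 = Dom C ?a1"
    and split_Ident: "s1 \<cdot> ?a0 \<boxplus> (?a1 \<cdot> t1 \<boxplus> ?f1 \<cdot> t2) = Ident C (Dom C ?a1)"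
    and split_Zero: "s2 \<cdot> ?a0 \<boxplus> ?b0 \<cdot> t2 = ZeroArr C (Dom C ?b0) (Dom C ?a1)"
    using f mono by (rule mono_splitting)
  obtain S0 i0 j0 p0 q0 where bp0: "biproduct C (Dom C ?b0) (Dom C ?a1) S0 i0 j0 p0 q0"
    using biproducts[of "Dom C ?b0" "Dom C ?a1"] fD by auto
  obtain S1 i1 j1 p1 q1 where bp1: "biproduct C (Dom C ?b1) (Cod C ?a1) S1 i1 j1 p1 q1"
    using biproducts[of "Dom C ?b1" "Cod C ?a1"] fD by auto
  obtain S2 i2 j2 p2 q2 where bp2: "biproduct C (Cod C ?b1) (Cod C ?a1) S2 i2 j2 p2 q2"
    using biproducts[of "Cod C ?b1" "Cod C ?a1"] fD by auto
  \<comment> \<open>\<open>c\<close> is the cokernel of \<open>f\<close>, dual to the kernel of \<open>kernel_data\<close>.\<close>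
  define c0 where "c0 = p0 \<cdot> (?b0 \<cdot> i1) \<boxplus> (q0 \<cdot> (?f1 \<cdot> i1) \<boxplus> q0 \<cdot> (?a1 \<cdot> j1))"
  define c1 where "c1 = p1 \<cdot> (?b1 \<cdot> i2) \<boxplus> q1 \<cdot> j2"
  define c where "c = DMor (tgt f) (Diag c0 c1) i0 i1 i2"
  note simps = fD biproduct_simps[OF bp0] biproduct_simps[OF bp1] biproduct_simps[OF bp2]
  have c0: "c0 \<in> Arr C" "Dom C c0 = S0" "Cod C c0 = S1"
    and c1: "c1 \<in> Arr C" "Dom C c1 = S1" "Cod C c1 = S2"
    by (simp_all add: c0_def c1_def simps)
  have c: "c \<in> diagram_morphisms C" "src c = tgt f" "tgt c = Diag c0 c1" "comp1 c = i1"
    by (simp_all add: c_def c0 c1 diagram_morphisms_iff diagrams_iff simps)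
       (simp_all add: c0_def c1_def simps Comp_Add_distrib)
  have fc: "f \<cdot>\<^bsub>Delta2 C\<^esub> c \<in> null_homotopic C"
  \<comment> \<open>The arrow \<open>j0 \<cdot> c0\<close> equals
    \<open>?f1 \<cdot> i1 \<boxplus> ?a1 \<cdot> j1\<close>; the choice of \<open>t\<close> cancels
    the second summand and leaves the middle component of \<open>f c\<close>.\<close>
  proof (rule null_homotopicI[where s = j0 and t = "Neg C j1"])
    show "f \<cdot>\<^bsub>Delta2 C\<^esub> c \<in> diagram_morphisms C"
      using D.Comp_simps(1)[of f c] f c by simp
    show "j0 \<cdot> edge0 (tgt (f \<cdot>\<^bsub>Delta2 C\<^esub> c)) \<boxplus> edge1 (src (f \<cdot>\<^bsub>Delta2 C\<^esub> c)) \<cdot> Neg C j1 =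
        comp1 (f \<cdot>\<^bsub>Delta2 C\<^esub> c)"
      by (simp add: c c0_def simps Comp_Add_distrib Comp_Neg Add_assoc)
  qed (simp_all add: c c0 simps)
  have "kernel_arrow Q.Q (Q.cls c) (Q.cls f)"
  proof (rule Q.kernel_arrow_QI)
    show "c \<in> Arr (Delta2 C)" "f \<in> Arr (Delta2 C)" "Cod (Delta2 C) f = Dom (Delta2 C) c"
      using c f by simp_all
    show "f \<cdot>\<^bsub>Delta2 C\<^esub> c \<in> null_homotopic C"
      by (rule fc)
    show "u \<in> null_homotopic C"
      if "u \<in> Arr (Delta2 C)" and "Cod (Delta2 C) u = Dom (Delta2 C) f"
        and "u \<cdot>\<^bsub>Delta2 C\<^esub> f \<in> null_homotopic C" for u
      using Q.mono_arrow_QD[of f u] that mono f by (simp add: Adel_def adel_class_def)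
    fix g
    assume "g \<in> Arr (Delta2 C)" "Cod (Delta2 C) g = Dom (Delta2 C) c"
      and gc: "g \<cdot>\<^bsub>Delta2 C\<^esub> c \<in> null_homotopic C"
    then have g: "g \<in> diagram_morphisms C" "tgt g = tgt f"
      using c by simp_all
    let ?T0 = "edge0 (src g)" and ?T1 = "edge1 (src g)"
    note gD = diagram_morphismD[OF g(1), unfolded g(2)]
      diagram_morphism_squares(1)[OF g(1), unfolded g(2)]
    obtain s t where st: "s \<in> Arr C" "Dom C s = Dom C ?T1" "Cod C s = S0"
      "t \<in> Arr C" "Dom C t = Cod C ?T1" "Cod C t = S1" "s \<cdot> c0 \<boxplus> ?T1 \<cdot> t = comp1 g \<cdot> i1"
      using gc by (auto simp: null_homotopic_iff c c0 gD)
    \<comment> \<open>Coordinates of the homotopy: \<open>p\<close>, \<open>q\<close> split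
      \<open>s\<close> along the summands of \<open>S0\<close>, and \<open>u\<close>,
      \<open>v\<close> split \<open>t\<close> along those of \<open>S1\<close>. Projecting the
      homotopy equation to the two summands of \<open>S1\<close> then expresses
      \<open>comp1 g\<close> and gives a relation for \<open>q \<cdot> ?a1\<close>.\<close>
    define p q u v where "p = s \<cdot> p0" and "q = s \<cdot> q0" and "u = t \<cdot> p1" and "v = t \<cdot> q1"
    have pquv: "p \<in> Arr C" "Dom C p = Dom C ?T1" "Cod C p = Dom C ?b0"
      "q \<in> Arr C" "Dom C q = Dom C ?T1" "Cod C q = Dom C ?a1"
      "u \<in> Arr C" "Dom C u = Cod C ?T1" "Cod C u = Dom C ?b1"
      "v \<in> Arr C" "Dom C v = Cod C ?T1" "Cod C v = Cod C ?a1"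
      by (simp_all add: p_def q_def u_def v_def st(1-6) simps)
    have "comp1 g = (s \<cdot> c0 \<boxplus> ?T1 \<cdot> t) \<cdot> p1"
      unfolding st(7) by (simp add: Comp_Comp gD simps)
    then have g1: "comp1 g = p \<cdot> ?b0 \<boxplus> (q \<cdot> ?f1 \<boxplus> ?T1 \<cdot> u)"
      using st(1-6) gD(1-6)
      by (simp add: c0_def p_def q_def u_def simps Comp_Comp Comp_Add_distrib Add_assoc)
    have "(s \<cdot> c0 \<boxplus> ?T1 \<cdot> t) \<cdot> q1 = ZeroArr C (Dom C ?T1) (Cod C ?a1)"
      unfolding st(7) by (simp add: Comp_Comp gD simps)
    then have zero: "q \<cdot> ?a1 \<boxplus> ?T1 \<cdot> v = ZeroArr C (Dom C ?T1) (Cod C ?a1)"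
      using st(1-6) gD(1-6)
      by (simp add: c0_def q_def v_def simps Comp_Comp Comp_Add_distrib Add_assoc)
    \<comment> \<open>\<open>q\<close> alone factors \<open>comp1 g\<close> up to homotopy but is not part of a morphism of diagrams;
      the term \<open>?T1 \<cdot> w\<close> repairs this without changing the homotopy class.\<close>
    define w where "w = v \<cdot> t1 \<boxplus> u \<cdot> t2"
    define m where "m = ?T0 \<cdot> p \<boxplus> Neg C (comp0 g)"
    have w: "w \<in> Arr C" "Dom C w = Cod C ?T1" "Cod C w = Dom C ?a1"
      and m: "m \<in> Arr C" "Dom C m = Dom C ?T0" "Cod C m = Dom C ?b0"
      by (simp_all add: w_def m_def pquv split gD simps)
    \<comment> \<open>The outer components are read off from the squares. On the right,
      \<open>q a1 = -T1 v\<close> suggests \<open>-v + w a1\<close>. On the left,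
      \<open>q + T1 w\<close> turns out to be \<open>q s1 a0 + (q f1 + T1 u) t2\<close>, and
      \<open>T0\<close> followed by the second part is \<open>m s2 a0\<close>.\<close>
    define h where "h = DMor (src g) (src f) (?T0 \<cdot> (q \<cdot> s1) \<boxplus> m \<cdot> s2) (q \<boxplus> ?T1 \<cdot> w)
      (Neg C v \<boxplus> w \<cdot> ?a1)"
    note arrs = split pquv w m gD(1-15) simps
    have T0_g1: "?T0 \<cdot> comp1 g = ?T0 \<cdot> (p \<cdot> ?b0) \<boxplus> (?T0 \<cdot> (q \<cdot> ?f1) \<boxplus> ?T0 \<cdot> (?T1 \<cdot> u))"
      unfolding g1 by (simp add: arrs Comp_Add_distrib)
    \<comment> \<open>No \<open>p\<close> survives in this composite: the left square of
      \<open>g\<close> replaces \<open>comp0 g \<cdot> ?b0\<close> by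
      \<open>?T0 \<cdot> comp1 g\<close>, whose expansion contains the same term with
      \<open>p\<close>.\<close>
    have "m \<cdot> ?b0 = ?T0 \<cdot> (p \<cdot> ?b0) \<boxplus> Neg C (?T0 \<cdot> comp1 g)"
      by (simp add: m_def arrs gD(16) Comp_Add_distrib Comp_Comp Comp_Neg)
    also have "\<dots> = Neg C (?T0 \<cdot> (q \<cdot> ?f1) \<boxplus> ?T0 \<cdot> (?T1 \<cdot> u))"
      unfolding T0_g1 by (simp add: arrs Neg_Add)
    finally have m_b0: "m \<cdot> ?b0 = Neg C (?T0 \<cdot> (q \<cdot> ?f1) \<boxplus> ?T0 \<cdot> (?T1 \<cdot> u))" .
    have s2_a0: "s2 \<cdot> ?a0 = Neg C (?b0 \<cdot> t2)"
      using split_Zero by (intro Neg_unique) (simp_all add: arrs Add_commute)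
    have "m \<cdot> (s2 \<cdot> ?a0) = Neg C ((m \<cdot> ?b0) \<cdot> t2)"
      unfolding s2_a0 by (simp add: arrs Comp_Neg Comp_Comp)
    also have "\<dots> = ?T0 \<cdot> (q \<cdot> (?f1 \<cdot> t2)) \<boxplus> ?T0 \<cdot> (?T1 \<cdot> (u \<cdot> t2))"
      unfolding m_b0 by (simp add: arrs Comp_Neg Comp_Comp Comp_Add_distrib)
    finally have m_s2_a0: "m \<cdot> (s2 \<cdot> ?a0) = ?T0 \<cdot> (q \<cdot> (?f1 \<cdot> t2)) \<boxplus> ?T0 \<cdot> (?T1 \<cdot> (u \<cdot> t2))" .
    have q_a1: "q \<cdot> ?a1 = Neg C (?T1 \<cdot> v)"
      using zero by (intro Neg_unique) (simp_all add: arrs Add_commute)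
    \<comment> \<open>The splitting of the identity is inserted behind \<open>q\<close>, and
      \<open>q \<cdot> ?a1\<close> is replaced by means of \<open>v\<close>.\<close>
    have "q = q \<cdot> (s1 \<cdot> ?a0 \<boxplus> (?a1 \<cdot> t1 \<boxplus> ?f1 \<cdot> t2))"
      unfolding split_Ident by (simp add: arrs)
    also have "\<dots> = q \<cdot> (s1 \<cdot> ?a0) \<boxplus> ((q \<cdot> ?a1) \<cdot> t1 \<boxplus> q \<cdot> (?f1 \<cdot> t2))"
      by (simp add: arrs Comp_Add_distrib Comp_Comp)
    also have "\<dots> = q \<cdot> (s1 \<cdot> ?a0) \<boxplus> (Neg C (?T1 \<cdot> (v \<cdot> t1)) \<boxplus> q \<cdot> (?f1 \<cdot> t2))"
      unfolding q_a1 by (simp add: arrs Comp_Neg Comp_Comp)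
    finally have q_eq: "q = q \<cdot> (s1 \<cdot> ?a0) \<boxplus> (Neg C (?T1 \<cdot> (v \<cdot> t1)) \<boxplus> q \<cdot> (?f1 \<cdot> t2))" .
    \<comment> \<open>The summand \<open>v \<cdot> t1\<close> of \<open>w\<close> cancels the term
      with \<open>t1\<close>; the summand \<open>u \<cdot> t2\<close> adds the term that
      \<open>m_s2_a0\<close> requires.\<close>
    have "q \<boxplus> ?T1 \<cdot> w = ?T1 \<cdot> w \<boxplus> (q \<cdot> (s1 \<cdot> ?a0) \<boxplus> (Neg C (?T1 \<cdot> (v \<cdot> t1)) \<boxplus> q \<cdot> (?f1 \<cdot> t2)))"
      unfolding q_eq[symmetric] by (simp add: arrs Add_commute)
    also have "\<dots> = q \<cdot> (s1 \<cdot> ?a0) \<boxplus> (q \<cdot> (?f1 \<cdot> t2) \<boxplus> ?T1 \<cdot> (u \<cdot> t2))"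
    proof -
      have "?T1 \<cdot> w = ?T1 \<cdot> (v \<cdot> t1) \<boxplus> ?T1 \<cdot> (u \<cdot> t2)"
        by (simp add: w_def arrs Comp_Add_distrib)
      then show ?thesis
        by (simp add: arrs Add_assoc Add_Neg_cancel4)
           (simp add: arrs Add_ac)
    qed
    finally have h1: "q \<boxplus> ?T1 \<cdot> w = q \<cdot> (s1 \<cdot> ?a0) \<boxplus> (q \<cdot> (?f1 \<cdot> t2) \<boxplus> ?T1 \<cdot> (u \<cdot> t2))" .
    have "?T0 \<cdot> (q \<boxplus> ?T1 \<cdot> w) = (?T0 \<cdot> (q \<cdot> s1) \<boxplus> m \<cdot> s2) \<cdot> ?a0"
      unfolding h1 by (simp add: arrs Comp_Add_distrib Comp_Comp m_s2_a0)
    moreover have "?T1 \<cdot> (Neg C v \<boxplus> w \<cdot> ?a1) = (q \<boxplus> ?T1 \<cdot> w) \<cdot> ?a1"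
      by (simp add: arrs Comp_Add_distrib Comp_Comp Comp_Neg q_a1)
    ultimately have h: "h \<in> diagram_morphisms C" "src h = src g" "tgt h = src f"
      by (simp_all add: h_def diagram_morphisms_iff diagrams_iff arrs)
    have comps: "comp1 h = q \<boxplus> ?T1 \<cdot> w"
      by (simp add: h_def)
    \<comment> \<open>The terms \<open>q \<cdot> ?f1\<close> cancel, and the rest already has the
      form of a homotopy, with first arrow \<open>-p\<close> and second arrow
      \<open>w f1 - u\<close>.\<close>
    have "(q \<boxplus> ?T1 \<cdot> w) \<cdot> ?f1 \<boxplus> Neg C (comp1 g) =
        ?T1 \<cdot> (w \<cdot> ?f1) \<boxplus> (Neg C (p \<cdot> ?b0) \<boxplus> Neg C (?T1 \<cdot> u))"
      unfolding g1 by (simp add: arrs Comp_Comp Comp_Add_distrib Neg_Add Add_assoc Add_Neg_cancel4)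
    also have "\<dots> = Neg C p \<cdot> ?b0 \<boxplus> ?T1 \<cdot> (w \<cdot> ?f1 \<boxplus> Neg C u)"
      by (simp add: arrs Comp_Add_distrib Comp_Neg Add_ac)
    finally have eq: "Neg C p \<cdot> ?b0 \<boxplus> ?T1 \<cdot> (w \<cdot> ?f1 \<boxplus> Neg C u) =
        (q \<boxplus> ?T1 \<cdot> w) \<cdot> ?f1 \<boxplus> Neg C (comp1 g)" by (rule sym)
    have hf: "h \<cdot>\<^bsub>Delta2 C\<^esub> f \<in> diagram_morphisms C"
      using D.Comp_simps(1)[of h f] h f by simp
    have "h \<cdot>\<^bsub>Delta2 C\<^esub> f \<boxplus>\<^bsub>Delta2 C\<^esub> Neg (Delta2 C) g \<in> null_homotopic C"
    proof (rule null_homotopicI[where s = "Neg C p" and t = "w \<cdot> ?f1 \<boxplus> Neg C u"])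
      show "h \<cdot>\<^bsub>Delta2 C\<^esub> f \<boxplus>\<^bsub>Delta2 C\<^esub> Neg (Delta2 C) g \<in> diagram_morphisms C"
      proof -
        have "h \<cdot>\<^bsub>Delta2 C\<^esub> f \<in> Arr (Delta2 C)" "g \<in> Arr (Delta2 C)"
          using hf g by (simp_all only: Delta2_simps)
        then have "h \<cdot>\<^bsub>Delta2 C\<^esub> f \<boxplus>\<^bsub>Delta2 C\<^esub> Neg (Delta2 C) g \<in> Arr (Delta2 C)"
          using h(2) g(2) by (intro D.Add_simps(1) D.Neg_simps(1)) (simp_all add: Neg_Delta2[OF g(1)])
        then show ?thesis
          by (simp only: Delta2_simps)
      qed
      show "Neg C p \<cdot> edge0 (tgt (h \<cdot>\<^bsub>Delta2 C\<^esub> f \<boxplus>\<^bsub>Delta2 C\<^esub> Neg (Delta2 C) g)) \<boxplus>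
          edge1 (src (h \<cdot>\<^bsub>Delta2 C\<^esub> f \<boxplus>\<^bsub>Delta2 C\<^esub> Neg (Delta2 C) g)) \<cdot> (w \<cdot> ?f1 \<boxplus> Neg C u) =
          comp1 (h \<cdot>\<^bsub>Delta2 C\<^esub> f \<boxplus>\<^bsub>Delta2 C\<^esub> Neg (Delta2 C) g)"
        by (simp add: Neg_Delta2 h g eq comps)
    qed (simp_all add: Neg_Delta2 h g arrs)
    then have "Q.cls (h \<cdot>\<^bsub>Delta2 C\<^esub> f) = Q.cls g"
      using h(2) hf g Q.cls_eq_iff[of "h \<cdot>\<^bsub>Delta2 C\<^esub> f" g] by (simp del: Delta2_simps(7))
    moreover have "h \<in> Hom (Delta2 C) (Dom (Delta2 C) g) (Dom (Delta2 C) f)"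
      using h by (simp add: Hom_iff)
    ultimately show "\<exists>u\<in>Hom (Delta2 C) (Dom (Delta2 C) g) (Dom (Delta2 C) f).
        Q.cls (u \<cdot>\<^bsub>Delta2 C\<^esub> f) = Q.cls g"
      by blast
  qed
  then show ?thesis
    by (auto simp: Adel_def adel_class_def)
qed

end


section \<open>Duality\<close>

lemma op_cat_simps [simp]:
  "Ob (op_cat C) = Ob C" "Arr (op_cat C) = Arr C" "Dom (op_cat C) = Cod C" "Cod (op_cat C) = Dom C"
  "Ident (op_cat C) = Ident C" "f \<cdot>\<^bsub>op_cat C\<^esub> g = g \<cdot>\<^bsub>C\<^esub> f"
  "f \<boxplus>\<^bsub>op_cat C\<^esub> g = f \<boxplus>\<^bsub>C\<^esub> g" "ZeroArr (op_cat C) X Y = ZeroArr C Y X"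
  "ZeroOb (op_cat C) = ZeroOb C"
  by (simp_all add: op_cat_def)

lemma op_cat_op_cat [simp]: "op_cat (op_cat C) = C"
  by (simp add: op_cat_def)

lemma Hom_op_cat [simp]: "Hom (op_cat C) X Y = Hom C Y X"
  by (auto simp: Hom_def)

lemma category_op_cat: "category C \<Longrightarrow> category (op_cat C)"
  unfolding category_def by simp metis

lemma biproduct_op_cat: "biproduct (op_cat C) X Y S p q i j \<longleftrightarrow> biproduct C X Y S i j p q"
  by (auto simp: biproduct_def)

lemma kernel_arrow_op_cat: "kernel_arrow (op_cat C) f k \<longleftrightarrow> cokernel_arrow C f k"
  by (simp add: kernel_arrow_def cokernel_arrow_def)

lemma mono_arrow_op_cat: "mono_arrow (op_cat C) f \<longleftrightarrow> epi_arrow C f"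
  by (simp add: mono_arrow_def epi_arrow_def)

lemma preadditive_op_cat:
  fixes C :: "('o, 'm) addcat"
  assumes "preadditive_category C"
  shows "preadditive_category (op_cat C)"
proof -
  interpret preadditive_category C
    by (rule assms)
  show ?thesis
  proof (rule preadditive_categoryI)
    show "category (op_cat C)"
      by (rule category_op_cat) (rule category_axioms)
    show "\<exists>g\<in>Hom (op_cat C) X Y. g \<boxplus>\<^bsub>op_cat C\<^esub> f = ZeroArr (op_cat C) X Y"
      if "f \<in> Hom (op_cat C) X Y" for X Y f
      using that by (intro bexI[of _ "Neg C f"]) (auto simp: Hom_iff[where C = C])
  qed (auto simp: Hom_iff[where C = C] Add_assoc Comp_Add_distrib intro: Add_commute)
qed

lemma additive_op_cat:
  fixes C :: "('o, 'm) addcat"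
  assumes "additive_category C"
  shows "additive_category (op_cat C)"
proof -
  interpret additive_category C
    by (rule assms)
  show ?thesis
    unfolding additive_category_def additive_category_axioms_def
  proof (intro conjI allI impI)
    show "preadditive_category (op_cat C)"
      by (rule preadditive_op_cat) (rule preadditive_category_axioms)
    show "zero_object (op_cat C) (ZeroOb (op_cat C))"
      using ZeroOb_zero by (simp add: zero_object_def)
    show "\<exists>S i j p q. biproduct (op_cat C) X Y S i j p q"
      if *: "X \<in> Ob (op_cat C)" "Y \<in> Ob (op_cat C)" for X Y
    proof -
      obtain S i j p q where "biproduct C X Y S i j p q"
        using biproducts[of X Y] * by auto
      then show ?thesis
        unfolding biproduct_op_cat by blast
    qed
  qed
qed

text \<open>The opposite category has the same sums and the same zero arrows, and these determine
  negatives.\<close>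

lemma Neg_op_cat:
  fixes C :: "('o, 'm) addcat"
  assumes "preadditive_category C" and "f \<in> Arr C"
  shows "Neg (op_cat C) f = Neg C f"
proof -
  interpret preadditive_category C
    by (rule assms)
  interpret op: preadditive_category "op_cat C"
    by (rule preadditive_op_cat) (rule assms)
  show ?thesis
    using assms(2) by (intro op.Neg_unique[symmetric]) simp_all
qed

lemma cat_functor_op_cat:
  fixes A :: "('o, 'm) addcat" and B :: "('p, 'n) addcat"
  assumes "cat_functor A B F"
  shows "cat_functor (op_cat A) (op_cat B) F"
  using assms unfolding cat_functor_def cat_functor_axioms_def
  by (simp add: category_op_cat) blast

lemma additive_functor_op_cat:
  fixes A :: "('o, 'm) addcat" and B :: "('p, 'n) addcat"
  assumes "additive_functor A B F"
  shows "additive_functor (op_cat A) (op_cat B) F"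
  using assms unfolding additive_functor_def additive_functor_axioms_def
  by (auto simp: additive_op_cat cat_functor_op_cat)

section \<open>Functors on arrows and transport along isomorphisms of categories\<close>

context cat_functor
begin

lemma arr_map_simps [simp]:
  assumes "f \<in> Arr A"
  shows "arr_map F f \<in> Arr B" and "Dom B (arr_map F f) = obj_map F (Dom A f)"
    and "Cod B (arr_map F f) = obj_map F (Cod A f)"
  using arr_map_Hom[OF arr_in_Hom[OF assms]] by (simp_all add: Hom_iff)

lemma arr_map_Comp' [simp]:
  assumes "f \<in> Arr A" and "g \<in> Arr A" and "Cod A f = Dom A g"
  shows "arr_map F (f \<cdot>\<^bsub>A\<^esub> g) = arr_map F f \<cdot>\<^bsub>B\<^esub> arr_map F g"
  using assms by (intro arr_map_Comp[of f "Dom A f" "Cod A f" g "Cod A g"]) (simp_all add: Hom_iff)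

end

context additive_functor
begin

lemma arr_map_Add' [simp]:
  assumes "f \<in> Arr A" and "g \<in> Arr A" and "Dom A f = Dom A g" and "Cod A f = Cod A g"
  shows "arr_map F (f \<boxplus>\<^bsub>A\<^esub> g) = arr_map F f \<boxplus>\<^bsub>B\<^esub> arr_map F g"
  using assms by (intro arr_map_Add[of f "Dom A f" "Cod A f" g]) (simp_all add: Hom_iff)

text \<open>The image of a zero arrow is equal to its own double, which in a group leaves only
  zero.\<close>

lemma arr_map_Zero [simp]:
  assumes "X \<in> Ob A" and "Y \<in> Ob A"
  shows "arr_map F (ZeroArr A X Y) = ZeroArr B (obj_map F X) (obj_map F Y)"
proof -
  let ?z = "ZeroArr A X Y"
  have "arr_map F ?z \<boxplus>\<^bsub>B\<^esub> arr_map F ?z = arr_map F ?z"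
    using assms arr_map_Add'[of ?z ?z] by simp
  also have "\<dots> = arr_map F ?z \<boxplus>\<^bsub>B\<^esub> ZeroArr B (obj_map F X) (obj_map F Y)"
    using assms by (subst B.Add_Zero) simp_all
  finally show ?thesis
    using assms by (subst (asm) B.Add_left_cancel) (simp_all add: obj_map_Ob)
qed

lemma arr_map_Neg [simp]:
  assumes "f \<in> Arr A"
  shows "arr_map F (Neg A f) = Neg B (arr_map F f)"
  using assms arr_map_Add'[of f "Neg A f"] by (intro B.Neg_unique) simp_all

end

text \<open>A test arrow is carried to \<open>A\<close> by \<open>G\<close>, factored there, and the
  factor is carried back by \<open>F\<close>. The intended instances are \<open>Adel_dual\<close>
  and its inverse.\<close>

lemma kernel_arrow_iso_functor:
  assumes "additive_functor A B F" and "additive_functor B A G"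
    and GF: "\<And>f. f \<in> Arr A \<Longrightarrow> arr_map G (arr_map F f) = f"
      "\<And>X. X \<in> Ob A \<Longrightarrow> obj_map G (obj_map F X) = X"
    and FG: "\<And>f. f \<in> Arr B \<Longrightarrow> arr_map F (arr_map G f) = f"
      "\<And>X. X \<in> Ob B \<Longrightarrow> obj_map F (obj_map G X) = X"
    and ker: "kernel_arrow A f k"
  shows "kernel_arrow B (arr_map F f) (arr_map F k)"
proof -
  interpret F: additive_functor A B F
    by (rule assms)
  interpret G: additive_functor B A G
    by (rule assms)
  have f: "f \<in> Arr A" and k: "k \<in> Arr A" "Cod A k = Dom A f"
    and kf: "k \<cdot>\<^bsub>A\<^esub> f = ZeroArr A (Dom A k) (Cod A f)"
    and univ: "\<And>T t. t \<in> Hom A T (Dom A f) \<Longrightarrow> t \<cdot>\<^bsub>A\<^esub> f = ZeroArr A T (Cod A f) \<Longrightarrow>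
        \<exists>!u. u \<in> Hom A T (Dom A k) \<and> u \<cdot>\<^bsub>A\<^esub> k = t"
    using ker unfolding kernel_arrow_def by auto
  show ?thesis
    unfolding kernel_arrow_def
  proof (intro conjI allI ballI impI)
    show "arr_map F k \<cdot>\<^bsub>B\<^esub> arr_map F f = ZeroArr B (Dom B (arr_map F k)) (Cod B (arr_map F f))"
      using f k kf F.arr_map_Comp'[of k f] by simp
    fix T t
    assume t: "t \<in> Hom B T (Dom B (arr_map F f))"
      and zero: "t \<cdot>\<^bsub>B\<^esub> arr_map F f = ZeroArr B T (Cod B (arr_map F f))"
    have t': "t \<in> Arr B" "Dom B t = T" "Cod B t = obj_map F (Dom A f)" "T \<in> Ob B"
      using t f F.B.Arr_Ob(1)[of t] by (auto simp: Hom_iff)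
    have "arr_map G t \<cdot>\<^bsub>A\<^esub> f = arr_map G (t \<cdot>\<^bsub>B\<^esub> arr_map F f)"
      using t' f GF by simp
    then have "arr_map G t \<cdot>\<^bsub>A\<^esub> f = ZeroArr A (obj_map G T) (Cod A f)"
      unfolding zero using t' f GF by (simp add: F.obj_map_Ob)
    moreover have "arr_map G t \<in> Hom A (obj_map G T) (Dom A f)"
      using t' f GF by (simp add: Hom_iff)
    ultimately have ex1: "\<exists>!u. u \<in> Hom A (obj_map G T) (Dom A k) \<and> u \<cdot>\<^bsub>A\<^esub> k = arr_map G t"
      by (rule univ[rotated])
    then obtain u where u: "u \<in> Hom A (obj_map G T) (Dom A k)" "u \<cdot>\<^bsub>A\<^esub> k = arr_map G t"
      by blast
    show "\<exists>!v. v \<in> Hom B T (Dom B (arr_map F k)) \<and> v \<cdot>\<^bsub>B\<^esub> arr_map F k = t"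
    proof (rule ex1I)
      have "arr_map F u \<cdot>\<^bsub>B\<^esub> arr_map F k = arr_map F (arr_map G t)"
        using u k by (simp add: Hom_iff flip: F.arr_map_Comp')
      then show "arr_map F u \<in> Hom B T (Dom B (arr_map F k)) \<and> arr_map F u \<cdot>\<^bsub>B\<^esub> arr_map F k = t"
        using u k t' FG by (simp add: Hom_iff)
      fix v
      assume v: "v \<in> Hom B T (Dom B (arr_map F k)) \<and> v \<cdot>\<^bsub>B\<^esub> arr_map F k = t"
      then have "arr_map G v \<in> Hom A (obj_map G T) (Dom A k) \<and> arr_map G v \<cdot>\<^bsub>A\<^esub> k = arr_map G t"
        using k GF G.arr_map_Comp'[of v "arr_map F k"] by (simp add: Hom_iff)
      then have "arr_map G v = u"
        using ex1 u by blast
      then show "v = arr_map F u"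
        using v FG by (auto simp: Hom_iff)
    qed
  qed (use f k in simp_all)
qed

lemma mono_arrow_iso_functor:
  assumes "additive_functor A B F" and "additive_functor B A G"
    and GF: "\<And>f. f \<in> Arr A \<Longrightarrow> arr_map G (arr_map F f) = f"
      "\<And>X. X \<in> Ob A \<Longrightarrow> obj_map G (obj_map F X) = X"
    and FG: "\<And>f. f \<in> Arr B \<Longrightarrow> arr_map F (arr_map G f) = f"
    and mono: "mono_arrow A f"
  shows "mono_arrow B (arr_map F f)"
proof -
  interpret F: additive_functor A B F
    by (rule assms)
  interpret G: additive_functor B A G
    by (rule assms)
  have f: "f \<in> Arr A"
    using mono by (simp add: mono_arrow_def)
  show ?thesis
    unfolding mono_arrow_def
  proof (intro conjI allI ballI impI)
    fix T u v
    assume uv: "u \<in> Hom B T (Dom B (arr_map F f))" "v \<in> Hom B T (Dom B (arr_map F f))"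
      and eq: "u \<cdot>\<^bsub>B\<^esub> arr_map F f = v \<cdot>\<^bsub>B\<^esub> arr_map F f"
    have "arr_map G u \<in> Hom A (obj_map G T) (Dom A f)" "arr_map G v \<in> Hom A (obj_map G T) (Dom A f)"
      using uv f GF by (simp_all add: Hom_iff)
    moreover have "arr_map G u \<cdot>\<^bsub>A\<^esub> f = arr_map G v \<cdot>\<^bsub>A\<^esub> f"
    proof -
      have "arr_map G (w \<cdot>\<^bsub>B\<^esub> arr_map F f) = arr_map G w \<cdot>\<^bsub>A\<^esub> f"
        if "w \<in> Hom B T (Dom B (arr_map F f))" for w
        using that f GF by (simp add: Hom_iff)
      then show ?thesis
        using uv eq by metis
    qed
    ultimately have "arr_map G u = arr_map G v"
      using mono unfolding mono_arrow_def by blast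
    then have "arr_map F (arr_map G u) = arr_map F (arr_map G v)"
      by (rule arg_cong)
    then show "u = v"
      using FG uv by (simp add: Hom_iff)
  qed (use f in simp)
qed

section \<open>Reversal of diagrams and the duality functor\<close>

lemma diag_dual_diag_dual [simp]: "diag_dual (diag_dual A) = A"
  by (cases A) (simp add: diag_dual_def)

lemma dmor_dual_dmor_dual [simp]: "dmor_dual (dmor_dual f) = f"
  by (cases f) (simp add: dmor_dual_def)

lemma diag_dual_simps [simp]: "edge0 (diag_dual A) = edge1 A" "edge1 (diag_dual A) = edge0 A"
  by (simp_all add: diag_dual_def)

lemma dmor_dual_simps [simp]:
  "src (dmor_dual f) = diag_dual (tgt f)" "tgt (dmor_dual f) = diag_dual (src f)"
  "comp0 (dmor_dual f) = comp2 f" "comp1 (dmor_dual f) = comp1 f" "comp2 (dmor_dual f) = comp0 f"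
  by (simp_all add: dmor_dual_def)

lemma obj_map_Adel_dual [simp]: "obj_map (Adel_dual C) = diag_dual"
  by (simp add: Adel_dual_def)

lemma Ob_Adel [simp]: "Ob (Adel C) = diagrams C"
  by (simp add: Adel_def quotient_cat_def)

lemma diag_dual_diagrams: "A \<in> diagrams C \<Longrightarrow> diag_dual A \<in> diagrams (op_cat C)"
  by (simp add: diagrams_iff)

lemma dmor_dual_diagram_morphisms:
  "f \<in> diagram_morphisms C \<Longrightarrow> dmor_dual f \<in> diagram_morphisms (op_cat C)"
  by (simp add: diagram_morphisms_iff diagrams_iff)

context base_category
begin

lemma base_op_cat: "base_category (op_cat C)"
  by (simp add: base_category_def additive_op_cat additive_category_axioms)

text \<open>The homotopy equation is symmetric under reversal: \<open>s\<close> and \<open>t\<close>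
  change places, and with them the two summands.\<close>

lemma dmor_dual_null_homotopic:
  assumes "f \<in> null_homotopic C"
  shows "dmor_dual f \<in> null_homotopic (op_cat C)"
proof -
  interpret op: base_category "op_cat C"
    by (rule base_op_cat)
  have f: "f \<in> diagram_morphisms C"
    using assms by (simp add: null_homotopic_iff)
  note fD = diagram_morphismD[OF f]
  obtain s t where "s \<in> Arr C" "Dom C s = Dom C (edge1 (src f))" "Cod C s = Dom C (edge0 (tgt f))"
    "t \<in> Arr C" "Dom C t = Cod C (edge1 (src f))" "Cod C t = Dom C (edge1 (tgt f))"
    "s \<cdot> edge0 (tgt f) \<boxplus> edge1 (src f) \<cdot> t = comp1 f"
    using assms by (auto simp: null_homotopic_iff fD)
  then show ?thesis
    using fD by (intro op.null_homotopicI[where s = t and t = s])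
      (simp_all add: dmor_dual_diagram_morphisms[OF f] Add_commute)
qed

lemma Arr_Adel: "Arr (Adel C) = adel_class C ` diagram_morphisms C"
  using Q.Arr_Q by (simp add: Adel_def adel_class_def)

lemma Adel_simps [simp]:
  "f \<in> diagram_morphisms C \<Longrightarrow> adel_class C f \<in> Arr (Adel C)"
  "f \<in> diagram_morphisms C \<Longrightarrow> Dom (Adel C) (adel_class C f) = src f"
  "f \<in> diagram_morphisms C \<Longrightarrow> Cod (Adel C) (adel_class C f) = tgt f"
  "f \<in> diagram_morphisms C \<Longrightarrow> g \<in> diagram_morphisms C \<Longrightarrow> tgt f = src g \<Longrightarrow>
     adel_class C f \<cdot>\<^bsub>Adel C\<^esub> adel_class C g = adel_class C (f \<cdot>\<^bsub>Delta2 C\<^esub> g)"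
  "f \<in> diagram_morphisms C \<Longrightarrow> g \<in> diagram_morphisms C \<Longrightarrow> src f = src g \<Longrightarrow> tgt f = tgt g \<Longrightarrow>
     adel_class C f \<boxplus>\<^bsub>Adel C\<^esub> adel_class C g = adel_class C (f \<boxplus>\<^bsub>Delta2 C\<^esub> g)"
  "Ident (Adel C) X = adel_class C (Ident (Delta2 C) X)"
  "ZeroArr (Adel C) X Y = adel_class C (ZeroArr (Delta2 C) X Y)"
  using Q.Comp_Q[of f g] Q.Add_Q[of f g]
  by (simp_all add: Adel_def adel_class_def Q.Arr_Q del: Q.Comp_Q Q.Add_Q)

lemma HomAdel_E:
  assumes "c \<in> Hom (Adel C) X Y"
  obtains f where "f \<in> diagram_morphisms C" and "src f = X" and "tgt f = Y" and "c = adel_class C f"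
  using assms by (auto simp: Hom_iff Arr_Adel)

lemma Arr_Adel_E:
  assumes "c \<in> Arr (Adel C)"
  obtains f where "f \<in> diagram_morphisms C" and "c = adel_class C f"
  using assms by (auto simp: Arr_Adel)

lemma adel_class_eq_iff:
  assumes "f \<in> diagram_morphisms C" and "g \<in> diagram_morphisms C"
  shows "adel_class C f = adel_class C g \<longleftrightarrow>
    src f = src g \<and> tgt f = tgt g \<and> f \<boxplus>\<^bsub>Delta2 C\<^esub> Neg (Delta2 C) g \<in> null_homotopic C"
  using assms Q.cls_eq_iff[of f g] unfolding adel_class_def by (simp del: Delta2_simps(7))

text \<open>Evaluates the unions by which \<open>Adel_dual\<close> and \<open>Adel_fctr\<close> act
  on classes: a congruent family is constant on a class, and the class is nonempty.\<close>

lemma UN_adel_class: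
  assumes f: "f \<in> diagram_morphisms C"
    and cong: "\<And>g. g \<in> diagram_morphisms C \<Longrightarrow> adel_class C g = adel_class C f \<Longrightarrow> h g = h f"
  shows "(\<Union>g\<in>adel_class C f. h g) = h f"
proof -
  have "h g = h f" if "g \<in> adel_class C f" for g
    using Q.in_clsD(2,5)[of g f] that cong[of g] by (simp add: adel_class_def)
  moreover have "f \<in> adel_class C f"
    using Q.cls_self[of f] f by (simp add: adel_class_def)
  ultimately show ?thesis
    by blast
qed

lemma Adel_dual_class [simp]:
  assumes f: "f \<in> diagram_morphisms C"
  shows "arr_map (Adel_dual C) (adel_class C f) = adel_class (op_cat C) (dmor_dual f)"
proof -
  interpret op: base_category "op_cat C"
    by (rule base_op_cat)
  have "adel_class (op_cat C) (dmor_dual g) = adel_class (op_cat C) (dmor_dual f)"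
    if g: "g \<in> diagram_morphisms C" and eq: "adel_class C g = adel_class C f" for g
  proof -
    have par: "src g = src f" "tgt g = tgt f" and null: "g \<boxplus>\<^bsub>Delta2 C\<^esub> Neg (Delta2 C) f \<in> null_homotopic C"
      using eq f g by (simp_all add: adel_class_eq_iff del: Delta2_simps(7))
    \<comment> \<open>Reversal acts on components and respects their sums, so it commutes with
      differences and the homotopy transfers.\<close>
    have "dmor_dual (g \<boxplus>\<^bsub>Delta2 C\<^esub> Neg (Delta2 C) f) =
        dmor_dual g \<boxplus>\<^bsub>Delta2 (op_cat C)\<^esub> Neg (Delta2 (op_cat C)) (dmor_dual f)"
      using diagram_morphismD[OF f] par dmor_dual_diagram_morphisms[OF f]
      by (intro dmor_eqI)
         (simp_all add: Neg_Delta2[OF f] op.Neg_Delta2 Neg_op_cat preadditive_category_axioms)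
    then show ?thesis
      using dmor_dual_null_homotopic[OF null] f g par
      by (simp add: op.adel_class_eq_iff dmor_dual_diagram_morphisms del: Delta2_simps(7))
  qed
  then show ?thesis
    using UN_adel_class[OF f, of "\<lambda>g. adel_class (op_cat C) (dmor_dual g)"]
    by (simp add: Adel_dual_def)
qed

lemma Adel_dual_additive: "additive_functor (op_cat (Adel C)) (Adel (op_cat C)) (Adel_dual C)"
  unfolding additive_functor_def additive_functor_axioms_def cat_functor_def cat_functor_axioms_def
proof (intro conjI allI impI)
  interpret op: base_category "op_cat C"
    by (rule base_op_cat)
  show add: "additive_category (op_cat (Adel C))" "additive_category (Adel (op_cat C))"
    using additive_Adel op.additive_Adel by (simp_all add: additive_op_cat)
  show "category (op_cat (Adel C))" "category (Adel (op_cat C))"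
    using add by (simp_all add: additive_category_def preadditive_category_def)
  show "obj_map (Adel_dual C) X \<in> Ob (Adel (op_cat C))" if "X \<in> Ob (op_cat (Adel C))" for X
    using that by (simp add: Adel_dual_def diag_dual_diagrams)
  show "arr_map (Adel_dual C) f \<in> Hom (Adel (op_cat C)) (obj_map (Adel_dual C) X) (obj_map (Adel_dual C) Y)"
    if *: "f \<in> Hom (op_cat (Adel C)) X Y" for f X Y
  proof -
    obtain f' where f': "f' \<in> diagram_morphisms C" "src f' = Y" "tgt f' = X" "f = adel_class C f'"
      using * by (auto elim: HomAdel_E)
    have "obj_map (Adel_dual C) = diag_dual"
      by (simp add: Adel_dual_def)
    then show ?thesis
      using f' by (auto simp: dmor_dual_diagram_morphisms Hom_iff)
  qed
  show "arr_map (Adel_dual C) (Ident (op_cat (Adel C)) X) = Ident (Adel (op_cat C)) (obj_map (Adel_dual C) X)"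
    if "X \<in> Ob (op_cat (Adel C))" for X
  proof -
    have "Ident (Delta2 C) X \<in> diagram_morphisms C"
      using that D.Ident_simps(1)[of X] by (simp del: Delta2_simps(5))
    then have "arr_map (Adel_dual C) (adel_class C (Ident (Delta2 C) X)) =
        adel_class (op_cat C) (dmor_dual (Ident (Delta2 C) X))"
      by (rule Adel_dual_class)
    moreover have "dmor_dual (Ident (Delta2 C) X) = Ident (Delta2 (op_cat C)) (diag_dual X)"
      using that by (intro dmor_eqI) (simp_all add: diagrams_iff)
    ultimately show ?thesis
      by (simp add: Adel_dual_def[of C])
  qed
  show "arr_map (Adel_dual C) (f \<cdot>\<^bsub>op_cat (Adel C)\<^esub> g) =
      arr_map (Adel_dual C) f \<cdot>\<^bsub>Adel (op_cat C)\<^esub> arr_map (Adel_dual C) g"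
    if *: "f \<in> Hom (op_cat (Adel C)) X Y" "g \<in> Hom (op_cat (Adel C)) Y Z" for f g X Y Z
  proof -
    obtain f' where f': "f' \<in> diagram_morphisms C" "src f' = Y" "tgt f' = X" "f = adel_class C f'"
      using * by (auto elim: HomAdel_E)
    obtain g' where g': "g' \<in> diagram_morphisms C" "src g' = Z" "tgt g' = Y" "g = adel_class C g'"
      using * by (auto elim: HomAdel_E)
    have "g' \<cdot>\<^bsub>Delta2 C\<^esub> f' \<in> diagram_morphisms C"
      using D.Comp_simps(1)[of g' f'] f' g' by (simp del: Delta2_simps(6))
    moreover have "dmor_dual (g' \<cdot>\<^bsub>Delta2 C\<^esub> f') = dmor_dual f' \<cdot>\<^bsub>Delta2 (op_cat C)\<^esub> dmor_dual g'"
      by (intro dmor_eqI) simp_all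
    ultimately show ?thesis
      using f' g' by (simp add: dmor_dual_diagram_morphisms del: Delta2_simps(6))
  qed
  show "arr_map (Adel_dual C) (f \<boxplus>\<^bsub>op_cat (Adel C)\<^esub> g) =
      arr_map (Adel_dual C) f \<boxplus>\<^bsub>Adel (op_cat C)\<^esub> arr_map (Adel_dual C) g"
    if *: "f \<in> Hom (op_cat (Adel C)) X Y" "g \<in> Hom (op_cat (Adel C)) X Y" for f g X Y
  proof -
    obtain f' where f': "f' \<in> diagram_morphisms C" "src f' = Y" "tgt f' = X" "f = adel_class C f'"
      using * by (auto elim: HomAdel_E)
    obtain g' where g': "g' \<in> diagram_morphisms C" "src g' = Y" "tgt g' = X" "g = adel_class C g'"
      using * by (auto elim: HomAdel_E)
    have "f' \<boxplus>\<^bsub>Delta2 C\<^esub> g' \<in> diagram_morphisms C"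
      using D.Add_simps(1)[of f' g'] f' g' by (simp del: Delta2_simps(7))
    moreover have "dmor_dual (f' \<boxplus>\<^bsub>Delta2 C\<^esub> g') = dmor_dual f' \<boxplus>\<^bsub>Delta2 (op_cat C)\<^esub> dmor_dual g'"
      by (intro dmor_eqI) simp_all
    ultimately show ?thesis
      using f' g' by (simp add: dmor_dual_diagram_morphisms del: Delta2_simps(7))
  qed
qed

text \<open>Reversing a triple twice restores it and \<open>op_cat\<close> is an involution, so the
  duality of \<open>op_cat C\<close> undoes that of \<open>C\<close>.\<close>

lemma Adel_dual_Adel_dual:
  assumes "c \<in> Arr (Adel C)"
  shows "arr_map (Adel_dual (op_cat C)) (arr_map (Adel_dual C) c) = c"
  using assms base_category.Adel_dual_class[OF base_op_cat dmor_dual_diagram_morphisms]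
  by (auto elim!: Arr_Adel_E)

lemma Adel_dual_op_additive: "additive_functor (Adel (op_cat C)) (op_cat (Adel C)) (Adel_dual (op_cat C))"
  using additive_functor_op_cat[OF base_category.Adel_dual_additive[OF base_op_cat]] by simp

lemmas Adel_dual_inverses =
  Adel_dual_additive Adel_dual_op_additive
  Adel_dual_Adel_dual base_category.Adel_dual_Adel_dual[OF base_op_cat, unfolded op_cat_op_cat]

text \<open>A cokernel in \<open>Adel C\<close> is a kernel in \<open>op_cat (Adel C)\<close> by
  mere unfolding; the duality and its inverse transport kernels in both directions.\<close>

lemma cokernel_arrow_iff_dual:
  assumes "c \<in> Arr (Adel C)" and "d \<in> Arr (Adel C)"
  shows "cokernel_arrow (Adel C) c d \<longleftrightarrow>
    kernel_arrow (Adel (op_cat C)) (arr_map (Adel_dual C) c) (arr_map (Adel_dual C) d)"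
proof
  assume "cokernel_arrow (Adel C) c d"
  then show "kernel_arrow (Adel (op_cat C)) (arr_map (Adel_dual C) c) (arr_map (Adel_dual C) d)"
    unfolding kernel_arrow_op_cat[symmetric]
    by (rule kernel_arrow_iso_functor[OF Adel_dual_additive Adel_dual_op_additive, rotated -1])
       (simp_all add: Adel_dual_inverses(3,4))
next
  assume "kernel_arrow (Adel (op_cat C)) (arr_map (Adel_dual C) c) (arr_map (Adel_dual C) d)"
  then have "kernel_arrow (op_cat (Adel C)) (arr_map (Adel_dual (op_cat C)) (arr_map (Adel_dual C) c))
      (arr_map (Adel_dual (op_cat C)) (arr_map (Adel_dual C) d))"
    by (rule kernel_arrow_iso_functor[OF Adel_dual_op_additive Adel_dual_additive, rotated -1])
       (simp_all add: Adel_dual_inverses(3,4))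
  then show "cokernel_arrow (Adel C) c d"
    using assms by (simp add: kernel_arrow_op_cat Adel_dual_Adel_dual)
qed

section \<open>The abelian axioms\<close>

lemma kernels_Adel: "c \<in> Arr (Adel C) \<Longrightarrow> \<exists>k. kernel_arrow (Adel C) c k"
  using kernel_data_exists kernel_data_kernel by (blast elim: Arr_Adel_E)

lemma mono_normal_Adel:
  assumes "mono_arrow (Adel C) c"
  shows "\<exists>d. kernel_arrow (Adel C) d c"
proof -
  have "c \<in> Arr (Adel C)"
    using assms by (simp add: mono_arrow_def)
  then show ?thesis
    using assms mono_is_kernel by (auto elim!: Arr_Adel_E)
qed

text \<open>Kernels are found in \<open>Adel (op_cat C)\<close>; surjectivity of the duality on
  arrows brings them back as cokernels in \<open>Adel C\<close>.\<close>

lemma Adel_dual_arr_E: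
  assumes "d \<in> Arr (Adel (op_cat C))"
  obtains e where "e \<in> Arr (Adel C)" and "d = arr_map (Adel_dual C) e"
proof -
  interpret G: additive_functor "Adel (op_cat C)" "op_cat (Adel C)" "Adel_dual (op_cat C)"
    by (rule Adel_dual_op_additive)
  show thesis
    using that[of "arr_map (Adel_dual (op_cat C)) d"] G.arr_map_simps(1)[OF assms]
      Adel_dual_inverses(4)[OF assms] by simp
qed

lemma abelian_Adel: "abelian_category (Adel C)"
  unfolding abelian_category_def abelian_category_axioms_def
proof (intro conjI allI impI)
  interpret op: base_category "op_cat C"
    by (rule base_op_cat)
  interpret dual: additive_functor "op_cat (Adel C)" "Adel (op_cat C)" "Adel_dual C"
    by (rule Adel_dual_additive)
  show "additive_category (Adel C)"
    by (rule additive_Adel)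
  show "\<exists>k. kernel_arrow (Adel C) c k" if "c \<in> Arr (Adel C)" for c
    using that by (rule kernels_Adel)
  show "\<exists>d. kernel_arrow (Adel C) d c" if "mono_arrow (Adel C) c" for c
    using that by (rule mono_normal_Adel)
  show "\<exists>d. cokernel_arrow (Adel C) c d" if c: "c \<in> Arr (Adel C)" for c
  proof -
    have "arr_map (Adel_dual C) c \<in> Arr (Adel (op_cat C))"
      using c by simp
    then obtain k where k: "kernel_arrow (Adel (op_cat C)) (arr_map (Adel_dual C) c) k"
      using op.kernels_Adel by blast
    then have "k \<in> Arr (Adel (op_cat C))"
      by (simp add: kernel_arrow_def)
    then obtain d where "d \<in> Arr (Adel C)" "k = arr_map (Adel_dual C) d"
      by (rule Adel_dual_arr_E)
    then show ?thesis
      using k c cokernel_arrow_iff_dual by blast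
  qed
  show "\<exists>d. cokernel_arrow (Adel C) d c" if epi: "epi_arrow (Adel C) c" for c
  proof -
    have c: "c \<in> Arr (Adel C)"
      using epi by (simp add: epi_arrow_def)
    have "mono_arrow (Adel (op_cat C)) (arr_map (Adel_dual C) c)"
      using epi unfolding mono_arrow_op_cat[symmetric]
      by (rule mono_arrow_iso_functor[OF Adel_dual_additive Adel_dual_op_additive, rotated -1])
         (simp_all add: Adel_dual_inverses(3,4))
    then obtain k where k: "kernel_arrow (Adel (op_cat C)) k (arr_map (Adel_dual C) c)"
      using op.mono_normal_Adel by blast
    then have "k \<in> Arr (Adel (op_cat C))"
      by (simp add: kernel_arrow_def)
    then obtain d where "d \<in> Arr (Adel C)" "k = arr_map (Adel_dual C) d"
      by (rule Adel_dual_arr_E)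
    then show ?thesis
      using k c cokernel_arrow_iff_dual by blast
  qed
qed

end


section \<open>The induced functor\<close>

lemma kernel_arrowD:
  assumes "kernel_arrow C f k"
  shows "f \<in> Arr C" and "k \<in> Arr C" and "Cod C k = Dom C f"
    and "k \<cdot>\<^bsub>C\<^esub> f = ZeroArr C (Dom C k) (Cod C f)"
    and "\<And>T t. t \<in> Hom C T (Dom C f) \<Longrightarrow> t \<cdot>\<^bsub>C\<^esub> f = ZeroArr C T (Cod C f) \<Longrightarrow>
           \<exists>!u. u \<in> Hom C T (Dom C k) \<and> u \<cdot>\<^bsub>C\<^esub> k = t"
  using assms unfolding kernel_arrow_def by auto

text \<open>Each kernel factors through the other, and a round trip solves the same factorisation
  problem as the identity.\<close>

lemma (in preadditive_category) kernel_arrow_unique: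
  assumes k: "kernel_arrow C f k" and l: "kernel_arrow C f l"
  obtains v w where "v \<in> Hom C (Dom C k) (Dom C l)" "w \<in> Hom C (Dom C l) (Dom C k)"
    "v \<cdot> l = k" "v \<cdot> w = Ident C (Dom C k)" "w \<cdot> v = Ident C (Dom C l)"
proof -
  note kD = kernel_arrowD[OF k] and lD = kernel_arrowD[OF l]
  have kH: "k \<in> Hom C (Dom C k) (Dom C f)" and lH: "l \<in> Hom C (Dom C l) (Dom C f)"
    using kD(2,3) lD(2,3) by (simp_all add: Hom_iff)
  obtain v where v: "v \<in> Hom C (Dom C k) (Dom C l)" "v \<cdot> l = k"
    using lD(5)[OF kH kD(4)] by blast
  obtain w where w: "w \<in> Hom C (Dom C l) (Dom C k)" "w \<cdot> k = l"
    using kD(5)[OF lH lD(4)] by blast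
  have "(v \<cdot> w) \<cdot> k = v \<cdot> (w \<cdot> k)" "(w \<cdot> v) \<cdot> l = w \<cdot> (v \<cdot> l)"
    using v(1) w(1) kD(2) lD(2) by (simp_all add: Comp_Comp Hom_iff)
  then have "(v \<cdot> w) \<cdot> k = k" "(w \<cdot> v) \<cdot> l = l"
    using v(2) w(2) by simp_all
  moreover have "Ident C (Dom C k) \<cdot> k = k" "Ident C (Dom C l) \<cdot> l = l"
    using kD(2) lD(2) by simp_all
  moreover have "v \<cdot> w \<in> Hom C (Dom C k) (Dom C k)" "w \<cdot> v \<in> Hom C (Dom C l) (Dom C l)"
    "Ident C (Dom C k) \<in> Hom C (Dom C k) (Dom C k)" "Ident C (Dom C l) \<in> Hom C (Dom C l) (Dom C l)"
    using v(1) w(1) kD(2) lD(2) by (simp_all add: Hom_iff)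
  ultimately have "v \<cdot> w = Ident C (Dom C k)" "w \<cdot> v = Ident C (Dom C l)"
    using kD(5)[OF kH kD(4)] lD(5)[OF lH lD(4)] by blast+
  then show thesis
    using that v w by blast
qed

lemma (in preadditive_category) kernel_arrow_iso_Comp:
  assumes k: "kernel_arrow C f k" and v: "v \<in> Hom C X (Dom C k)" and w: "w \<in> Hom C (Dom C k) X"
    and vw: "v \<cdot> w = Ident C X" and wv: "w \<cdot> v = Ident C (Dom C k)"
  shows "kernel_arrow C f (v \<cdot> k)"
proof -
  note kD = kernel_arrowD[OF k]
  have arrs: "v \<in> Arr C" "Dom C v = X" "Cod C v = Dom C k" "w \<in> Arr C" "Dom C w = Dom C k" "Cod C w = X"
    "X \<in> Ob C"
    using v w Arr_Ob(1)[of v] by (auto simp: Hom_iff)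
  show ?thesis
    unfolding kernel_arrow_def
  proof (intro conjI allI ballI impI)
    show "(v \<cdot> k) \<cdot> f = ZeroArr C (Dom C (v \<cdot> k)) (Cod C f)"
      using arrs kD(1-4) by (simp add: Comp_Comp)
    fix T t
    assume t: "t \<in> Hom C T (Dom C f)" "t \<cdot> f = ZeroArr C T (Cod C f)"
    note ex1 = kD(5)[OF t]
    obtain u where u: "u \<in> Hom C T (Dom C k)" "u \<cdot> k = t"
      using ex1 by blast
    show "\<exists>!u. u \<in> Hom C T (Dom C (v \<cdot> k)) \<and> u \<cdot> (v \<cdot> k) = t"
    proof (rule ex1I)
      have "(u \<cdot> w) \<cdot> (v \<cdot> k) = u \<cdot> ((w \<cdot> v) \<cdot> k)"
        using u(1) arrs kD(2) by (simp add: Comp_Comp Hom_iff)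
      then show "u \<cdot> w \<in> Hom C T (Dom C (v \<cdot> k)) \<and> (u \<cdot> w) \<cdot> (v \<cdot> k) = t"
        using u arrs kD(2) by (simp add: wv Hom_iff)
      fix u'
      assume u': "u' \<in> Hom C T (Dom C (v \<cdot> k)) \<and> u' \<cdot> (v \<cdot> k) = t"
      then have "u' \<cdot> v \<in> Hom C T (Dom C k) \<and> (u' \<cdot> v) \<cdot> k = t"
        using arrs kD(2) by (simp add: Comp_Comp Hom_iff)
      then have "u' \<cdot> v = u"
        using ex1 u by blast
      moreover have "(u' \<cdot> v) \<cdot> w = u'"
        using u' arrs kD(2) by (simp add: Comp_Comp Hom_iff vw)
      ultimately show "u' = u \<cdot> w"
        by simp
    qed
  qed (use arrs kD(1-3) in simp_all)
qed

text \<open>One kernel per arrow with a known image suffices: \<open>l\<close> is \<open>v\<close>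
  followed by \<open>k\<close> with \<open>v\<close> invertible, and \<open>F\<close> keeps
  \<open>v\<close> invertible.\<close>

lemma (in additive_functor) preserves_kernel_transfer:
  assumes k: "kernel_arrow A f k" and Fk: "kernel_arrow B (arr_map F f) (arr_map F k)"
    and l: "kernel_arrow A f l"
  shows "kernel_arrow B (arr_map F f) (arr_map F l)"
proof -
  obtain v w where v: "v \<in> Hom A (Dom A l) (Dom A k)" and w: "w \<in> Hom A (Dom A k) (Dom A l)"
    and eqs: "v \<cdot>\<^bsub>A\<^esub> k = l" "v \<cdot>\<^bsub>A\<^esub> w = Ident A (Dom A l)" "w \<cdot>\<^bsub>A\<^esub> v = Ident A (Dom A k)"
    using l k by (rule A.kernel_arrow_unique)
  note kD = kernel_arrowD(2)[OF k] and lD = kernel_arrowD(2)[OF l]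
  have "arr_map F v \<cdot>\<^bsub>B\<^esub> arr_map F w = Ident B (obj_map F (Dom A l))"
    "arr_map F w \<cdot>\<^bsub>B\<^esub> arr_map F v = Ident B (obj_map F (Dom A k))"
    using v w kD lD arr_map_Comp[OF v w] arr_map_Comp[OF w v]
    by (simp_all add: eqs arr_map_Ident)
  moreover have "arr_map F v \<in> Hom B (obj_map F (Dom A l)) (Dom B (arr_map F k))"
    "arr_map F w \<in> Hom B (Dom B (arr_map F k)) (obj_map F (Dom A l))"
    using v w kD by (simp_all add: Hom_iff)
  ultimately have "kernel_arrow B (arr_map F f) (arr_map F v \<cdot>\<^bsub>B\<^esub> arr_map F k)"
    using kD by (intro B.kernel_arrow_iso_Comp[OF Fk]) simp_all
  moreover have "arr_map F l = arr_map F v \<cdot>\<^bsub>B\<^esub> arr_map F k"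
    unfolding eqs(1)[symmetric] using v kD by (simp add: Hom_iff)
  ultimately show ?thesis
    by simp
qed

section \<open>The induced functor on diagrams and on classes\<close>

lemma diag_image_simps [simp]:
  "edge0 (diag_image F X) = arr_map F (edge0 X)" "edge1 (diag_image F X) = arr_map F (edge1 X)"
  by (simp_all add: diag_image_def)

lemma dmor_image_simps [simp]:
  "src (dmor_image F f) = diag_image F (src f)" "tgt (dmor_image F f) = diag_image F (tgt f)"
  "comp0 (dmor_image F f) = arr_map F (comp0 f)" "comp1 (dmor_image F f) = arr_map F (comp1 f)"
  "comp2 (dmor_image F f) = arr_map F (comp2 f)"
  by (simp_all add: dmor_image_def)

lemma obj_map_Adel_fctr [simp]: "obj_map (Adel_fctr B F) = diag_image F"
  by (simp add: Adel_fctr_def)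

lemma diag_dual_image: "diag_dual (diag_image F X) = diag_image F (diag_dual X)"
  by (simp add: diag_dual_def diag_image_def)

lemma dmor_dual_image: "dmor_dual (dmor_image F f) = dmor_image F (dmor_dual f)"
  by (simp add: dmor_dual_def dmor_image_def diag_dual_image)

locale base_functor = A: base_category A + B: base_category B + additive_functor A B F
  for A :: "('o, 'm) addcat" and B :: "('p, 'n) addcat" and F
begin

lemma diag_image_diagrams: "X \<in> diagrams A \<Longrightarrow> diag_image F X \<in> diagrams B"
  by (simp add: diagrams_iff)

lemma dmor_image_diagram_morphisms:
  assumes "f \<in> diagram_morphisms A"
  shows "dmor_image F f \<in> diagram_morphisms B"
proof -
  note fD = diagram_morphismD[OF assms]
  have "arr_map F (edge0 (src f) \<cdot>\<^bsub>A\<^esub> comp1 f) = arr_map F (comp0 f \<cdot>\<^bsub>A\<^esub> edge0 (tgt f))"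
    "arr_map F (edge1 (src f) \<cdot>\<^bsub>A\<^esub> comp2 f) = arr_map F (comp1 f \<cdot>\<^bsub>A\<^esub> edge1 (tgt f))"
    using assms by (simp_all only: diagram_morphisms_iff)
  then show ?thesis
    using fD by (simp add: diagram_morphisms_iff diagrams_iff)
qed

lemma dmor_image_Comp:
  assumes "f \<in> diagram_morphisms A" and "g \<in> diagram_morphisms A" and "tgt f = src g"
  shows "dmor_image F (f \<cdot>\<^bsub>Delta2 A\<^esub> g) = dmor_image F f \<cdot>\<^bsub>Delta2 B\<^esub> dmor_image F g"
  using diagram_morphismD[OF assms(1)] diagram_morphismD[OF assms(2)] assms(3)
  by (intro dmor_eqI) simp_all

lemma dmor_image_Add:
  assumes "f \<in> diagram_morphisms A" and "g \<in> diagram_morphisms A" and "src f = src g" and "tgt f = tgt g"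
  shows "dmor_image F (f \<boxplus>\<^bsub>Delta2 A\<^esub> g) = dmor_image F f \<boxplus>\<^bsub>Delta2 B\<^esub> dmor_image F g"
  using diagram_morphismD[OF assms(1)] diagram_morphismD[OF assms(2)] assms(3,4)
  by (intro dmor_eqI) simp_all

lemma dmor_image_Neg:
  assumes "f \<in> diagram_morphisms A"
  shows "dmor_image F (Neg (Delta2 A) f) = Neg (Delta2 B) (dmor_image F f)"
  using diagram_morphismD[OF assms] dmor_image_diagram_morphisms[OF assms]
  by (intro dmor_eqI) (simp_all add: A.Neg_Delta2[OF assms] B.Neg_Delta2)

lemma dmor_image_Ident:
  "X \<in> diagrams A \<Longrightarrow> dmor_image F (Ident (Delta2 A) X) = Ident (Delta2 B) (diag_image F X)"
  by (intro dmor_eqI) (simp_all add: diagrams_iff arr_map_Ident)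

text \<open>An additive functor maps the homotopy equation to one of the same form; this makes the
  action on classes well defined.\<close>

lemma dmor_image_null_homotopic:
  assumes "f \<in> null_homotopic A"
  shows "dmor_image F f \<in> null_homotopic B"
proof -
  have f: "f \<in> diagram_morphisms A"
    using assms by (simp add: null_homotopic_iff)
  note fD = diagram_morphismD[OF f]
  obtain s t where st: "s \<in> Arr A" "Dom A s = Dom A (edge1 (src f))" "Cod A s = Dom A (edge0 (tgt f))"
    "t \<in> Arr A" "Dom A t = Cod A (edge1 (src f))" "Cod A t = Dom A (edge1 (tgt f))"
    and eq: "s \<cdot>\<^bsub>A\<^esub> edge0 (tgt f) \<boxplus>\<^bsub>A\<^esub> edge1 (src f) \<cdot>\<^bsub>A\<^esub> t = comp1 f"
    using assms by (auto simp: null_homotopic_iff fD)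
  show ?thesis
    by (rule B.null_homotopicI[where s = "arr_map F s" and t = "arr_map F t"])
      (use st fD in \<open>simp_all add: dmor_image_diagram_morphisms[OF f] eq[symmetric]\<close>)
qed

lemma Adel_fctr_class [simp]:
  assumes f: "f \<in> diagram_morphisms A"
  shows "arr_map (Adel_fctr B F) (adel_class A f) = adel_class B (dmor_image F f)"
proof -
  have "adel_class B (dmor_image F g) = adel_class B (dmor_image F f)"
    if g: "g \<in> diagram_morphisms A" and eq: "adel_class A g = adel_class A f" for g
  proof -
    have par: "src g = src f" "tgt g = tgt f" and null: "g \<boxplus>\<^bsub>Delta2 A\<^esub> Neg (Delta2 A) f \<in> null_homotopic A"
      using eq f g by (simp_all add: A.adel_class_eq_iff del: Delta2_simps(7))
    have "Neg (Delta2 A) f \<in> diagram_morphisms A"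
      using A.D.Neg_simps(1)[of f] f by simp
    then have "dmor_image F (g \<boxplus>\<^bsub>Delta2 A\<^esub> Neg (Delta2 A) f) =
        dmor_image F g \<boxplus>\<^bsub>Delta2 B\<^esub> Neg (Delta2 B) (dmor_image F f)"
      using f g par by (subst dmor_image_Add) (simp_all add: A.Neg_Delta2 dmor_image_Neg[symmetric])
    then show ?thesis
      using dmor_image_null_homotopic[OF null] f g par
      by (simp add: B.adel_class_eq_iff dmor_image_diagram_morphisms del: Delta2_simps(7))
  qed
  then show ?thesis
    using A.UN_adel_class[OF f, of "\<lambda>g. adel_class B (dmor_image F g)"]
    by (simp add: Adel_fctr_def)
qed

lemma Adel_fctr_additive: "additive_functor (Adel A) (Adel B) (Adel_fctr B F)"
  unfolding additive_functor_def additive_functor_axioms_def cat_functor_def cat_functor_axioms_def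
proof (intro conjI allI impI)
  show add: "additive_category (Adel A)" "additive_category (Adel B)"
    by (rule A.additive_Adel B.additive_Adel)+
  show "category (Adel A)" "category (Adel B)"
    using add by (simp_all add: additive_category_def preadditive_category_def)
  show "obj_map (Adel_fctr B F) X \<in> Ob (Adel B)" if "X \<in> Ob (Adel A)" for X
    using that by (simp add: diag_image_diagrams)
  show "arr_map (Adel_fctr B F) f \<in> Hom (Adel B) (obj_map (Adel_fctr B F) X) (obj_map (Adel_fctr B F) Y)"
    if "f \<in> Hom (Adel A) X Y" for f X Y
    using that by (auto elim!: A.HomAdel_E simp: Hom_iff[where C = "Adel B"] dmor_image_diagram_morphisms)
  show "arr_map (Adel_fctr B F) (Ident (Adel A) X) = Ident (Adel B) (obj_map (Adel_fctr B F) X)"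
    if "X \<in> Ob (Adel A)" for X
  proof -
    have "X \<in> diagrams A" "Ident (Delta2 A) X \<in> diagram_morphisms A"
      using that A.D.Ident_simps(1)[of X] by (simp_all del: Delta2_simps(5))
    then show ?thesis
      by (simp add: dmor_image_Ident del: Delta2_simps(5))
  qed
  show "arr_map (Adel_fctr B F) (f \<cdot>\<^bsub>Adel A\<^esub> g) =
      arr_map (Adel_fctr B F) f \<cdot>\<^bsub>Adel B\<^esub> arr_map (Adel_fctr B F) g"
    if *: "f \<in> Hom (Adel A) X Y" "g \<in> Hom (Adel A) Y Z" for f g X Y Z
  proof -
    obtain f' where f': "f' \<in> diagram_morphisms A" "src f' = X" "tgt f' = Y" "f = adel_class A f'"
      using * by (auto elim: A.HomAdel_E)
    obtain g' where g': "g' \<in> diagram_morphisms A" "src g' = Y" "tgt g' = Z" "g = adel_class A g'"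
      using * by (auto elim: A.HomAdel_E)
    have "f' \<cdot>\<^bsub>Delta2 A\<^esub> g' \<in> diagram_morphisms A"
      using A.D.Comp_simps(1)[of f' g'] f' g' by (simp del: Delta2_simps(6))
    then show ?thesis
      using f' g' by (simp add: dmor_image_diagram_morphisms dmor_image_Comp del: Delta2_simps(6))
  qed
  show "arr_map (Adel_fctr B F) (f \<boxplus>\<^bsub>Adel A\<^esub> g) =
      arr_map (Adel_fctr B F) f \<boxplus>\<^bsub>Adel B\<^esub> arr_map (Adel_fctr B F) g"
    if *: "f \<in> Hom (Adel A) X Y" "g \<in> Hom (Adel A) X Y" for f g X Y
  proof -
    obtain f' where f': "f' \<in> diagram_morphisms A" "src f' = X" "tgt f' = Y" "f = adel_class A f'"
      using * by (auto elim: A.HomAdel_E)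
    obtain g' where g': "g' \<in> diagram_morphisms A" "src g' = X" "tgt g' = Y" "g = adel_class A g'"
      using * by (auto elim: A.HomAdel_E)
    have "f' \<boxplus>\<^bsub>Delta2 A\<^esub> g' \<in> diagram_morphisms A"
      using A.D.Add_simps(1)[of f' g'] f' g' by (simp del: Delta2_simps(7))
    then show ?thesis
      using f' g' by (simp add: dmor_image_diagram_morphisms dmor_image_Add del: Delta2_simps(7))
  qed
qed

text \<open>Biproducts are defined by equations between composites, sums, identities and zero
  arrows, all of which an additive functor respects.\<close>

lemma biproduct_image:
  assumes "biproduct A X Y S i j p q"
  shows "biproduct B (obj_map F X) (obj_map F Y) (obj_map F S)
    (arr_map F i) (arr_map F j) (arr_map F p) (arr_map F q)"
proof -
  note bp = A.biproduct_simps[OF assms]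
  have "arr_map F (i \<cdot>\<^bsub>A\<^esub> p) = arr_map F (Ident A X)" "arr_map F (j \<cdot>\<^bsub>A\<^esub> q) = arr_map F (Ident A Y)"
    "arr_map F (i \<cdot>\<^bsub>A\<^esub> q) = arr_map F (ZeroArr A X Y)" "arr_map F (j \<cdot>\<^bsub>A\<^esub> p) = arr_map F (ZeroArr A Y X)"
    "arr_map F (p \<cdot>\<^bsub>A\<^esub> i \<boxplus>\<^bsub>A\<^esub> q \<cdot>\<^bsub>A\<^esub> j) = arr_map F (Ident A S)"
    by (simp_all only: bp(16-20))
  then show ?thesis
    using bp(1-15) by (simp add: biproduct_def Hom_iff obj_map_Ob arr_map_Ident)
qed

text \<open>The images under \<open>F\<close> of the biproducts behind \<open>k\<close> are the
  witnesses for \<open>dmor_image F k\<close>; \<open>kernel_data\<close> admits arbitrary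
  biproducts for this purpose.\<close>

lemma kernel_data_image:
  assumes data: "kernel_data A f k"
  shows "kernel_data B (dmor_image F f) (dmor_image F k)"
proof -
  have f: "f \<in> diagram_morphisms A"
    using data by (rule A.kernel_data_source)
  note fD = diagram_morphismD[OF f]
  obtain S0 i0 j0 p0 q0 S1 i1 j1 p1 q1 S2 i2 j2 p2 q2 where bp:
    "biproduct A (Dom A (edge0 (src f))) (Dom A (edge0 (tgt f))) S0 i0 j0 p0 q0"
    "biproduct A (Dom A (edge1 (src f))) (Dom A (edge0 (tgt f))) S1 i1 j1 p1 q1"
    "biproduct A (Cod A (edge1 (src f))) (Dom A (edge1 (tgt f))) S2 i2 j2 p2 q2"
    and k: "edge0 (src k) = p0 \<cdot>\<^bsub>A\<^esub> (edge0 (src f) \<cdot>\<^bsub>A\<^esub> i1) \<boxplus>\<^bsub>A\<^esub> q0 \<cdot>\<^bsub>A\<^esub> j1"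
    "edge1 (src k) = p1 \<cdot>\<^bsub>A\<^esub> (edge1 (src f) \<cdot>\<^bsub>A\<^esub> i2) \<boxplus>\<^bsub>A\<^esub>
       (p1 \<cdot>\<^bsub>A\<^esub> (comp1 f \<cdot>\<^bsub>A\<^esub> j2) \<boxplus>\<^bsub>A\<^esub> q1 \<cdot>\<^bsub>A\<^esub> (edge0 (tgt f) \<cdot>\<^bsub>A\<^esub> j2))"
    "tgt k = src f" "comp0 k = p0" "comp1 k = p1" "comp2 k = p2"
    using data by (rule A.kernel_dataE)
  note bps = A.biproduct_simps[OF bp(1)] A.biproduct_simps[OF bp(2)] A.biproduct_simps[OF bp(3)]
  have "dmor_image F k = DMor
      (Diag
        (arr_map F p0 \<cdot>\<^bsub>B\<^esub> (arr_map F (edge0 (src f)) \<cdot>\<^bsub>B\<^esub> arr_map F i1) \<boxplus>\<^bsub>B\<^esub> arr_map F q0 \<cdot>\<^bsub>B\<^esub> arr_map F j1)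
        (arr_map F p1 \<cdot>\<^bsub>B\<^esub> (arr_map F (edge1 (src f)) \<cdot>\<^bsub>B\<^esub> arr_map F i2) \<boxplus>\<^bsub>B\<^esub>
          (arr_map F p1 \<cdot>\<^bsub>B\<^esub> (arr_map F (comp1 f) \<cdot>\<^bsub>B\<^esub> arr_map F j2) \<boxplus>\<^bsub>B\<^esub>
           arr_map F q1 \<cdot>\<^bsub>B\<^esub> (arr_map F (edge0 (tgt f)) \<cdot>\<^bsub>B\<^esub> arr_map F j2))))
      (diag_image F (src f)) (arr_map F p0) (arr_map F p1) (arr_map F p2)"
    using fD bps by (intro dmor_eqI) (simp_all add: k diag_image_def)
  then show ?thesis
    using bp[THEN biproduct_image] dmor_image_diagram_morphisms[OF f] fD
    unfolding kernel_data_def by (simp, blast)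
qed

lemma Adel_fctr_preserves_kernels:
  assumes "kernel_arrow (Adel A) c k"
  shows "kernel_arrow (Adel B) (arr_map (Adel_fctr B F) c) (arr_map (Adel_fctr B F) k)"
proof -
  interpret G: additive_functor "Adel A" "Adel B" "Adel_fctr B F"
    by (rule Adel_fctr_additive)
  have "c \<in> Arr (Adel A)"
    using assms by (rule kernel_arrowD)
  then obtain f where f: "f \<in> diagram_morphisms A" "c = adel_class A f"
    by (rule A.Arr_Adel_E)
  \<comment> \<open>The formula supplies one kernel whose image is known; the given \<open>k\<close>
    is reached from it by \<open>preserves_kernel_transfer\<close>.\<close>
  obtain l where l: "kernel_data A f l"
    using A.kernel_data_exists[OF f(1)] by blast
  have Fl: "kernel_arrow (Adel B) (arr_map (Adel_fctr B F) c) (arr_map (Adel_fctr B F) (adel_class A l))"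
    using B.kernel_data_kernel[OF kernel_data_image[OF l]] f A.kernel_data_arrow[OF l] by simp
  have "kernel_arrow (Adel A) c (adel_class A l)"
    using A.kernel_data_kernel[OF l] f(2) by simp
  then show ?thesis
    by (rule G.preserves_kernel_transfer[OF _ Fl assms])
qed

section \<open>Cokernels and the opposite functor\<close>

lemma op_base_functor: "base_functor (op_cat A) (op_cat B) F"
  by (simp add: base_functor_def A.base_op_cat B.base_op_cat additive_functor_op_cat additive_functor_axioms)

text \<open>Applying \<open>F\<close> to the entries of a triple commutes with reversing the triple.
  Preservation of cokernels and the equation for the opposite functor both rest on this
  square.\<close>

lemma Adel_dual_fctr:
  assumes "c \<in> Arr (Adel A)"
  shows "arr_map (Adel_dual B) (arr_map (Adel_fctr B F) c) =
    arr_map (Adel_fctr (op_cat B) F) (arr_map (Adel_dual A) c)"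
proof -
  interpret op: base_functor "op_cat A" "op_cat B" F
    by (rule op_base_functor)
  show ?thesis
    using assms
    by (auto elim!: A.Arr_Adel_E
        simp: dmor_image_diagram_morphisms dmor_dual_diagram_morphisms dmor_dual_image)
qed

text \<open>Through \<open>Adel_dual_fctr\<close> the claim becomes preservation of kernels for
  \<open>F\<close> regarded as a functor between the opposite categories.\<close>

lemma Adel_fctr_preserves_cokernels:
  assumes "cokernel_arrow (Adel A) c d"
  shows "cokernel_arrow (Adel B) (arr_map (Adel_fctr B F) c) (arr_map (Adel_fctr B F) d)"
proof -
  interpret op: base_functor "op_cat A" "op_cat B" F
    by (rule op_base_functor)
  interpret G: additive_functor "Adel A" "Adel B" "Adel_fctr B F"
    by (rule Adel_fctr_additive)
  have cd: "c \<in> Arr (Adel A)" "d \<in> Arr (Adel A)"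
    using assms by (auto simp: cokernel_arrow_def)
  then have "kernel_arrow (Adel (op_cat A)) (arr_map (Adel_dual A) c) (arr_map (Adel_dual A) d)"
    using assms A.cokernel_arrow_iff_dual by blast
  then have "kernel_arrow (Adel (op_cat B)) (arr_map (Adel_fctr (op_cat B) F) (arr_map (Adel_dual A) c))
      (arr_map (Adel_fctr (op_cat B) F) (arr_map (Adel_dual A) d))"
    by (rule op.Adel_fctr_preserves_kernels)
  then show ?thesis
    using cd by (simp add: B.cokernel_arrow_iff_dual Adel_dual_fctr)
qed

lemma Adel_fctr_exact: "exact_functor (Adel A) (Adel B) (Adel_fctr B F)"
  unfolding exact_functor_def exact_functor_axioms_def
  using A.abelian_Adel B.abelian_Adel Adel_fctr_additive
    Adel_fctr_preserves_kernels Adel_fctr_preserves_cokernels by blast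

text \<open>By \<open>Adel_dual_fctr\<close>, the functor that \<open>inv_fctr\<close> is applied to
  yields \<open>Adel_dual B\<close> evaluated at the image under \<open>Adel_fctr B F\<close>.
  Injectivity of \<open>Adel_dual B\<close> on objects and on arrows is then enough for
  \<open>inv_into\<close> to return that image.\<close>

lemma Adel_fctr_op:
  "fctr_eq (op_cat (Adel A))
    (op_fctr (Adel_fctr B F))
    (comp_fctr (inv_fctr (op_cat (Adel B)) (Adel_dual B))
      (comp_fctr (Adel_fctr (op_cat B) (op_fctr F)) (Adel_dual A)))"
proof -
  interpret G: additive_functor "Adel A" "Adel B" "Adel_fctr B F"
    by (rule Adel_fctr_additive)
  have inj: "inj_on (arr_map (Adel_dual B)) (Arr (Adel B))" "inj_on diag_dual (diagrams B)"
    using inj_on_inverseI[of "Arr (Adel B)" "arr_map (Adel_dual (op_cat B))" "arr_map (Adel_dual B)"]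
      inj_on_inverseI[of "diagrams B" diag_dual diag_dual] B.Adel_dual_Adel_dual
    by simp_all
  have "inv_into (diagrams B) diag_dual (diag_image F (diag_dual X)) = diag_image F X"
    if "X \<in> diagrams A" for X
    using that inv_into_f_f[OF inj(2) diag_image_diagrams] by (simp flip: diag_dual_image)
  moreover have "inv_into (Arr (Adel B)) (arr_map (Adel_dual B))
      (arr_map (Adel_fctr (op_cat B) F) (arr_map (Adel_dual A) c)) = arr_map (Adel_fctr B F) c"
    if "c \<in> Arr (Adel A)" for c
    using that inv_into_f_f[OF inj(1) G.arr_map_simps(1)] by (simp flip: Adel_dual_fctr)
  ultimately show ?thesis
    by (simp add: fctr_eq_def op_fctr_def comp_fctr_def inv_fctr_def)
qed

end


section \<open>The inclusion functor and induced transformations\<close>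

lemma cat_functor_comp:
  assumes "cat_functor A B F" and "cat_functor B C G"
  shows "cat_functor A C (comp_fctr G F)"
proof -
  interpret F: cat_functor A B F
    by (rule assms)
  interpret G: cat_functor B C G
    by (rule assms)
  show ?thesis
  proof
    show "arr_map (comp_fctr G F) (f \<cdot>\<^bsub>A\<^esub> g) = arr_map (comp_fctr G F) f \<cdot>\<^bsub>C\<^esub> arr_map (comp_fctr G F) g"
      if "f \<in> Hom A X Y" and "g \<in> Hom A Y Z" for f g X Y Z
      using that by (simp add: comp_fctr_def Hom_iff)
  qed (auto simp: comp_fctr_def F.obj_map_Ob G.obj_map_Ob F.arr_map_Ident G.arr_map_Ident
      intro: F.arr_map_Hom G.arr_map_Hom)
qed

lemma obj_map_Adel_inclusion [simp]:
  "obj_map (Adel_inclusion C) X = Diag (ZeroArr C (ZeroOb C) X) (ZeroArr C X (ZeroOb C))"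
  by (simp add: Adel_inclusion_def Let_def)

lemma arr_map_Adel_inclusion [simp]:
  "arr_map (Adel_inclusion C) f = adel_class C
     (DMor (obj_map (Adel_inclusion C) (Dom C f)) (obj_map (Adel_inclusion C) (Cod C f))
       (ZeroArr C (ZeroOb C) (ZeroOb C)) f (ZeroArr C (ZeroOb C) (ZeroOb C)))"
  by (simp add: Adel_inclusion_def Let_def)

context base_category
begin

lemma category_Adel: "category (Adel C)"
  using additive_Adel by (simp add: additive_category_def preadditive_category_def)

text \<open>The inclusion functor has zero arrows at the outer vertices, where the identity of a
  diagram has identities; at the chosen zero object the two agree.\<close>

lemma Ident_ZeroOb: "Ident C (ZeroOb C) = ZeroArr C (ZeroOb C) (ZeroOb C)"
  using ZeroOb_unique[of "Ident C (ZeroOb C)"] by simp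

lemma Adel_inclusion_functor: "cat_functor C (Adel C) (Adel_inclusion C)"
proof (intro cat_functor.intro cat_functor_axioms.intro)
  let ?I = "Adel_inclusion C" and ?z = "ZeroArr C (ZeroOb C) (ZeroOb C)"
  show "category C" "category (Adel C)"
    by (rule category_axioms category_Adel)+
  show "obj_map ?I X \<in> Ob (Adel C)" if "X \<in> Ob C" for X
    using that by (simp add: diagrams_iff)
  have arr: "DMor (obj_map ?I (Dom C f)) (obj_map ?I (Cod C f)) ?z f ?z \<in> diagram_morphisms C"
    if "f \<in> Arr C" for f
    using that by (simp add: diagram_morphisms_iff diagrams_iff)
  show "arr_map ?I f \<in> Hom (Adel C) (obj_map ?I X) (obj_map ?I Y)" if "f \<in> Hom C X Y" for f X Y
    using that arr[of f] by (auto simp: Hom_iff)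
  show "arr_map ?I (Ident C X) = Ident (Adel C) (obj_map ?I X)" if "X \<in> Ob C" for X
    using that by (simp add: Ident_ZeroOb)
  show "arr_map ?I (f \<cdot> g) = arr_map ?I f \<cdot>\<^bsub>Adel C\<^esub> arr_map ?I g"
    if "f \<in> Hom C X Y" and "g \<in> Hom C Y Z" for f g X Y Z
    using that arr[of f] arr[of g] by (auto simp: Hom_iff)
qed

text \<open>The isomorphisms constructed below are already invertible as morphisms of diagrams, so
  no homotopies enter.\<close>

lemma iso_arrow_AdelI:
  assumes "f \<in> diagram_morphisms C" and "g \<in> diagram_morphisms C"
    and "src g = tgt f" and "tgt g = src f"
    and "f \<cdot>\<^bsub>Delta2 C\<^esub> g = Ident (Delta2 C) (src f)" and "g \<cdot>\<^bsub>Delta2 C\<^esub> f = Ident (Delta2 C) (tgt f)"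
  shows "iso_arrow (Adel C) (adel_class C f)"
  using assms
  by (intro category.iso_arrowI[OF category_Adel, of _ "src f" "tgt f" "adel_class C g"])
    (simp_all add: Hom_iff del: Delta2_simps(5,6))

end

section \<open>Comparison with the inclusion functors\<close>

context base_functor
begin

text \<open>The image of \<open>ZeroOb A\<close> may differ from \<open>ZeroOb B\<close>, but its
  identity is still zero; for this reason the outer components of \<open>Adel_epsilon\<close> are
  invertible.\<close>

lemma image_ZeroOb:
  "Ident B (obj_map F (ZeroOb A)) = ZeroArr B (obj_map F (ZeroOb A)) (obj_map F (ZeroOb A))"
  using arr_map_Ident[of "ZeroOb A"] A.Ident_ZeroOb by simp

lemma Adel_fctr_functor: "cat_functor (Adel A) (Adel B) (Adel_fctr B F)"
  using Adel_fctr_additive by (simp add: additive_functor_def)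

lemma Adel_epsilon_nat_iso:
  "nat_iso A (Adel B) (comp_fctr (Adel_inclusion B) F) (comp_fctr (Adel_fctr B F) (Adel_inclusion A))
    (Adel_epsilon A B F)"
proof -
  let ?I = "Adel_inclusion A" and ?J = "Adel_inclusion B" and ?FZ = "obj_map F (ZeroOb A)"
  let ?e = "\<lambda>S. DMor (obj_map ?J (obj_map F S)) (diag_image F (obj_map ?I S))
      (ZeroArr B (ZeroOb B) ?FZ) (Ident B (obj_map F S)) (ZeroArr B (ZeroOb B) ?FZ)"
  \<comment> \<open>The inverse: an identity in the middle and zero arrows in the other direction.
    Both composites are identities because the identities of \<open>ZeroOb B\<close> and of
    \<open>?FZ\<close> are zero.\<close>
  let ?d = "\<lambda>S. DMor (diag_image F (obj_map ?I S)) (obj_map ?J (obj_map F S))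
      (ZeroArr B ?FZ (ZeroOb B)) (Ident B (obj_map F S)) (ZeroArr B ?FZ (ZeroOb B))"
  have e: "Adel_epsilon A B F S = adel_class B (?e S)" for S
    by (simp add: Adel_epsilon_def)
  have FZ: "?FZ \<in> Ob B"
    by (simp add: obj_map_Ob)
  have e_arr: "?e S \<in> diagram_morphisms B" and d_arr: "?d S \<in> diagram_morphisms B"
    if "S \<in> Ob A" for S
    using that FZ by (simp_all add: diagram_morphisms_iff diagrams_iff obj_map_Ob)
  have inc_arr: "DMor (obj_map ?I (Dom A f)) (obj_map ?I (Cod A f)) (ZeroArr A (ZeroOb A) (ZeroOb A)) f
      (ZeroArr A (ZeroOb A) (ZeroOb A)) \<in> diagram_morphisms A" (is "?i f \<in> _") if "f \<in> Arr A" for f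
    using that by (simp add: diagram_morphisms_iff diagrams_iff)
  have inc_arr': "DMor (obj_map ?J (Dom B f)) (obj_map ?J (Cod B f)) (ZeroArr B (ZeroOb B) (ZeroOb B)) f
      (ZeroArr B (ZeroOb B) (ZeroOb B)) \<in> diagram_morphisms B" (is "?j f \<in> _") if "f \<in> Arr B" for f
    using that by (simp add: diagram_morphisms_iff diagrams_iff)
  show ?thesis
  proof (intro nat_iso.intro nat_trans.intro nat_trans_axioms.intro nat_iso_axioms.intro)
    show "cat_functor A (Adel B) (comp_fctr ?J F)"
      by (rule cat_functor_comp[OF cat_functor_axioms B.Adel_inclusion_functor])
    show "cat_functor A (Adel B) (comp_fctr (Adel_fctr B F) ?I)"
      by (rule cat_functor_comp[OF A.Adel_inclusion_functor Adel_fctr_functor])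
    show "Adel_epsilon A B F S \<in> Hom (Adel B) (obj_map (comp_fctr ?J F) S)
        (obj_map (comp_fctr (Adel_fctr B F) ?I) S)" if "S \<in> Ob A" for S
      unfolding e using e_arr[OF that] by (simp add: Hom_iff comp_fctr_def)
    show "arr_map (comp_fctr ?J F) f \<cdot>\<^bsub>Adel B\<^esub> Adel_epsilon A B F T =
        Adel_epsilon A B F S \<cdot>\<^bsub>Adel B\<^esub> arr_map (comp_fctr (Adel_fctr B F) ?I) f"
      if "f \<in> Hom A S T" for f S T
    proof -
      have f: "f \<in> Arr A" "Dom A f = S" "Cod A f = T" "S \<in> Ob A" "T \<in> Ob A"
        using that A.Arr_Ob[of f] by (auto simp: Hom_iff)
      have "arr_map (comp_fctr ?J F) f = adel_class B (?j (arr_map F f))"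
        by (simp add: comp_fctr_def)
      moreover have "arr_map (comp_fctr (Adel_fctr B F) ?I) f = adel_class B (dmor_image F (?i f))"
        using inc_arr[OF f(1)] by (simp add: comp_fctr_def)
      moreover have "?j (arr_map F f) \<cdot>\<^bsub>Delta2 B\<^esub> ?e T = ?e S \<cdot>\<^bsub>Delta2 B\<^esub> dmor_image F (?i f)"
        using f FZ by (intro dmor_eqI) (simp_all add: obj_map_Ob)
      ultimately show ?thesis
        using f e_arr[of S] e_arr[of T] inc_arr'[of "arr_map F f"]
          dmor_image_diagram_morphisms[OF inc_arr[OF f(1)]]
        by (simp add: e del: Delta2_simps(6))
    qed
    show "iso_arrow (Adel B) (Adel_epsilon A B F S)" if S: "S \<in> Ob A" for S
      unfolding e
    proof (rule B.iso_arrow_AdelI[OF e_arr[OF S] d_arr[OF S]])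
      show "?e S \<cdot>\<^bsub>Delta2 B\<^esub> ?d S = Ident (Delta2 B) (src (?e S))"
        using S FZ by (intro dmor_eqI) (simp_all add: obj_map_Ob B.Ident_ZeroOb)
      show "?d S \<cdot>\<^bsub>Delta2 B\<^esub> ?e S = Ident (Delta2 B) (tgt (?e S))"
        using S FZ by (intro dmor_eqI) (simp_all add: obj_map_Ob image_ZeroOb)
    qed simp_all
  qed
qed

text \<open>Since \<open>F\<close> preserves zero arrows, matching zero objects make the diagrams
  and triples of both composites literally equal.\<close>

lemma Adel_fctr_inclusion_eq:
  assumes "obj_map F (ZeroOb A) = ZeroOb B"
  shows "fctr_eq A (comp_fctr (Adel_inclusion B) F) (comp_fctr (Adel_fctr B F) (Adel_inclusion A))"
  unfolding fctr_eq_def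
proof (intro conjI ballI)
  show "obj_map (comp_fctr (Adel_inclusion B) F) X = obj_map (comp_fctr (Adel_fctr B F) (Adel_inclusion A)) X"
    if "X \<in> Ob A" for X
    using that by (simp add: comp_fctr_def diag_image_def assms)
  show "arr_map (comp_fctr (Adel_inclusion B) F) f = arr_map (comp_fctr (Adel_fctr B F) (Adel_inclusion A)) f"
    if "f \<in> Arr A" for f
  proof -
    have "DMor (obj_map (Adel_inclusion A) (Dom A f)) (obj_map (Adel_inclusion A) (Cod A f))
        (ZeroArr A (ZeroOb A) (ZeroOb A)) f (ZeroArr A (ZeroOb A) (ZeroOb A)) \<in> diagram_morphisms A"
      using that by (simp add: diagram_morphisms_iff diagrams_iff)
    then show ?thesis
      using that by (simp add: comp_fctr_def dmor_image_def diag_image_def assms)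
  qed
qed

end

section \<open>Induced natural transformations\<close>

lemma (in nat_trans) naturality':
  assumes "f \<in> Arr A"
  shows "arr_map F f \<cdot>\<^bsub>B\<^esub> \<alpha> (Cod A f) = \<alpha> (Dom A f) \<cdot>\<^bsub>B\<^esub> arr_map G f"
  using naturality[OF arr_in_Hom[OF assms]] .

lemma (in nat_trans) component_simps:
  assumes "X \<in> Ob A"
  shows "\<alpha> X \<in> Arr B" and "Dom B (\<alpha> X) = obj_map F X" and "Cod B (\<alpha> X) = obj_map G X"
  using component_Hom[OF assms] by (simp_all add: Hom_iff)

context
  fixes A :: "('o, 'm) addcat" and B :: "('p, 'n) addcat" and F G \<alpha>
  assumes F: "additive_functor A B F" and G: "additive_functor A B G" and \<alpha>: "nat_trans A B F G \<alpha>"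
begin

interpretation F: additive_functor A B F
  by (rule F)
interpretation G: additive_functor A B G
  by (rule G)
interpretation F: base_functor A B F
  by (simp add: base_functor_def base_category_def F F.A.additive_category_axioms F.B.additive_category_axioms)
interpretation G: base_functor A B G
  by (simp add: base_functor_def base_category_def G F.A.additive_category_axioms F.B.additive_category_axioms)
interpretation nat_trans A B F G \<alpha>
  by (rule \<alpha>)

abbreviation nat_image :: "'m diag \<Rightarrow> 'n dmor" where
  "nat_image X \<equiv> DMor (diag_image F X) (diag_image G X)
     (\<alpha> (Dom A (edge0 X))) (\<alpha> (Cod A (edge0 X))) (\<alpha> (Cod A (edge1 X)))"

lemma Adel_nat_eq: "Adel_nat A B F G \<alpha> X = adel_class B (nat_image X)"
  by (simp add: Adel_nat_def vert0_def vert1_def vert2_def)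

text \<open>The two squares are naturality of \<open>\<alpha>\<close> at the two edges of the
  diagram.\<close>

lemma nat_image_arr:
  assumes "X \<in> diagrams A"
  shows "nat_image X \<in> diagram_morphisms B"
  using assms naturality'[of "edge0 X"] naturality'[of "edge1 X"]
  by (simp add: diagram_morphisms_iff diagrams_iff component_simps)

lemma Adel_nat_nat_trans:
  "nat_trans (Adel A) (Adel B) (Adel_fctr B F) (Adel_fctr B G) (Adel_nat A B F G \<alpha>)"
proof (intro nat_trans.intro nat_trans_axioms.intro)
  show "cat_functor (Adel A) (Adel B) (Adel_fctr B F)" "cat_functor (Adel A) (Adel B) (Adel_fctr B G)"
    by (rule F.Adel_fctr_functor G.Adel_fctr_functor)+
  show "Adel_nat A B F G \<alpha> X \<in> Hom (Adel B) (obj_map (Adel_fctr B F) X) (obj_map (Adel_fctr B G) X)"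
    if "X \<in> Ob (Adel A)" for X
    using that nat_image_arr[of X] by (simp add: Adel_nat_eq Hom_iff)
  show "arr_map (Adel_fctr B F) c \<cdot>\<^bsub>Adel B\<^esub> Adel_nat A B F G \<alpha> Y =
      Adel_nat A B F G \<alpha> X \<cdot>\<^bsub>Adel B\<^esub> arr_map (Adel_fctr B G) c"
    if "c \<in> Hom (Adel A) X Y" for c X Y
  proof -
    obtain f where f: "f \<in> diagram_morphisms A" "src f = X" "tgt f = Y" "c = adel_class A f"
      using \<open>c \<in> Hom (Adel A) X Y\<close> by (rule F.A.HomAdel_E)
    note fD = diagram_morphismD[OF f(1), unfolded f(2,3)]
    have XY: "X \<in> diagrams A" "Y \<in> diagrams A"
      using fD by (simp_all add: diagrams_iff)
    have "dmor_image F f \<cdot>\<^bsub>Delta2 B\<^esub> nat_image Y = nat_image X \<cdot>\<^bsub>Delta2 B\<^esub> dmor_image G f"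
      using fD f(2,3) naturality'[of "comp0 f"] naturality'[of "comp1 f"] naturality'[of "comp2 f"]
      by (intro dmor_eqI) simp_all
    then show ?thesis
      using f XY nat_image_arr[of X] nat_image_arr[of Y]
      by (simp add: Adel_nat_eq F.dmor_image_diagram_morphisms G.dmor_image_diagram_morphisms
          del: Delta2_simps(6))
  qed
qed

lemma Adel_nat_nat_iso:
  assumes "nat_iso A B F G \<alpha>"
  shows "nat_iso (Adel A) (Adel B) (Adel_fctr B F) (Adel_fctr B G) (Adel_nat A B F G \<alpha>)"
proof (intro nat_iso.intro nat_iso_axioms.intro)
  show "nat_trans (Adel A) (Adel B) (Adel_fctr B F) (Adel_fctr B G) (Adel_nat A B F G \<alpha>)"
    by (rule Adel_nat_nat_trans)
  have "\<exists>b. b \<in> Hom B (obj_map G X) (obj_map F X) \<and>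
      \<alpha> X \<cdot>\<^bsub>B\<^esub> b = Ident B (obj_map F X) \<and> b \<cdot>\<^bsub>B\<^esub> \<alpha> X = Ident B (obj_map G X)" if "X \<in> Ob A" for X
    using nat_iso.component_iso[OF assms that] component_simps[OF that] by (auto simp: iso_arrow_def)
  \<comment> \<open>A simultaneous choice of inverses. Their naturality, proved next, is what makes
    the triple \<open>?b\<close> below a morphism of diagrams.\<close>
  then obtain \<beta> where "\<And>X. X \<in> Ob A \<Longrightarrow> \<beta> X \<in> Hom B (obj_map G X) (obj_map F X) \<and>
      \<alpha> X \<cdot>\<^bsub>B\<^esub> \<beta> X = Ident B (obj_map F X) \<and> \<beta> X \<cdot>\<^bsub>B\<^esub> \<alpha> X = Ident B (obj_map G X)"
    by metis
  then have \<beta>: "\<beta> X \<in> Arr B" "Dom B (\<beta> X) = obj_map G X" "Cod B (\<beta> X) = obj_map F X"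
    "\<alpha> X \<cdot>\<^bsub>B\<^esub> \<beta> X = Ident B (obj_map F X)" "\<beta> X \<cdot>\<^bsub>B\<^esub> \<alpha> X = Ident B (obj_map G X)"
    if "X \<in> Ob A" for X
    using that by (auto simp: Hom_iff)
  have \<beta>_nat: "arr_map G f \<cdot>\<^bsub>B\<^esub> \<beta> (Cod A f) = \<beta> (Dom A f) \<cdot>\<^bsub>B\<^esub> arr_map F f" if f: "f \<in> Arr A" for f
  proof -
    let ?X = "Dom A f" and ?Y = "Cod A f"
    have X: "?X \<in> Ob A" and Y: "?Y \<in> Ob A"
      using f by simp_all
    note arrs = \<beta>[OF X] \<beta>[OF Y] component_simps[OF X] component_simps[OF Y] f
    \<comment> \<open>An identity \<open>\<beta> \<alpha>\<close> is inserted in front; naturality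
      moves \<open>\<alpha>\<close> behind the arrow, where it cancels against the other
      \<open>\<beta>\<close>.\<close>
    have "arr_map G f \<cdot>\<^bsub>B\<^esub> \<beta> ?Y = (\<beta> ?X \<cdot>\<^bsub>B\<^esub> \<alpha> ?X) \<cdot>\<^bsub>B\<^esub> (arr_map G f \<cdot>\<^bsub>B\<^esub> \<beta> ?Y)"
      by (simp add: arrs)
    also have "\<dots> = \<beta> ?X \<cdot>\<^bsub>B\<^esub> ((\<alpha> ?X \<cdot>\<^bsub>B\<^esub> arr_map G f) \<cdot>\<^bsub>B\<^esub> \<beta> ?Y)"
      using arrs(1-3,6-8,11-) by (simp add: F.B.Comp_Comp)
    also have "\<dots> = \<beta> ?X \<cdot>\<^bsub>B\<^esub> (arr_map F f \<cdot>\<^bsub>B\<^esub> (\<alpha> ?Y \<cdot>\<^bsub>B\<^esub> \<beta> ?Y))"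
      unfolding naturality'[OF f, symmetric] using arrs(1-3,6-8,11-) by (simp add: F.B.Comp_Comp)
    also have "\<dots> = \<beta> ?X \<cdot>\<^bsub>B\<^esub> arr_map F f"
      by (simp add: arrs)
    finally show ?thesis .
  qed
  show "iso_arrow (Adel B) (Adel_nat A B F G \<alpha> X)" if "X \<in> Ob (Adel A)" for X
    unfolding Adel_nat_eq
  proof (rule F.B.iso_arrow_AdelI)
    have X: "X \<in> diagrams A"
      using that by simp
    let ?b = "DMor (diag_image G X) (diag_image F X)
      (\<beta> (Dom A (edge0 X))) (\<beta> (Cod A (edge0 X))) (\<beta> (Cod A (edge1 X)))"
    show "nat_image X \<in> diagram_morphisms B"
      by (rule nat_image_arr[OF X])
    show "?b \<in> diagram_morphisms B"
      using X \<beta>_nat[of "edge0 X"] \<beta>_nat[of "edge1 X"]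
      by (simp add: diagram_morphisms_iff diagrams_iff \<beta>)
    show "nat_image X \<cdot>\<^bsub>Delta2 B\<^esub> ?b = Ident (Delta2 B) (src (nat_image X))"
      "?b \<cdot>\<^bsub>Delta2 B\<^esub> nat_image X = Ident (Delta2 B) (tgt (nat_image X))"
      using X by (auto intro!: dmor_eqI simp: diagrams_iff \<beta>)
  qed simp_all
qed

end

theorem mainTheorem2:
  fixes A :: "('o, 'm) addcat" and B :: "('p, 'n) addcat"
  assumes "additive_category A" and "additive_category B"
  shows
    "(\<forall>F. additive_functor A B F \<longrightarrow>
        (\<forall>x0 x1. Diag x0 x1 \<in> Ob (Adel A) \<longrightarrow>
           obj_map (Adel_fctr B F) (Diag x0 x1) = Diag (arr_map F x0) (arr_map F x1)) \<and>
        (\<forall>X Y f0 f1 f2. DMor X Y f0 f1 f2 \<in> Arr (Delta2 A) \<longrightarrow>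
           DMor (obj_map (Adel_fctr B F) X) (obj_map (Adel_fctr B F) Y)
             (arr_map F f0) (arr_map F f1) (arr_map F f2) \<in> Arr (Delta2 B) \<and>
           arr_map (Adel_fctr B F) (adel_class A (DMor X Y f0 f1 f2)) =
           adel_class B (DMor (obj_map (Adel_fctr B F) X) (obj_map (Adel_fctr B F) Y)
             (arr_map F f0) (arr_map F f1) (arr_map F f2))) \<and>
        exact_functor (Adel A) (Adel B) (Adel_fctr B F) \<and>
        fctr_eq (op_cat (Adel A))
          (op_fctr (Adel_fctr B F))
          (comp_fctr (inv_fctr (op_cat (Adel B)) (Adel_dual B))
            (comp_fctr (Adel_fctr (op_cat B) (op_fctr F)) (Adel_dual A))) \<and>
        nat_iso A (Adel B)
          (comp_fctr (Adel_inclusion B) F)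
          (comp_fctr (Adel_fctr B F) (Adel_inclusion A))
          (Adel_epsilon A B F) \<and>
        (obj_map F (ZeroOb A) = ZeroOb B \<longrightarrow>
          fctr_eq A
            (comp_fctr (Adel_inclusion B) F)
            (comp_fctr (Adel_fctr B F) (Adel_inclusion A))))
     \<and>
     (\<forall>F G \<alpha>. additive_functor A B F \<and> additive_functor A B G \<and> nat_trans A B F G \<alpha> \<longrightarrow>
        nat_trans (Adel A) (Adel B) (Adel_fctr B F) (Adel_fctr B G) (Adel_nat A B F G \<alpha>) \<and>
        (nat_iso A B F G \<alpha> \<longrightarrow>
          nat_iso (Adel A) (Adel B) (Adel_fctr B F) (Adel_fctr B G) (Adel_nat A B F G \<alpha>)))"
proof (intro conjI allI impI; (elim conjE)?)
  fix F
  assume "additive_functor A B F"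
  then interpret base_functor A B F
    using assms by (simp add: base_functor_def base_category_def)
  show "obj_map (Adel_fctr B F) (Diag x0 x1) = Diag (arr_map F x0) (arr_map F x1)" for x0 x1
    by (simp add: diag_image_def)
  fix X Y f0 f1 f2
  assume "DMor X Y f0 f1 f2 \<in> Arr (Delta2 A)"
  then have f: "DMor X Y f0 f1 f2 \<in> diagram_morphisms A"
    by simp
  have eq: "DMor (obj_map (Adel_fctr B F) X) (obj_map (Adel_fctr B F) Y)
      (arr_map F f0) (arr_map F f1) (arr_map F f2) = dmor_image F (DMor X Y f0 f1 f2)"
    by (simp add: dmor_image_def)
  show "DMor (obj_map (Adel_fctr B F) X) (obj_map (Adel_fctr B F) Y)
      (arr_map F f0) (arr_map F f1) (arr_map F f2) \<in> Arr (Delta2 B)"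
    unfolding eq using dmor_image_diagram_morphisms[OF f] by simp
  show "arr_map (Adel_fctr B F) (adel_class A (DMor X Y f0 f1 f2)) =
      adel_class B (DMor (obj_map (Adel_fctr B F) X) (obj_map (Adel_fctr B F) Y)
        (arr_map F f0) (arr_map F f1) (arr_map F f2))"
    unfolding eq by (rule Adel_fctr_class[OF f])
next
  fix F
  assume "additive_functor A B F"
  then interpret base_functor A B F
    using assms by (simp add: base_functor_def base_category_def)
  show "exact_functor (Adel A) (Adel B) (Adel_fctr B F)"
    by (rule Adel_fctr_exact)
  show "fctr_eq (op_cat (Adel A)) (op_fctr (Adel_fctr B F))
      (comp_fctr (inv_fctr (op_cat (Adel B)) (Adel_dual B))
        (comp_fctr (Adel_fctr (op_cat B) (op_fctr F)) (Adel_dual A)))"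
    by (rule Adel_fctr_op)
  show "nat_iso A (Adel B) (comp_fctr (Adel_inclusion B) F) (comp_fctr (Adel_fctr B F) (Adel_inclusion A))
      (Adel_epsilon A B F)"
    by (rule Adel_epsilon_nat_iso)
  show "fctr_eq A (comp_fctr (Adel_inclusion B) F) (comp_fctr (Adel_fctr B F) (Adel_inclusion A))"
    if "obj_map F (ZeroOb A) = ZeroOb B"
    using that by (rule Adel_fctr_inclusion_eq)
next
  fix F G \<alpha>
  assume F: "additive_functor A B F" and G: "additive_functor A B G" and \<alpha>: "nat_trans A B F G \<alpha>"
  show "nat_trans (Adel A) (Adel B) (Adel_fctr B F) (Adel_fctr B G) (Adel_nat A B F G \<alpha>)"
    by (rule Adel_nat_nat_trans[OF F G \<alpha>])
  show "nat_iso (Adel A) (Adel B) (Adel_fctr B F) (Adel_fctr B G) (Adel_nat A B F G \<alpha>)"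
    if "nat_iso A B F G \<alpha>"
    by (rule Adel_nat_nat_iso[OF F G \<alpha> that])
qed

end
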